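(* Let $\lambda>0$, $\ell>0$ and $n_{\lambda,\ell}:=\left\lceil \sqrt{\lambda\ell^2/\hat\lambda}\,\right\rceil$. Suppose that $\gamma\in A_\ell$ is a penalized pinned elastica. Then either $\gamma$ is (a parametrization of) the line segment from $(0,0)$ to $(\ell,0)$, or, up to reflection across the $x$-axis and reparametrization, $\gamma$ is one of the following: (i) the $(\lambda,\ell,n)$-shorter arc $\gamma_{\rm sarc}^{\lambda,\ell,n}$ for some integer $n\ge n_{\lambda,\ell}$; (ii) the $(\lambda,\ell,n)$-longer arc $\gamma_{\rm larc}^{\lambda,\ell,n}$ for some integer $n\ge n_{\lambda,\ell}$; (iii) the $(\lambda,\ell,n)$-loop $\gamma_{\rm loop}^{\lambda,\ell,n}$ for some integer $n\ge1$.
   Context: Elliptic functions: for $q\in[0,1)$, $x\in\mathbb{R}$, $\mathrm{F}(x,q)=\int_0^x(1-q^2\sin^2\theta)^{-1/2}\,d\theta$, $\mathrm{E}(x,q)=\int_0^x(1-q^2\sin^2\theta)^{1/2}\,d\theta$, $\mathrm{K}(q)=\mathrm{F}(\pi/2,q)$, $\mathrm{E}(q)=\mathrm{E}(\pi/2,q)$; $\mathrm{am}(\cdot,q)$ is the inverse function of $x\mapsto\mathrm{F}(x,q)$, and $\mathrm{cn}(x,q)=\cos\mathrm{am}(x,q)$. The function $q\mapsto2\mathrm{E}(q)-\mathrm{K}(q)$ is strictly decreasing on $[0,1)$ with a unique zero $q_*\in(0,1)$. On $[1/\sqrt2,1)$ let $f(q)=(4q^4-5q^2+1)\mathrm{K}(q)+(-8q^4+8q^2-1)\mathrm{E}(q)$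 and $g(q)=8(2\mathrm{E}(q)-\mathrm{K}(q))^2(2q^2-1)$. The function $f$ has a unique zero $\hat q\in[1/\sqrt2,1)$ (it lies in $(1/\sqrt2,q_* )$, $\hat q\approx0.79257$); set $\hat\lambda:=g(\hat q)\approx0.70107$. One has $g(1/\sqrt2)=0$, $g$ strictly increasing on $[1/\sqrt2,\hat q]$, strictly decreasing on $[\hat q,q_*]$ with $g(q_* )=0$, and strictly increasing on $[q_*,1)$ with $g(q)\to\infty$ as $q\to1$. For $c\in(0,\hat\lambda]$ let $q_1(c)\in(1/\sqrt2,\hat q]$, $q_2(c)\in[\hat q,q_* )$, $q_3(c)\in(q_*,1)$ be the solutions of $g(q)=c$ in these intervals ($q_1(\hat\lambda)=q_2(\hat\lambda)=\hat q$); for $c>\hat\lambda$ let $q_3(c)$ be the unique solution of $g(q)=c$ in $(q_*,1)$. Setting: $W^{2,2}_{\rm imm}(0,1;\mathbb{R}^2)=\{\gamma\in W^{2,2}(0,1;\mathbb{R}^2): |\gamma'(x)|\neq0\ \forall x\in[0,1]\}$, $A_\ell=\{\gamma\in W^{2,2}_{\rm imm}(0,1;\mathbb{R}^2):\gamma(0)=(0,0),\ \gamma(1)=(\ell,0)\}$. For an immersed planar curve, $k$ is its signed curvature, $s$ arclength, $B[\gamma]=\int_\gamma k^2\,ds$, $L[\gamma]$ its length, and $\mathcal{E}_\lambda[\gamma]=B[\gamma]+\lambda L[\gamma]$. A penalized pinned elastica is a $\gamma\in A_\ell$ with $\frac{d}{d\varepsilon}\mathcal{E}_\lambda[\gamma+\varepsilon\eta]\big|_{\varepsilon=0}=0$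 for all $\eta\in W^{2,2}(0,1;\mathbb{R}^2)\cap W^{1,2}_0(0,1;\mathbb{R}^2)$. Special curves (arclength parametrized on $[0,2n\mathrm{K}(q)/\alpha]$): for an integer $n\ge n_{\lambda,\ell}$, $\gamma_{\rm sarc}^{\lambda,\ell,n}(s)=\frac1\alpha\big(2\mathrm{E}(\mathrm{am}(\alpha s-\mathrm{K}(q),q),q)+2\mathrm{E}(q)-\alpha s,\ 2q\,\mathrm{cn}(\alpha s-\mathrm{K}(q),q)\big)$ with $q=q_1(\lambda\ell^2/n^2)$ and $\alpha=\frac{2n}{\ell}(2\mathrm{E}(q)-\mathrm{K}(q))$; $\gamma_{\rm larc}^{\lambda,\ell,n}$ is given by the same formula with $q=q_2(\lambda\ell^2/n^2)$ and $\alpha=\frac{2n}{\ell}(2\mathrm{E}(q)-\mathrm{K}(q))$; for an integer $n\ge1$, $\gamma_{\rm loop}^{\lambda,\ell,n}(s)=\frac1\alpha\big(-2\mathrm{E}(\mathrm{am}(\alpha s-\mathrm{K}(q),q),q)-2\mathrm{E}(q)+\alpha s,\ 2q\,\mathrm{cn}(\alpha s-\mathrm{K}(q),q)\big)$ with $q=q_3(\lambda\ell^2/n^2)$ and $\alpha=\frac{2n}{\ell}(\mathrm{K}(q)-2\mathrm{E}(q))$. *)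

theory Defs
  imports "HOL-Analysis.Analysis"
begin

definition ellF :: "real \<Rightarrow> real \<Rightarrow> real" where
  "ellF x q = (if 0 \<le> x then integral {0..x} (\<lambda>\<theta>. 1 / sqrt (1 - q\<^sup>2 * (sin \<theta>)\<^sup>2))
               else - integral {x..0} (\<lambda>\<theta>. 1 / sqrt (1 - q\<^sup>2 * (sin \<theta>)\<^sup>2)))"

definition ellE :: "real \<Rightarrow> real \<Rightarrow> real" where
  "ellE x q = (if 0 \<le> x then integral {0..x} (\<lambda>\<theta>. sqrt (1 - q\<^sup>2 * (sin \<theta>)\<^sup>2))
               else - integral {x..0} (\<lambda>\<theta>. sqrt (1 - q\<^sup>2 * (sin \<theta>)\<^sup>2)))"

definition ellK :: "real \<Rightarrow> real" where "ellK q = ellF (pi/2) q"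
definition ellEc :: "real \<Rightarrow> real" where "ellEc q = ellE (pi/2) q"

definition jam :: "real \<Rightarrow> real \<Rightarrow> real" where "jam u q = (THE x. ellF x q = u)"
definition jcn :: "real \<Rightarrow> real \<Rightarrow> real" where "jcn u q = cos (jam u q)"

definition qstar :: real where
  "qstar = (THE q. 0 \<le> q \<and> q < 1 \<and> 2 * ellEc q - ellK q = 0)"

definition ff :: "real \<Rightarrow> real" where
  "ff q = (4*q^4 - 5*q\<^sup>2 + 1) * ellK q + (-8*q^4 + 8*q\<^sup>2 - 1) * ellEc q"

definition gg :: "real \<Rightarrow> real" where
  "gg q = 8 * (2 * ellEc q - ellK q)\<^sup>2 * (2*q\<^sup>2 - 1)"

definition qhat :: real where
  "qhat = (THE q. 1/sqrt 2 \<le> q \<and> q < 1 \<and> ff q = 0)"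

definition lamhat :: real where "lamhat = gg qhat"

definition q1 :: "real \<Rightarrow> real" where
  "q1 c = (THE q. 1/sqrt 2 < q \<and> q \<le> qhat \<and> gg q = c)"
definition q2 :: "real \<Rightarrow> real" where
  "q2 c = (THE q. qhat \<le> q \<and> q < qstar \<and> gg q = c)"
definition q3 :: "real \<Rightarrow> real" where
  "q3 c = (THE q. qstar < q \<and> q < 1 \<and> gg q = c)"

definition n_lam :: "real \<Rightarrow> real \<Rightarrow> int" where
  "n_lam lam l = \<lceil>sqrt (lam * l\<^sup>2 / lamhat)\<rceil>"

text \<open>First and second derivative on [0,1] (one-sided at the end points).
  For W^{2,2} curves the second derivative exists almost everywhere and agrees a.e.
  with the weak one, which suffices inside the integrals below.\<close>
definition d1 :: "(real \<Rightarrow> real \<times> real) \<Rightarrow> real \<Rightarrow> real \<times> real" where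
  "d1 \<gamma> x = vector_derivative \<gamma> (at x within {0..1})"
definition d2 :: "(real \<Rightarrow> real \<times> real) \<Rightarrow> real \<Rightarrow> real \<times> real" where
  "d2 \<gamma> x = vector_derivative (d1 \<gamma>) (at x within {0..1})"

text \<open>W^{2,2}(0,1;R^2) (continuous representative): \<gamma> is C^1 on [0,1] and its derivative is
  the indefinite integral of an L^2 function.\<close>
definition W22 :: "(real \<Rightarrow> real \<times> real) \<Rightarrow> bool" where
  "W22 \<gamma> \<longleftrightarrow> (\<exists>v g. (\<forall>x\<in>{0..1}. (\<gamma> has_vector_derivative v x) (at x within {0..1}))
      \<and> set_integrable lborel {0..1} g
      \<and> set_integrable lborel {0..1} (\<lambda>x. (norm (g x))\<^sup>2)
      \<and> (\<forall>x\<in>{0..1}. v x = v 0 + (LINT t:{0..x}|lborel. g t)))"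

definition W22_imm :: "(real \<Rightarrow> real \<times> real) \<Rightarrow> bool" where
  "W22_imm \<gamma> \<longleftrightarrow> W22 \<gamma> \<and> (\<forall>x\<in>{0..1}. d1 \<gamma> x \<noteq> 0)"

definition A_adm :: "real \<Rightarrow> (real \<Rightarrow> real \<times> real) set" where
  "A_adm l = {\<gamma>. W22_imm \<gamma> \<and> \<gamma> 0 = (0,0) \<and> \<gamma> 1 = (l,0)}"

definition curv :: "(real \<Rightarrow> real \<times> real) \<Rightarrow> real \<Rightarrow> real" where
  "curv \<gamma> x = (fst (d1 \<gamma> x) * snd (d2 \<gamma> x) - snd (d1 \<gamma> x) * fst (d2 \<gamma> x)) / (norm (d1 \<gamma> x))^3"

definition bend :: "(real \<Rightarrow> real \<times> real) \<Rightarrow> real" where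
  "bend \<gamma> = integral {0..1} (\<lambda>x. (curv \<gamma> x)\<^sup>2 * norm (d1 \<gamma> x))"

definition len :: "(real \<Rightarrow> real \<times> real) \<Rightarrow> real" where
  "len \<gamma> = integral {0..1} (\<lambda>x. norm (d1 \<gamma> x))"

definition energy :: "real \<Rightarrow> (real \<Rightarrow> real \<times> real) \<Rightarrow> real" where
  "energy lam \<gamma> = bend \<gamma> + lam * len \<gamma>"

definition pen_pinned_elastica :: "real \<Rightarrow> real \<Rightarrow> (real \<Rightarrow> real \<times> real) \<Rightarrow> bool" where
  "pen_pinned_elastica lam l \<gamma> \<longleftrightarrow> \<gamma> \<in> A_adm l \<and>
     (\<forall>\<eta>. W22 \<eta> \<and> \<eta> 0 = 0 \<and> \<eta> 1 = 0 \<longrightarrow>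
        ((\<lambda>\<epsilon>. energy lam (\<lambda>x. \<gamma> x + \<epsilon> *\<^sub>R \<eta> x)) has_real_derivative 0) (at 0))"

section \<open>Special curves (arclength parametrized)\<close>

definition arc_curve :: "real \<Rightarrow> real \<Rightarrow> real \<Rightarrow> real \<times> real" where
  "arc_curve q al s = ((2 * ellE (jam (al * s - ellK q) q) q + 2 * ellEc q - al * s) / al,
                        2 * q * jcn (al * s - ellK q) q / al)"

definition loop_curve :: "real \<Rightarrow> real \<Rightarrow> real \<Rightarrow> real \<times> real" where
  "loop_curve q al s = ((- 2 * ellE (jam (al * s - ellK q) q) q - 2 * ellEc q + al * s) / al,
                         2 * q * jcn (al * s - ellK q) q / al)"

text \<open>Each special curve is given as (q, alpha); it lives on [0, 2 n K(q)/alpha].\<close>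
definition sarc_q :: "real \<Rightarrow> real \<Rightarrow> nat \<Rightarrow> real" where
  "sarc_q lam l n = q1 (lam * l\<^sup>2 / (real n)\<^sup>2)"
definition larc_q :: "real \<Rightarrow> real \<Rightarrow> nat \<Rightarrow> real" where
  "larc_q lam l n = q2 (lam * l\<^sup>2 / (real n)\<^sup>2)"
definition loop_q :: "real \<Rightarrow> real \<Rightarrow> nat \<Rightarrow> real" where
  "loop_q lam l n = q3 (lam * l\<^sup>2 / (real n)\<^sup>2)"

definition arc_alpha :: "real \<Rightarrow> nat \<Rightarrow> real \<Rightarrow> real" where
  "arc_alpha l n q = 2 * real n / l * (2 * ellEc q - ellK q)"
definition loop_alpha :: "real \<Rightarrow> nat \<Rightarrow> real \<Rightarrow> real" where
  "loop_alpha l n q = 2 * real n / l * (ellK q - 2 * ellEc q)"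

definition gamma_sarc :: "real \<Rightarrow> real \<Rightarrow> nat \<Rightarrow> real \<Rightarrow> real \<times> real" where
  "gamma_sarc lam l n = (let q = sarc_q lam l n in arc_curve q (arc_alpha l n q))"
definition gamma_larc :: "real \<Rightarrow> real \<Rightarrow> nat \<Rightarrow> real \<Rightarrow> real \<times> real" where
  "gamma_larc lam l n = (let q = larc_q lam l n in arc_curve q (arc_alpha l n q))"
definition gamma_loop :: "real \<Rightarrow> real \<Rightarrow> nat \<Rightarrow> real \<Rightarrow> real \<times> real" where
  "gamma_loop lam l n = (let q = loop_q lam l n in loop_curve q (loop_alpha l n q))"

definition sarc_len :: "real \<Rightarrow> real \<Rightarrow> nat \<Rightarrow> real" where
  "sarc_len lam l n = (let q = sarc_q lam l n in 2 * real n * ellK q / arc_alpha l n q)"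
definition larc_len :: "real \<Rightarrow> real \<Rightarrow> nat \<Rightarrow> real" where
  "larc_len lam l n = (let q = larc_q lam l n in 2 * real n * ellK q / arc_alpha l n q)"
definition loop_len :: "real \<Rightarrow> real \<Rightarrow> nat \<Rightarrow> real" where
  "loop_len lam l n = (let q = loop_q lam l n in 2 * real n * ellK q / loop_alpha l n q)"

definition reparam :: "(real \<Rightarrow> real) \<Rightarrow> real \<Rightarrow> bool" where
  "reparam \<phi> L \<longleftrightarrow> \<phi> 0 = 0 \<and> \<phi> 1 = L \<and>
     (\<forall>x\<in>{0..1}. \<exists>D. D > 0 \<and> (\<phi> has_real_derivative D) (at x within {0..1}))"

definition reflx :: "real \<times> real \<Rightarrow> real \<times> real" where
  "reflx p = (fst p, - snd p)"

definition same_curve_upto :: "(real \<Rightarrow> real \<times> real) \<Rightarrow> (real \<Rightarrow> real \<times> real) \<Rightarrow> real \<Rightarrow> bool" where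
  "same_curve_upto \<gamma> \<sigma> L \<longleftrightarrow> (\<exists>\<phi>. reparam \<phi> L \<and>
      ((\<forall>x\<in>{0..1}. \<gamma> x = \<sigma> (\<phi> x)) \<or> (\<forall>x\<in>{0..1}. \<gamma> x = reflx (\<sigma> (\<phi> x)))))"

definition is_segment :: "real \<Rightarrow> (real \<Rightarrow> real \<times> real) \<Rightarrow> bool" where
  "is_segment l \<gamma> \<longleftrightarrow> (\<exists>\<phi>. reparam \<phi> l \<and> (\<forall>x\<in>{0..1}. \<gamma> x = (\<phi> x, 0)))"

end

theory Submission
  imports Defs
begin

text \<open>
  Write \<open>v = \<gamma>'\<close>, \<open>r = \<bar>v\<bar>\<close>, \<open>T = v / r\<close>, \<open>N\<close> for the rotation of \<open>T\<close> by a right angle and \<open>k\<close> for the curvature.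
  Testing the first variation with piecewise quadratic fields gives, by the argument of du Bois-Reymond,
  \<open>(2 k / r) N = R(x) - x R(1)\<close> for almost every \<open>x\<close>, where \<open>R\<close> is the primitive of an integrable function. Hence \<open>k\<close> has a
  continuous representative which vanishes at both ends, and differentiating this relation shows that \<open>T\<close> and \<open>k\<close> are
  continuously differentiable and satisfy \<open>2 k_s N + (k\<^sup>2 - lam) T = - c\<close> for a constant vector \<open>c\<close>. Its normal component
  integrates to a linear relation between \<open>k\<close> and \<open>\<gamma>\<close>, so the boundary conditions force \<open>c\<close> to be horizontal.
  The triple \<open>(T, k)\<close> then solves a pendulum equation with \<open>k = 0\<close> initially; by uniqueness it is constant or coincides, up to
  reflection, with that of a special curve whose modulus satisfies \<open>2 q\<^sup>2 - 1 = lam / \<bar>c\<bar>\<close>. The condition \<open>k = 0\<close> at the other end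
  quantizes the length, the horizontal distance of the end points determines \<open>\<alpha>\<close>, and together they give
  \<open>g(q) = lam l\<^sup>2 / n\<^sup>2\<close>; the monotonicity of \<open>g\<close> identifies \<open>q\<close> among \<open>q1\<close>, \<open>q2\<close> and \<open>q3\<close>.
\<close>

section \<open>The amplitude and the incomplete integrals\<close>

text \<open>The admissible test fields vanish at the end points, but their slopes there are free.
  This is why the integrated equation carries no free constant: its right-hand side R(x) - x R(1)
  vanishes at 0 and at 1, which is the natural boundary condition k = 0. The obstacle is regularity.
  The second derivative of \<gamma> exists only almost everywhere, and at first the same holds for
  the derivatives of T and k. However, the derivatives found in this way extend continuously, and
  the increments of the functions are bounded by integrals of fixed integrable functions; together
  these facts make the functions C^1, and everything afterwards concerns ordinary derivatives. The
  tangential component of the vector equation is the first integral c . T = lam - k^2. Once c is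
  horizontal it reads c T1(0) = lam > 0 at the start, so T1(0) is not 0 and q^2 = (1 + |T1(0)|) / 2
  exceeds 1/2: only moduli above 1 / sqrt 2 occur. The sign of T1(0), which is that of c, separates
  the arcs (negative) from the loops (positive).\<close>

definition ellD :: "real \<Rightarrow> real \<Rightarrow> real" where
  "ellD q \<theta> = sqrt (1 - q\<^sup>2 * (sin \<theta>)\<^sup>2)"

lemma ellD_arg_pos:
  fixes q \<theta> :: real
  assumes "\<bar>q\<bar> < 1"
  shows "1 - q\<^sup>2 * (sin \<theta>)\<^sup>2 > 0"
proof -
  have "q\<^sup>2 * (sin \<theta>)\<^sup>2 \<le> q\<^sup>2 * 1" by (intro mult_left_mono) (auto simp: abs_square_le_1)
  moreover have "q\<^sup>2 < 1" using assms by (simp add: abs_square_less_1)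
  ultimately show ?thesis by simp
qed

lemma ellD_pos: "\<bar>q\<bar> < 1 \<Longrightarrow> ellD q \<theta> > 0"
  using ellD_arg_pos by (simp add: ellD_def)

lemma ellD_le_1: "\<bar>q\<bar> < 1 \<Longrightarrow> ellD q \<theta> \<le> 1"
  by (simp add: ellD_def)

lemma ellD_square: "\<bar>q\<bar> < 1 \<Longrightarrow> (ellD q \<theta>)\<^sup>2 = 1 - q\<^sup>2 * (sin \<theta>)\<^sup>2"
  using ellD_arg_pos[of q \<theta>] by (simp add: ellD_def)

lemma continuous_ellD: "continuous_on S (ellD q)"
  unfolding ellD_def by (intro continuous_intros)

lemma continuous_inverse_ellD: "\<bar>q\<bar> < 1 \<Longrightarrow> continuous_on S (\<lambda>\<theta>. 1 / ellD q \<theta>)"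
  using ellD_pos[of q] by (intro continuous_intros continuous_ellD) (auto simp: less_le)

text \<open>The two branches hide one function: with A = |x| + 1, both equal near x the integral
  from -A minus the constant integral over [-A, 0]. So the fundamental theorem of calculus also
  covers the junction at 0.\<close>

lemma two_sided_integral_has_derivative:
  fixes f :: "real \<Rightarrow> real"
  assumes f: "continuous_on UNIV f"
  shows "((\<lambda>x. if 0 \<le> x then integral {0..x} f else - integral {x..0} f) has_real_derivative f x) (at x)"
proof -
  define A where "A = \<bar>x\<bar> + 1"
  have fi: "f integrable_on {u..v}" for u v
    by (intro integrable_continuous_real continuous_on_subset[OF f]) auto
  have eq: "(if 0 \<le> y then integral {0..y} f else - integral {y..0} f) = integral {-A..y} f - integral {-A..0} f"
    if "y \<in> {-A<..<A}" for y
  proof (cases "0 \<le> y")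
    case True
    have "integral {-A..0} f + integral {0..y} f = integral {-A..y} f"
      using that True by (intro Henstock_Kurzweil_Integration.integral_combine fi) (auto simp: A_def)
    then show ?thesis using True by simp
  next
    case False
    have "integral {-A..y} f + integral {y..0} f = integral {-A..0} f"
      using that False by (intro Henstock_Kurzweil_Integration.integral_combine fi) auto
    then show ?thesis using False by simp
  qed
  have xA: "x \<in> {-A<..<A}" by (auto simp: A_def)
  have "((\<lambda>y. integral {-A..y} f) has_real_derivative f x) (at x within {-A..A})"
    by (intro integral_has_real_derivative continuous_on_subset[OF f]) (use xA in auto)
  then have "((\<lambda>y. integral {-A..y} f) has_real_derivative f x) (at x)"
    using xA by (subst (asm) at_within_interior) auto
  then have "((\<lambda>y. integral {-A..y} f - integral {-A..0} f) has_real_derivative f x) (at x)"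
    by (auto intro!: derivative_eq_intros)
  moreover have "eventually (\<lambda>y. y \<in> {-A<..<A}) (nhds x)"
    using xA by (intro eventually_nhds_in_open) auto
  then have "eventually (\<lambda>y. integral {-A..y} f - integral {-A..0} f = (if 0 \<le> y then integral {0..y} f else - integral {y..0} f)) (nhds x)"
    by eventually_elim (use eq in auto)
  ultimately show ?thesis by (subst (asm) DERIV_cong_ev[OF refl _ refl])
qed

lemma ellF_has_derivative: "\<bar>q\<bar> < 1 \<Longrightarrow> ((\<lambda>x. ellF x q) has_real_derivative 1 / ellD q x) (at x)"
  using two_sided_integral_has_derivative[OF continuous_inverse_ellD, of q x] unfolding ellF_def[abs_def] ellD_def[abs_def] .

lemma ellE_has_derivative: "((\<lambda>x. ellE x q) has_real_derivative ellD q x) (at x)"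
  using two_sided_integral_has_derivative[OF continuous_ellD, of q x] unfolding ellE_def[abs_def] ellD_def[abs_def] .

lemma ell_0 [simp]: "ellF 0 q = 0" "ellE 0 q = 0"
  by (simp_all add: ellF_def ellE_def)

text \<open>Abstract in F so as to serve \<open>ellF\<close> and \<open>ellE\<close> alike. Both
  F(x) + F(-x) and F(x + pi) - F(x) have zero derivative; the second constant is evaluated at -pi/2,
  where oddness turns it into 2 F(pi/2). The odd multiples of pi/2 are the amplitudes at which cn,
  and with it the curvature of a special curve, vanishes.\<close>

lemma antiderivative_even_periodic:
  fixes F f :: "real \<Rightarrow> real"
  assumes d: "\<And>x. (F has_real_derivative f x) (at x)" and F0: "F 0 = 0"
    and ev: "\<And>x. f (- x) = f x" and per: "\<And>x. f (x + pi) = f x"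
  shows "F (- x) = - F x" "F (x + pi) = F x + 2 * F (pi/2)"
    "F (of_int m * pi + pi/2) = (2 * of_int m + 1) * F (pi/2)"
proof -
  have odd: "F (- x) = - F x" for x
  proof -
    have "((\<lambda>x. F x + F (- x)) has_real_derivative 0) (at x)" for x
    proof -
      have "((\<lambda>x. F (- x)) has_real_derivative f (- x) * (- 1)) (at x)"
        by (rule DERIV_chain2[where f=F, OF d]) (auto intro!: derivative_eq_intros)
      from DERIV_add[OF d[of x] this] show ?thesis by (simp add: ev)
    qed
    then have "F x + F (- x) = F 0 + F (- 0)"
      using DERIV_isconst_all[of "\<lambda>x. F x + F (- x)"] by blast
    then show ?thesis using F0 by simp
  qed
  have sh: "F (x + pi) - F x = F (- pi/2 + pi) - F (- pi/2)" for x
  proof -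
    have "((\<lambda>x. F (x + pi) - F x) has_real_derivative 0) (at x)" for x
    proof -
      have "((\<lambda>x. F (x + pi)) has_real_derivative f (x + pi) * 1) (at x)"
        by (rule DERIV_chain2[where f=F, OF d]) (auto intro!: derivative_eq_intros)
      from DERIV_diff[OF this d[of x]] show ?thesis by (simp add: per)
    qed
    then show ?thesis
      using DERIV_isconst_all[of "\<lambda>x. F (x + pi) - F x"] by blast
  qed
  have sh': "F (x + pi) = F x + 2 * F (pi/2)" for x
    using sh[of x] odd[of "pi/2"] by (simp add: field_simps)
  show "F (- x) = - F x" "F (x + pi) = F x + 2 * F (pi/2)" by (fact odd sh')+
  have nat: "F (real m * pi + pi/2) = (2 * real m + 1) * F (pi/2)" for m
  proof (induction m)
    case (Suc m)
    have "F (real (Suc m) * pi + pi/2) = F ((real m * pi + pi/2) + pi)" by (simp add: algebra_simps)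
    then show ?case unfolding sh' Suc.IH by (simp add: algebra_simps)
  qed simp
  show "F (of_int m * pi + pi/2) = (2 * of_int m + 1) * F (pi/2)"
  proof (cases "m \<ge> 0")
    case True
    then show ?thesis using nat[of "nat m"] by simp
  next
    case False
    \<comment> \<open>Oddness reflects the index about -1/2: m pi + pi/2 = -(j pi + pi/2) for j = -m
      - 1.\<close>
    define j where "j = nat (- m - 1)"
    have m: "real_of_int m = - real j - 1" using False by (simp add: j_def)
    have "F (of_int m * pi + pi/2) = F (- (real j * pi + pi/2))"
      unfolding m by (rule arg_cong[of _ _ F]) (simp add: algebra_simps)
    also have "\<dots> = (2 * of_int m + 1) * F (pi/2)" unfolding odd nat m by (simp add: algebra_simps)
    finally show ?thesis .
  qed
qed

lemma ellF_odd_multiple: "\<bar>q\<bar> < 1 \<Longrightarrow> ellF (of_int m * pi + pi/2) q = (2 * of_int m + 1) * ellK q"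
  using antiderivative_even_periodic(3)[of "\<lambda>x. ellF x q" "\<lambda>x. 1 / ellD q x" m] ellF_has_derivative[of q]
  by (simp add: ellK_def ellD_def)

lemma ellE_odd_multiple: "ellE (of_int m * pi + pi/2) q = (2 * of_int m + 1) * ellEc q"
  using antiderivative_even_periodic(3)[of "\<lambda>x. ellE x q" "\<lambda>x. ellD q x" m] ellE_has_derivative
  by (simp add: ellEc_def ellD_def)

lemma ellF_strict_mono:
  assumes q: "\<bar>q\<bar> < 1"
  shows "strict_mono (\<lambda>x. ellF x q)"
proof (rule strict_monoI)
  fix x y :: real assume "x < y"
  then show "ellF x q < ellF y q"
  proof (rule DERIV_pos_imp_increasing)
    fix z
    have "1 / ellD q z > 0" using ellD_pos[OF q] by simp
    then show "\<exists>d. ((\<lambda>x. ellF x q) has_real_derivative d) (at z) \<and> 0 < d"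
      using ellF_has_derivative[OF q] by blast
  qed
qed

lemma continuous_ellF: "\<bar>q\<bar> < 1 \<Longrightarrow> continuous_on S (\<lambda>x. ellF x q)"
  by (intro continuous_at_imp_continuous_on ballI DERIV_isCont[OF ellF_has_derivative])

text \<open>The integrand of F is at least 1. With oddness this growth makes F onto, so that
  \<open>jam\<close> inverts it on the whole line; at pi/2 it gives K > 0.\<close>

lemma ellF_ge:
  assumes q: "\<bar>q\<bar> < 1" and x: "x \<ge> 0"
  shows "ellF x q \<ge> x"
proof -
  have "ellF 0 q - 0 \<le> ellF x q - x"
  proof (rule DERIV_nonneg_imp_nondecreasing[OF x])
    fix y
    have "((\<lambda>x. ellF x q - x) has_real_derivative 1 / ellD q y - 1) (at y)"
      using ellF_has_derivative[OF q, of y] by (auto intro!: derivative_eq_intros)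
    moreover have "1 / ellD q y - 1 \<ge> 0" using ellD_pos[OF q, of y] ellD_le_1[OF q, of y] by simp
    ultimately show "\<exists>d. ((\<lambda>x. ellF x q - x) has_real_derivative d) (at y) \<and> 0 \<le> d" by blast
  qed
  then show ?thesis by simp
qed

lemma ellF_odd: "\<bar>q\<bar> < 1 \<Longrightarrow> ellF (- x) q = - ellF x q"
  using antiderivative_even_periodic(1)[of "\<lambda>x. ellF x q" "\<lambda>x. 1 / ellD q x" x] ellF_has_derivative[of q]
  by (simp add: ellD_def)

lemma ellF_surj:
  assumes q: "\<bar>q\<bar> < 1"
  shows "\<exists>x. ellF x q = u"
proof -
  have "\<exists>x. - \<bar>u\<bar> \<le> x \<and> x \<le> \<bar>u\<bar> \<and> ellF x q = u"
    using ellF_ge[OF q, of "\<bar>u\<bar>"] ellF_odd[OF q, of "\<bar>u\<bar>"]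
    by (intro IVT'[of "\<lambda>x. ellF x q"] continuous_ellF[OF q]) auto
  then show ?thesis by blast
qed

lemma jam_unique:
  assumes q: "\<bar>q\<bar> < 1"
  shows "ellF (jam u q) q = u" "jam (ellF x q) q = x"
proof -
  have ex1: "\<exists>!x. ellF x q = u" for u
    using ellF_surj[OF q, of u] strict_mono_eq[OF ellF_strict_mono[OF q]] by metis
  show "ellF (jam u q) q = u" unfolding jam_def by (rule theI'[OF ex1])
  show "jam (ellF x q) q = x" unfolding jam_def by (rule the1_equality[OF ex1]) simp
qed

lemma jam_has_derivative:
  assumes q: "\<bar>q\<bar> < 1"
  shows "((\<lambda>u. jam u q) has_real_derivative ellD q (jam u q)) (at u)"
proof -
  have "isCont (\<lambda>u. jam u q) (ellF (jam u q) q)"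
    by (rule isCont_inverse_function[where d=1 and f="\<lambda>x. ellF x q"])
      (auto simp: jam_unique[OF q] intro: DERIV_isCont[OF ellF_has_derivative[OF q]])
  then have "isCont (\<lambda>u. jam u q) u" by (simp add: jam_unique[OF q])
  then have "((\<lambda>u. jam u q) has_real_derivative inverse (1 / ellD q (jam u q))) (at u)"
    using ellD_pos[OF q, of "jam u q"]
    by (intro DERIV_inverse_function[where f="\<lambda>x. ellF x q" and a="u-1" and b="u+1"] ellF_has_derivative[OF q])
      (auto simp: jam_unique[OF q])
  then show ?thesis by simp
qed

lemma jam_odd_multiple: "\<bar>q\<bar> < 1 \<Longrightarrow> jam ((2 * of_int m + 1) * ellK q) q = of_int m * pi + pi/2"
  using jam_unique(2)[of q "of_int m * pi + pi/2"] ellF_odd_multiple[of q m] by simp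

lemma ellK_pos: "\<bar>q\<bar> < 1 \<Longrightarrow> ellK q > 0"
  using ellF_ge[of q "pi/2"] pi_gt_zero unfolding ellK_def by linarith

section \<open>The complete integrals as functions of the modulus\<close>

lemma ellK_eq: "ellK q = integral {0..pi/2} (\<lambda>\<theta>. 1 / ellD q \<theta>)"
  and ellEc_eq: "ellEc q = integral {0..pi/2} (ellD q)"
  by (simp_all add: ellK_def ellEc_def ellF_def ellE_def ellD_def[abs_def])

lemma integral_pos_of_continuous:
  fixes f :: "real \<Rightarrow> real"
  assumes "a < b" "continuous_on {a..b} f" "\<And>x. x \<in> {a..b} \<Longrightarrow> 0 \<le> f x" "x \<in> {a..b}" "0 < f x"
  shows "0 < integral {a..b} f"
proof -
  have "integral {a..b} f \<noteq> 0"
    using integral_eq_0_iff[of a b f] assms by force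
  moreover have "0 \<le> integral {a..b} f"
    using assms by (intro integral_nonneg integrable_continuous_real) auto
  ultimately show ?thesis by simp
qed

lemma ell_integrable:
  assumes "\<bar>q\<bar> < 1"
  shows "(\<lambda>\<theta>. 1 / ellD q \<theta>) integrable_on {a..b}" "(ellD q) integrable_on {a..b}"
  using assms by (auto intro!: integrable_continuous_real continuous_ellD continuous_inverse_ellD)

lemma ellEc_pos: "\<bar>q\<bar> < 1 \<Longrightarrow> ellEc q > 0"
  unfolding ellEc_eq using ellD_pos[of q]
  by (intro integral_pos_of_continuous[where x=0] continuous_ellD) (auto simp: less_imp_le)

lemma ellEc_le: "\<bar>q\<bar> < 1 \<Longrightarrow> ellEc q \<le> pi / 2"
proof -
  assume q: "\<bar>q\<bar> < 1"
  have "integral {0..pi/2} (ellD q) \<le> integral {0..pi/2} (\<lambda>_. 1)"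
    using ellD_le_1[OF q] by (intro integral_le ell_integrable q) auto
  then show ?thesis by (simp add: ellEc_eq)
qed

lemma ellEc_less_ellK: "0 < q \<Longrightarrow> q < 1 \<Longrightarrow> ellEc q < ellK q"
proof -
  assume q: "0 < q" "q < 1"
  then have q1: "\<bar>q\<bar> < 1" by simp
  have "0 < integral {0..pi/2} (\<lambda>\<theta>. 1 / ellD q \<theta> - ellD q \<theta>)"
  proof (rule integral_pos_of_continuous[where x="pi/2"])
    show "continuous_on {0..pi/2} (\<lambda>\<theta>. 1 / ellD q \<theta> - ellD q \<theta>)"
      by (intro continuous_intros continuous_ellD continuous_inverse_ellD q1)
    show "0 \<le> 1 / ellD q x - ellD q x" for x
      using ellD_pos[OF q1, of x] ellD_le_1[OF q1, of x] by (simp add: field_simps mult_le_one)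
    have "(ellD q (pi/2))\<^sup>2 < 1" unfolding ellD_square[OF q1] using q by simp
    then show "0 < 1 / ellD q (pi/2) - ellD q (pi/2)"
      using ellD_pos[OF q1, of "pi/2"] by (simp add: field_simps power2_eq_square)
  qed auto
  then show ?thesis
    using ell_integrable[OF q1, of 0 "pi/2"] by (simp add: ellK_eq ellEc_eq integral_diff)
qed

text \<open>With D for \<open>ellD q\<close>, D^2 >= 1 - q^2 gives D >= (1 - q^2) / D pointwise,
  strictly at 0. The difference of the two sides is the numerator of the derivative of K, so this is
  what makes K increasing.\<close>

lemma ellK_bound_ellEc: "0 < q \<Longrightarrow> q < 1 \<Longrightarrow> (1 - q\<^sup>2) * ellK q < ellEc q"
proof -
  assume q: "0 < q" "q < 1"
  then have q1: "\<bar>q\<bar> < 1" by simp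
  have "0 < integral {0..pi/2} (\<lambda>\<theta>. ellD q \<theta> - (1 - q\<^sup>2) * (1 / ellD q \<theta>))"
  proof (rule integral_pos_of_continuous[where x=0])
    show "continuous_on {0..pi/2} (\<lambda>\<theta>. ellD q \<theta> - (1 - q\<^sup>2) * (1 / ellD q \<theta>))"
      by (intro continuous_intros continuous_ellD continuous_inverse_ellD q1)
    show "0 \<le> ellD q x - (1 - q\<^sup>2) * (1 / ellD q x)" for x
    proof -
      have "q\<^sup>2 * (sin x)\<^sup>2 \<le> q\<^sup>2 * 1" by (intro mult_left_mono) (auto simp: abs_square_le_1)
      then have "1 - q\<^sup>2 \<le> (ellD q x)\<^sup>2" unfolding ellD_square[OF q1] by simp
      then show ?thesis using ellD_pos[OF q1, of x] by (simp add: field_simps power2_eq_square)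
    qed
    show "0 < ellD q 0 - (1 - q\<^sup>2) * (1 / ellD q 0)" using q by (simp add: ellD_def)
  qed auto
  also have "integral {0..pi/2} (\<lambda>\<theta>. ellD q \<theta> - (1 - q\<^sup>2) * (1 / ellD q \<theta>)) = ellEc q - (1 - q\<^sup>2) * ellK q"
    unfolding ellK_eq ellEc_eq
    using ell_integrable[OF q1, of 0 "pi/2"] by (subst integral_diff) (auto intro: integrable_on_mult_right simp del: times_divide_eq_right)
  finally show ?thesis by simp
qed

text \<open>The left sides are what the chain rule for the square root produces. At X = 0 both sides
  are 0 by the convention for division.\<close>

lemma sqrt_chain_eq: "inverse X / 2 * (- 2 * a * b * c) = - a * b * c / X" "inverse X / 2 * (- 2 * a * b) = - a * b / X" for X a b c :: real
  by (cases "X = 0"; simp add: field_simps)+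

lemma ellD_deriv_q:
  assumes "\<bar>q\<bar> < 1"
  shows "((\<lambda>q. ellD q t) has_real_derivative (- q * (sin t)\<^sup>2 / ellD q t)) (at q)"
    "((\<lambda>q. 1 / ellD q t) has_real_derivative (q * (sin t)\<^sup>2 / ellD q t ^ 3)) (at q)"
proof -
  have "((\<lambda>q. 1 - q\<^sup>2 * (sin t)\<^sup>2) has_real_derivative (- 2 * q * (sin t)\<^sup>2)) (at q)"
    by (auto intro!: derivative_eq_intros)
  from DERIV_chain2[where f=sqrt and g="\<lambda>q. 1 - q\<^sup>2 * (sin t)\<^sup>2", OF DERIV_real_sqrt[OF ellD_arg_pos[OF assms, of t]] this]
  show 1: "((\<lambda>q. ellD q t) has_real_derivative (- q * (sin t)\<^sup>2 / ellD q t)) (at q)"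
    unfolding ellD_def sqrt_chain_eq .
  have "ellD q t \<noteq> 0" using ellD_pos[OF assms, of t] by simp
  from DERIV_inverse_fun[OF 1 this]
  show "((\<lambda>q. 1 / ellD q t) has_real_derivative (q * (sin t)\<^sup>2 / ellD q t ^ 3)) (at q)"
    unfolding inverse_eq_divide by (rule DERIV_cong) (use ellD_pos[OF assms, of t] in \<open>simp add: divide_simps eval_nat_numeral\<close>)
qed

lemma continuous_ellD_pair: "continuous_on S (\<lambda>z. ellD (fst z) (snd z))"
  unfolding ellD_def by (intro continuous_intros)

lemma ellD_pair_nonzero: "\<bar>fst z\<bar> < 1 \<Longrightarrow> ellD (fst z) (snd z) \<noteq> 0"
  using ellD_pos[of "fst z" "snd z"] by simp

lemma parameter_integral_has_derivative:
  fixes f f' :: "real \<Rightarrow> real \<Rightarrow> real"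
  assumes q: "\<bar>q\<bar> < 1"
    and d: "\<And>q t. \<bar>q\<bar> < 1 \<Longrightarrow> ((\<lambda>q. f q t) has_real_derivative f' q t) (at q)"
    and i: "\<And>q. \<bar>q\<bar> < 1 \<Longrightarrow> f q integrable_on {a..b}"
    and c: "continuous_on ({-1<..<1} \<times> {a..b}) (\<lambda>(q, t). f' q t)"
  shows "((\<lambda>q. integral {a..b} (f q)) has_real_derivative integral {a..b} (f' q)) (at q)"
proof -
  have "((\<lambda>q. integral (cbox a b) (f q)) has_real_derivative integral (cbox a b) (f' q)) (at q within {-1<..<1})"
  proof (rule leibniz_rule_field_derivative)
    show "((\<lambda>q. f q t) has_real_derivative f' q t) (at q within {-1<..<1})" if "q \<in> {-1<..<1}" for q t
      using d[of q t] that by (auto intro: has_field_derivative_at_within)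
    show "f q integrable_on cbox a b" if "q \<in> {-1<..<1}" for q using i[of q] that by auto
  qed (use c q in auto)
  moreover have "at q within {-1<..<1} = at q" using q by (intro at_within_open) auto
  ultimately show ?thesis by simp
qed

lemma ellEc_has_derivative:
  assumes q: "0 < q" "q < 1"
  shows "(ellEc has_real_derivative (ellEc q - ellK q) / q) (at q)"
proof -
  have q1: "\<bar>q\<bar> < 1" using q by simp
  have "((\<lambda>q. integral {0..pi/2} (\<lambda>t. ellD q t)) has_real_derivative integral {0..pi/2} (\<lambda>t. - q * (sin t)\<^sup>2 / ellD q t)) (at q)"
  proof (rule parameter_integral_has_derivative[OF q1 ellD_deriv_q(1)])
    have "continuous_on ({-1<..<1} \<times> {0..pi/2}) (\<lambda>z. - fst z * (sin (snd z))\<^sup>2 / ellD (fst z) (snd z))"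
      by (intro continuous_intros continuous_ellD_pair ballI power_not_zero ellD_pair_nonzero) (auto simp: abs_less_iff)
    then show "continuous_on ({-1<..<1} \<times> {0..pi/2}) (\<lambda>(q, t). - q * (sin t)\<^sup>2 / ellD q t)"
      by (simp add: split_def)
  qed (use ell_integrable in auto)
  moreover have "integral {0..pi/2} (\<lambda>t. - q * (sin t)\<^sup>2 / ellD q t) = (ellEc q - ellK q) / q"
  proof -
    \<comment> \<open>Substituting q^2 sin^2 = 1 - D^2 brings the derivative back to the integrands
      of E and K.\<close>
    have "- q * (sin t)\<^sup>2 / ellD q t = (1 / q) * (ellD q t - 1 / ellD q t)" for t
    proof -
      have "q\<^sup>2 * (sin t)\<^sup>2 = 1 - (ellD q t)\<^sup>2" using ellD_square[OF q1, of t] by simp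
      then show ?thesis using q ellD_pos[OF q1, of t] by (simp add: field_simps power2_eq_square)
    qed
    then have "integral {0..pi/2} (\<lambda>t. - q * (sin t)\<^sup>2 / ellD q t) = (1 / q) * integral {0..pi/2} (\<lambda>t. ellD q t - 1 / ellD q t)"
      by simp
    also have "\<dots> = (ellEc q - ellK q) / q"
      unfolding ellK_eq ellEc_eq using ell_integrable[OF q1, of 0 "pi/2"] by (simp add: integral_diff)
    finally show ?thesis .
  qed
  ultimately show ?thesis by (simp add: ellEc_eq[abs_def])
qed

lemma ellD_has_derivative:
  assumes q1: "\<bar>q\<bar> < 1"
  shows "(ellD q has_real_derivative (- q\<^sup>2 * sin t * cos t / ellD q t)) (at t)"
proof -
  have "((\<lambda>t. 1 - q\<^sup>2 * (sin t)\<^sup>2) has_real_derivative (- 2 * q\<^sup>2 * sin t * cos t)) (at t)"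
    by (auto intro!: derivative_eq_intros)
  from DERIV_chain2[where f=sqrt and g="\<lambda>t. 1 - q\<^sup>2 * (sin t)\<^sup>2", OF DERIV_real_sqrt[OF ellD_arg_pos[OF q1, of t]] this]
  show ?thesis unfolding ellD_def[abs_def] sqrt_chain_eq .
qed

text \<open>Differentiating the integrand of K in q leaves D^3 in the denominator. The function q^2
  sin cos / D vanishes at 0 and pi/2 and has derivative D - (1 - q^2) / D^3, which expresses the
  integral of 1 / D^3 through E.\<close>

lemma integral_ellD_cube:
  assumes q1: "\<bar>q\<bar> < 1"
  shows "(1 - q\<^sup>2) * integral {0..pi/2} (\<lambda>t. 1 / ellD q t ^ 3) = ellEc q"
    "(\<lambda>t. 1 / ellD q t ^ 3) integrable_on {0..pi/2}"
proof -
  have D0: "ellD q t \<noteq> 0" for t using ellD_pos[OF q1, of t] by simp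
  show i: "(\<lambda>t. 1 / ellD q t ^ 3) integrable_on {0..pi/2}"
    using D0 by (intro integrable_continuous_real continuous_intros continuous_ellD) auto
  note dD = ellD_has_derivative[OF q1]
  have der: "((\<lambda>t. q\<^sup>2 * sin t * cos t / ellD q t) has_real_derivative ellD q t - (1 - q\<^sup>2) * (1 / ellD q t ^ 3)) (at t)" for t
  proof -
    define s c D where "s = sin t" and "c = cos t" and "D = ellD q t"
    have c2: "c\<^sup>2 = 1 - s\<^sup>2" unfolding s_def c_def by (rule cos_squared_eq)
    have D2: "D\<^sup>2 = 1 - q\<^sup>2 * s\<^sup>2" unfolding D_def s_def by (rule ellD_square[OF q1])
    have D: "D \<noteq> 0" unfolding D_def by (rule D0)
    have "((\<lambda>t. sin t * cos t) has_real_derivative c\<^sup>2 - s\<^sup>2) (at t)"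
      using DERIV_mult[OF DERIV_sin[of t] DERIV_cos[of t]]
      by (rule DERIV_cong) (simp add: s_def c_def power2_eq_square)
    from DERIV_cmult[OF this, of "q\<^sup>2"]
    have "((\<lambda>t. q\<^sup>2 * sin t * cos t) has_real_derivative q\<^sup>2 * (c\<^sup>2 - s\<^sup>2)) (at t)"
      by (simp only: mult.assoc)
    from DERIV_divide[OF this dD D0]
    have "((\<lambda>t. q\<^sup>2 * sin t * cos t / ellD q t) has_real_derivative
       (q\<^sup>2 * (c\<^sup>2 - s\<^sup>2) * D - q\<^sup>2 * s * c * (- q\<^sup>2 * s * c / D)) / (D * D)) (at t)"
      unfolding s_def c_def D_def .
    moreover have "(q\<^sup>2 * (c\<^sup>2 - s\<^sup>2) * D - q\<^sup>2 * s * c * (- q\<^sup>2 * s * c / D)) / (D * D)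
       = (q\<^sup>2 * (c\<^sup>2 - s\<^sup>2) * D\<^sup>2 + q\<^sup>2 * q\<^sup>2 * s\<^sup>2 * c\<^sup>2) / D ^ 3"
    proof -
      have "(X * D - Y * (- Y / D)) / (D * D) = (X * D\<^sup>2 + Y\<^sup>2) / D ^ 3" for X Y
        using D by (simp add: divide_simps eval_nat_numeral)
      from this[of "q\<^sup>2 * (c\<^sup>2 - s\<^sup>2)" "q\<^sup>2 * s * c"] show ?thesis
        by (simp add: power_mult_distrib power2_eq_square)
    qed
    moreover have "q\<^sup>2 * (c\<^sup>2 - s\<^sup>2) * D\<^sup>2 + q\<^sup>2 * q\<^sup>2 * s\<^sup>2 * c\<^sup>2 = D\<^sup>2 * D\<^sup>2 - (1 - q\<^sup>2)"
      unfolding c2 D2 by (simp add: algebra_simps power2_eq_square)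
    moreover have "(D\<^sup>2 * D\<^sup>2 - (1 - q\<^sup>2)) / D ^ 3 = D - (1 - q\<^sup>2) * (1 / D ^ 3)"
      using D by (simp add: diff_divide_distrib eval_nat_numeral)
    ultimately show ?thesis by (simp add: D_def)
  qed
  have z: "((\<lambda>t. ellD q t - (1 - q\<^sup>2) * (1 / ellD q t ^ 3)) has_integral (0 - 0)) {0..pi/2}"
    using fundamental_theorem_of_calculus[of 0 "pi/2" "\<lambda>t. q\<^sup>2 * sin t * cos t / ellD q t"
      "\<lambda>t. ellD q t - (1 - q\<^sup>2) * (1 / ellD q t ^ 3)"] der
    by (simp add: has_real_derivative_iff_has_vector_derivative has_vector_derivative_at_within)
  have "((\<lambda>t. ellD q t - (1 - q\<^sup>2) * (1 / ellD q t ^ 3)) has_integral (ellEc q - (1 - q\<^sup>2) * integral {0..pi/2} (\<lambda>t. 1 / ellD q t ^ 3))) {0..pi/2}"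
    unfolding ellEc_eq using i ell_integrable(2)[OF q1]
    by (intro has_integral_diff has_integral_mult_right integrable_integral) auto
  from has_integral_unique[OF this z]
  have "ellEc q - (1 - q\<^sup>2) * integral {0..pi/2} (\<lambda>t. 1 / ellD q t ^ 3) = 0" by simp
  then show "(1 - q\<^sup>2) * integral {0..pi/2} (\<lambda>t. 1 / ellD q t ^ 3) = ellEc q" by simp
qed

lemma ellK_has_derivative:
  assumes q: "0 < q" "q < 1"
  shows "(ellK has_real_derivative (ellEc q - (1 - q\<^sup>2) * ellK q) / (q * (1 - q\<^sup>2))) (at q)"
proof -
  have q1: "\<bar>q\<bar> < 1" using q by simp
  have q2: "1 - q\<^sup>2 > 0" using q by (simp add: power_less_one_iff)
  have "((\<lambda>q. integral {0..pi/2} (\<lambda>t. 1 / ellD q t)) has_real_derivative integral {0..pi/2} (\<lambda>t. q * (sin t)\<^sup>2 / ellD q t ^ 3)) (at q)"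
  proof (rule parameter_integral_has_derivative[OF q1 ellD_deriv_q(2)])
    have "continuous_on ({-1<..<1} \<times> {0..pi/2}) (\<lambda>z. fst z * (sin (snd z))\<^sup>2 / ellD (fst z) (snd z) ^ 3)"
      by (intro continuous_intros continuous_ellD_pair ballI power_not_zero ellD_pair_nonzero) (auto simp: abs_less_iff)
    then show "continuous_on ({-1<..<1} \<times> {0..pi/2}) (\<lambda>(q, t). q * (sin t)\<^sup>2 / ellD q t ^ 3)"
      by (simp add: split_def)
  qed (use ell_integrable in auto)
  moreover have "integral {0..pi/2} (\<lambda>t. q * (sin t)\<^sup>2 / ellD q t ^ 3) = (ellEc q - (1 - q\<^sup>2) * ellK q) / (q * (1 - q\<^sup>2))"
  proof -
    have "q * (sin t)\<^sup>2 / ellD q t ^ 3 = (1 / q) * (1 / ellD q t ^ 3 - 1 / ellD q t)" for t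
    proof -
      have "q\<^sup>2 * (sin t)\<^sup>2 = 1 - (ellD q t)\<^sup>2" using ellD_square[OF q1, of t] by simp
      then show ?thesis using q ellD_pos[OF q1, of t] by (simp add: field_simps power2_eq_square eval_nat_numeral)
    qed
    then have "integral {0..pi/2} (\<lambda>t. q * (sin t)\<^sup>2 / ellD q t ^ 3) = (1 / q) * integral {0..pi/2} (\<lambda>t. 1 / ellD q t ^ 3 - 1 / ellD q t)"
      by simp
    also have "\<dots> = (1 / q) * (integral {0..pi/2} (\<lambda>t. 1 / ellD q t ^ 3) - ellK q)"
      unfolding ellK_eq using ell_integrable[OF q1, of 0 "pi/2"] integral_ellD_cube(2)[OF q1] by (simp add: integral_diff)
    also have "integral {0..pi/2} (\<lambda>t. 1 / ellD q t ^ 3) = ellEc q / (1 - q\<^sup>2)"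
      using integral_ellD_cube(1)[OF q1] q2 by (simp add: field_simps)
    finally show ?thesis using q q2 by (simp add: field_simps)
  qed
  ultimately show ?thesis by (simp add: ellK_eq[abs_def])
qed

section \<open>Signs of 2E - K and of \<open>ff\<close>, and the three monotone branches of
  \<open>gg\<close>\<close>

definition hh :: "real \<Rightarrow> real" where "hh q = 2 * ellEc q - ellK q"

lemma strict_mono_on_K_E:
  assumes "0 < x" "x < y" "y < 1"
  shows "ellK x < ellK y" "ellEc y < ellEc x" "hh y < hh x"
proof -
  show K: "ellK x < ellK y"
  proof (rule DERIV_pos_imp_increasing[OF assms(2)])
    fix z assume "x \<le> z" "z \<le> y"
    then have z: "0 < z" "z < 1" using assms by auto
    have "(ellEc z - (1 - z\<^sup>2) * ellK z) / (z * (1 - z\<^sup>2)) > 0"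
      using ellK_bound_ellEc[OF z] z by (intro divide_pos_pos mult_pos_pos) (auto simp: power_less_one_iff)
    then show "\<exists>d. (ellK has_real_derivative d) (at z) \<and> 0 < d"
      using ellK_has_derivative[OF z] by blast
  qed
  show E: "ellEc y < ellEc x"
  proof (rule DERIV_neg_imp_decreasing[OF assms(2)])
    fix z assume "x \<le> z" "z \<le> y"
    then have z: "0 < z" "z < 1" using assms by auto
    have "(ellEc z - ellK z) / z < 0" using ellEc_less_ellK[OF z] z by (simp add: divide_neg_pos)
    then show "\<exists>d. (ellEc has_real_derivative d) (at z) \<and> d < 0"
      using ellEc_has_derivative[OF z] by blast
  qed
  show "hh y < hh x" using K E by (simp add: hh_def)
qed

lemma continuous_K_E:
  assumes "S \<subseteq> {0<..<1}"
  shows "continuous_on S ellK" "continuous_on S ellEc" "continuous_on S hh"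
proof -
  show 1: "continuous_on S ellK" "continuous_on S ellEc"
    using assms by (auto intro!: continuous_at_imp_continuous_on DERIV_isCont[OF ellK_has_derivative] DERIV_isCont[OF ellEc_has_derivative])
  show "continuous_on S hh" unfolding hh_def[abs_def] by (intro continuous_intros 1)
qed

lemma sqrt_half: "(1 / sqrt 2)\<^sup>2 = (1/2::real)" "0 < 1 / sqrt 2" "1 / sqrt 2 < (1::real)"
  by (simp_all add: power_divide)

lemma ge_sqrt_half_imp_pos: "1 / sqrt 2 \<le> x \<Longrightarrow> 0 < x"
  by (rule less_le_trans[OF sqrt_half(2)])

text \<open>For q^2 = 1/2 one has 2 D^2 = 2 - sin^2 >= 1, so the integrand 2 D - 1 / D is itself
  nonnegative.\<close>

lemma hh_sqrt_half_pos: "hh (1 / sqrt 2) > 0"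
proof -
  define q where "q = 1 / sqrt (2::real)"
  have q1: "\<bar>q\<bar> < 1" using sqrt_half by (simp add: q_def)
  have q2: "q\<^sup>2 = 1/2" using sqrt_half by (simp add: q_def)
  have "0 < integral {0..pi/2} (\<lambda>t. 2 * ellD q t - 1 / ellD q t)"
  proof (rule integral_pos_of_continuous[where x=0])
    show "continuous_on {0..pi/2} (\<lambda>t. 2 * ellD q t - 1 / ellD q t)"
      by (intro continuous_intros continuous_ellD continuous_inverse_ellD q1)
    show "0 \<le> 2 * ellD q t - 1 / ellD q t" for t
    proof -
      have "(sin t)\<^sup>2 \<le> 1" by (simp add: abs_square_le_1)
      then have "1 \<le> 2 * (ellD q t)\<^sup>2" unfolding ellD_square[OF q1] q2 by simp
      then show ?thesis using ellD_pos[OF q1, of t] by (simp add: field_simps power2_eq_square)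
    qed
    show "0 < 2 * ellD q 0 - 1 / ellD q 0" by (simp add: ellD_def)
  qed auto
  also have "integral {0..pi/2} (\<lambda>t. 2 * ellD q t - 1 / ellD q t) = hh q"
    unfolding hh_def ellK_eq ellEc_eq using ell_integrable[OF q1, of 0 "pi/2"]
    by (subst integral_diff) (auto intro: integrable_on_mult_right)
  finally show ?thesis by (simp add: q_def)
qed

lemma has_integral_shifted_reciprocal:
  fixes k b :: real
  assumes k: "0 < k" and b: "0 \<le> b"
  shows "((\<lambda>t. 1 / (k + b - t)) has_integral (ln (k + b) - ln k)) {0..b}"
proof -
  define F where "F t = - ln (k + b - t)" for t
  have "(F has_vector_derivative 1 / (k + b - t)) (at t within {0..b})" if t: "t \<in> {0..b}" for t
  proof -
    have "k + b - t > 0" using t k by auto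
    then have A: "(ln has_real_derivative 1 / (k + b - t)) (at (k + b - t))"
      by (rule DERIV_ln_divide)
    have B: "((\<lambda>t. k + b - t) has_real_derivative - 1) (at t)" by (auto intro!: derivative_eq_intros)
    have "((\<lambda>t. ln (k + b - t)) has_real_derivative 1 / (k + b - t) * - 1) (at t)"
      using DERIV_chain2[where f=ln and g="\<lambda>t. k + b - t" and x=t and s=UNIV, OF A B] .
    from DERIV_minus[OF this] have "(F has_real_derivative 1 / (k + b - t)) (at t)"
      unfolding F_def[abs_def] mult_minus1_right minus_minus .
    then show ?thesis
      unfolding has_real_derivative_iff_has_vector_derivative by (rule has_vector_derivative_at_within)
  qed
  from fundamental_theorem_of_calculus[OF b this] show ?thesis
    by (simp add: F_def)
qed

text \<open>For complementary modulus \<open>k = exp (- 4)\<close> one has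
  \<open>1 - q\<^sup>2 sin\<^sup>2 \<theta> \<le> (cos \<theta> + k)\<^sup>2 \<le> (pi/2 - \<theta> + k)\<^sup>2\<close>, whence \<open>K \<ge> ln ((pi/2 + k) / k) \<ge> 4 > pi \<ge> 2 E\<close>.\<close>
lemma hh_neg_exists: "\<exists>q. 1 / sqrt 2 < q \<and> q < 1 \<and> hh q < 0"
proof -
  define k where "k = exp (- 4 :: real)"
  have k: "k > 0" "k < 1/2"
  proof -
    have "1 + 4 \<le> exp (4::real)" by (rule exp_ge_add_one_self)
    then show "k < 1/2" by (simp add: k_def exp_minus field_simps)
  qed (simp add: k_def)
  have k2: "k\<^sup>2 < 1/4" using power_strict_mono[of k "1/2" 2] k by (simp add: power2_eq_square)
  define q where "q = sqrt (1 - k\<^sup>2)"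
  have qs: "q\<^sup>2 = 1 - k\<^sup>2" using k2 by (simp add: q_def)
  have q: "1 / sqrt 2 < q" "q < 1"
  proof -
    show "q < 1" using k k2 by (simp add: q_def)
    have "(1 / sqrt 2)\<^sup>2 < q\<^sup>2" unfolding qs sqrt_half using k2 by simp
    moreover have "0 \<le> q" unfolding q_def using k2 by simp
    ultimately show "1 / sqrt 2 < q" by (rule power_less_imp_less_base)
  qed
  have q0: "0 < q" using q sqrt_half(2) by linarith
  have q1: "\<bar>q\<bar> < 1" using q q0 by simp
  have low: "1 / (k + pi/2 - t) \<le> 1 / ellD q t" if t: "t \<in> {0..pi/2}" for t
  proof -
    have c0: "0 \<le> cos t" using t by (intro cos_ge_zero) auto
    have "cos t = sin (pi/2 - t)" by (simp add: sin_cos_eq)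
    also have "\<dots> \<le> pi/2 - t" using t by (intro sin_x_le_x) auto
    finally have c1: "cos t \<le> pi/2 - t" .
    have "(ellD q t)\<^sup>2 = (cos t)\<^sup>2 + k\<^sup>2 * (sin t)\<^sup>2"
      unfolding ellD_square[OF q1] qs cos_squared_eq by (simp add: algebra_simps)
    also have "\<dots> \<le> (cos t)\<^sup>2 + k\<^sup>2 * 1"
      by (intro add_left_mono mult_left_mono) (auto simp: abs_square_le_1)
    also have "\<dots> \<le> (cos t + k)\<^sup>2" using c0 k by (simp add: power2_sum)
    finally have "ellD q t \<le> cos t + k"
      by (rule power2_le_imp_le) (use c0 k(1) in linarith)
    then have "ellD q t \<le> k + pi/2 - t" using c1 by linarith
    moreover note ellD_pos[OF q1, of t]
    ultimately show ?thesis by (intro divide_left_mono mult_pos_pos; linarith)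
  qed
  have I: "((\<lambda>t. 1 / (k + pi/2 - t)) has_integral (ln (k + pi/2) + 4)) {0..pi/2}"
  proof -
    have lnk: "ln k = - 4" by (simp add: k_def)
    have "0 \<le> pi/2" by simp
    from has_integral_shifted_reciprocal[OF k(1) this] show ?thesis
      unfolding lnk diff_minus_eq_add .
  qed
  have J: "((\<lambda>t. 1 / ellD q t) has_integral ellK q) {0..pi/2}"
    unfolding ellK_eq by (rule integrable_integral[OF ell_integrable(1)[OF q1]])
  have "ln (k + pi/2) + 4 \<le> ellK q"
    by (rule has_integral_le[OF I J]) (rule low)
  moreover have "ln (k + pi/2) \<ge> 0" using k pi_gt3 by (intro ln_ge_zero) auto
  ultimately have "ellK q \<ge> 4" by linarith
  moreover have "2 * ellEc q \<le> pi" using ellEc_le[OF q1] by simp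
  ultimately have "hh q < 0" using pi_less_4 by (simp add: hh_def)
  then show ?thesis using q by blast
qed

lemma qstar_props:
  shows "1 / sqrt 2 < qstar" "qstar < 1" "hh qstar = 0"
    "0 < q \<Longrightarrow> q < qstar \<Longrightarrow> hh q > 0" "qstar < q \<Longrightarrow> q < 1 \<Longrightarrow> hh q < 0"
proof -
  obtain q0 where q0: "1 / sqrt 2 < q0" "q0 < 1" "hh q0 < 0" using hh_neg_exists by blast
  have "\<exists>x\<ge>1 / sqrt 2. x \<le> q0 \<and> hh x = 0"
  proof (rule IVT2')
    show "continuous_on {1 / sqrt 2..q0} hh" by (intro continuous_K_E) (use q0 ge_sqrt_half_imp_pos in auto)
  qed (use q0 hh_sqrt_half_pos in auto)
  then obtain z where z: "1 / sqrt 2 \<le> z" "z \<le> q0" "hh z = 0" by blast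
  have zz: "1 / sqrt 2 < z" "z < 1" "0 < z"
    using z q0 hh_sqrt_half_pos ge_sqrt_half_imp_pos[of z] by (auto simp: less_le)
  \<comment> \<open>The definition of \<open>qstar\<close> admits q = 0, whereas the monotonicity of
    \<open>hh\<close> is proved for positive moduli; the value pi/2 at 0 excludes this
    candidate.\<close>
  have h0: "hh 0 > 0"
    by (simp add: hh_def ellK_eq ellEc_eq ellD_def[abs_def])
  have uniq: "q = z" if "0 \<le> q" "q < 1" "hh q = 0" for q
  proof -
    have "q > 0" using that h0 by (cases "q = 0") auto
    then show ?thesis
      using strict_mono_on_K_E(3)[of q z] strict_mono_on_K_E(3)[of z q] that z zz by (cases q z rule: linorder_cases) auto
  qed
  have "qstar = z"
    unfolding qstar_def using z zz uniq by (intro the_equality) (auto simp: hh_def)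
  then show "1 / sqrt 2 < qstar" "qstar < 1" "hh qstar = 0"
    "0 < q \<Longrightarrow> q < qstar \<Longrightarrow> hh q > 0" "qstar < q \<Longrightarrow> q < 1 \<Longrightarrow> hh q < 0"
    using z zz strict_mono_on_K_E(3)[of q z] strict_mono_on_K_E(3)[of z q] by auto
qed

text \<open>\<open>ff\<close> vanishes exactly where the increasing function \<open>K/E\<close> meets \<open>(8p(1-p) - 1) / ((1-p)(4p-1))\<close>,
  \<open>p = q\<^sup>2\<close>, which is decreasing on \<open>[1/2, 1)\<close>.\<close>
lemma ff_sign_step:
  assumes x: "1 / sqrt 2 \<le> x" and xy: "x < y" and y: "y < 1" and f: "ff x \<le> 0"
  shows "ff y < 0"
proof -
  define p r where "p = x\<^sup>2" and "r = y\<^sup>2"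
  have x0: "0 < x" using x sqrt_half(2) by linarith
  have p: "1/2 \<le> p" using power_mono[OF x, of 2] sqrt_half by (simp add: p_def)
  have pr: "p < r" using xy x0 by (simp add: p_def r_def power_strict_mono)
  have r: "r < 1" using y x0 xy by (simp add: r_def power_less_one_iff)
  define B D where "B = (\<lambda>p::real. 8 * p * (1 - p) - 1)" and "D = (\<lambda>p::real. (1 - p) * (4 * p - 1))"
  have ffe: "ff q = B (q\<^sup>2) * ellEc q - D (q\<^sup>2) * ellK q" for q
    by (simp add: ff_def B_def D_def algebra_simps power2_eq_square eval_nat_numeral)
  have Dp: "D p > 0" "D r > 0" using p pr r unfolding D_def by (auto intro!: mult_pos_pos)
  have KE: "ellK x < ellK y" "ellEc y < ellEc x" using strict_mono_on_K_E[OF x0 xy y] by auto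
  have E0: "ellEc y > 0" "ellEc x > 0" using ellEc_pos x0 xy y by auto
  \<comment> \<open>The decrease of B / D in cross-multiplied form. The difference factors, and its
    second factor is positive because p and r are at least 1/2.\<close>
  have "B r * D p < B p * D r"
  proof -
    have "B p * D r - B r * D p = (r - p) * (2 * (2 * p - 1) * (2 * r - 1) + 1)"
      by (simp add: B_def D_def algebra_simps)
    moreover have "0 < (r - p) * (2 * (2 * p - 1) * (2 * r - 1) + 1)"
      using pr p by (intro mult_pos_pos add_nonneg_pos mult_nonneg_nonneg) auto
    ultimately show ?thesis by simp
  qed
  then have "B r / D r < B p / D p" using Dp by (simp add: field_simps)
  also have "\<dots> \<le> ellK x / ellEc x"
    using f Dp E0 unfolding ffe p_def[symmetric] by (simp add: field_simps)
  also have "\<dots> \<le> ellK y / ellEc y"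
    using KE E0 ellK_pos[of x] x0 xy y by (intro frac_le) auto
  finally show "ff y < 0" unfolding ffe r_def[symmetric] using Dp E0 by (simp add: field_simps)
qed

text \<open>At 1 / sqrt 2 the value of \<open>ff\<close> is half that of \<open>hh\<close>, and at
  \<open>qstar\<close>, where K = 2E, it is (1 - 2 q^2) E < 0. By \<open>ff_sign_step\<close> a
  nonpositive value forces negative values everywhere to its right, so the zero between these points
  is the only one.\<close>

lemma qhat_props:
  shows "1 / sqrt 2 < qhat" "qhat < qstar"
    "1 / sqrt 2 \<le> q \<Longrightarrow> q < qhat \<Longrightarrow> ff q > 0" "qhat < q \<Longrightarrow> q < 1 \<Longrightarrow> ff q < 0"
proof -
  note qs = qstar_props(1-3)
  have s0: "0 < qstar" using qs sqrt_half(2) by linarith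
  have f1: "ff (1 / sqrt 2) > 0"
  proof -
    have "(1 / sqrt 2) ^ 4 = ((1 / sqrt 2)\<^sup>2)\<^sup>2" by (simp only: power_mult[symmetric]) simp
    also have "\<dots> = (1/4::real)" unfolding sqrt_half by (simp add: power2_eq_square)
    finally have f4: "(1 / sqrt 2) ^ 4 = (1/4::real)" .
    have "ff (1 / sqrt 2) = hh (1 / sqrt 2) / 2"
      unfolding ff_def sqrt_half hh_def f4 by (simp add: field_simps)
    then show ?thesis using hh_sqrt_half_pos by simp
  qed
  have f2: "ff qstar < 0"
  proof -
    have K: "ellK qstar = 2 * ellEc qstar" using qs by (simp add: hh_def)
    have "ff qstar = (1 - 2 * qstar\<^sup>2) * ellEc qstar"
      unfolding ff_def K by (simp add: algebra_simps)
    moreover have "1 - 2 * qstar\<^sup>2 < 0"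
      using power_strict_mono[OF qs(1), of 2] sqrt_half by simp
    moreover have "ellEc qstar > 0" using ellEc_pos qs s0 by simp
    ultimately show ?thesis by (simp add: mult_neg_pos)
  qed
  have "\<exists>x\<ge>1 / sqrt 2. x \<le> qstar \<and> ff x = 0"
  proof (rule IVT2')
    have "{1 / sqrt 2..qstar} \<subseteq> {0<..<1}" using ge_sqrt_half_imp_pos qs by auto
    from continuous_K_E[OF this] show "continuous_on {1 / sqrt 2..qstar} ff"
      unfolding ff_def[abs_def] by (intro continuous_intros)
  qed (use qs f1 f2 in auto)
  then obtain z where z: "1 / sqrt 2 \<le> z" "z \<le> qstar" "ff z = 0" by blast
  have zz: "1 / sqrt 2 < z" "z < qstar" using z f1 f2 by (auto simp: less_le)
  have above: "ff q < 0" if "z < q" "q < 1" for q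
    using ff_sign_step[OF z(1) that] z(3) by simp
  have below: "ff q > 0" if "1 / sqrt 2 \<le> q" "q < z" for q
    using ff_sign_step[OF that(1,2)] z zz qs by force
  have "qhat = z"
    unfolding qhat_def
  proof (rule the_equality)
    show "1 / sqrt 2 \<le> z \<and> z < 1 \<and> ff z = 0" using z zz qs by auto
    show "q = z" if "1 / sqrt 2 \<le> q \<and> q < 1 \<and> ff q = 0" for q
      using above[of q] below[of q] that by (cases q z rule: linorder_cases) auto
  qed
  then show "1 / sqrt 2 < qhat" "qhat < qstar"
    "1 / sqrt 2 \<le> q \<Longrightarrow> q < qhat \<Longrightarrow> ff q > 0" "qhat < q \<Longrightarrow> q < 1 \<Longrightarrow> ff q < 0"
    using zz above below by auto
qed

text \<open>This is where \<open>ff\<close> comes from.\<close>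
lemma gg_has_derivative:
  assumes q: "0 < q" "q < 1"
  shows "(gg has_real_derivative 16 * hh q * ff q / (q * (1 - q\<^sup>2))) (at q)"
proof -
  define E K where "E = ellEc q" and "K = ellK q"
  define E' K' where "E' = (E - K) / q" and "K' = (E - (1 - q\<^sup>2) * K) / (q * (1 - q\<^sup>2))"
  have d: "(ellEc has_real_derivative E') (at q)" "(ellK has_real_derivative K') (at q)"
    using ellEc_has_derivative[OF q] ellK_has_derivative[OF q] by (simp_all add: E_def K_def E'_def K'_def)
  have q2: "1 - q\<^sup>2 > 0" using q by (simp add: power_less_one_iff)
  have "(gg has_real_derivative 16 * hh q * ((2 * E' - K') * (2 * q\<^sup>2 - 1)) + 8 * (hh q)\<^sup>2 * (4 * q)) (at q)"
    unfolding gg_def[abs_def] hh_def by (auto intro!: derivative_eq_intros d simp: algebra_simps power2_eq_square)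
  moreover have "16 * hh q * ((2 * E' - K') * (2 * q\<^sup>2 - 1)) + 8 * (hh q)\<^sup>2 * (4 * q)
     = 16 * hh q * ff q / (q * (1 - q\<^sup>2))"
  proof -
    have "(2 * E' - K') * (2 * q\<^sup>2 - 1) + 2 * hh q * q = ff q / (q * (1 - q\<^sup>2))"
    proof -
      have "(2 * E' - K') * (q * (1 - q\<^sup>2)) = 2 * (E - K) * (1 - q\<^sup>2) - (E - (1 - q\<^sup>2) * K)"
      proof -
        have "E' * q = E - K" "K' * (q * (1 - q\<^sup>2)) = E - (1 - q\<^sup>2) * K"
          using q q2 by (simp_all add: E'_def K'_def)
        moreover have "(2 * E' - K') * (q * (1 - q\<^sup>2)) = 2 * (E' * q) * (1 - q\<^sup>2) - K' * (q * (1 - q\<^sup>2))"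
          by (simp add: algebra_simps)
        ultimately show ?thesis by simp
      qed
      then have "((2 * E' - K') * (2 * q\<^sup>2 - 1) + 2 * hh q * q) * (q * (1 - q\<^sup>2))
        = (2 * (E - K) * (1 - q\<^sup>2) - (E - (1 - q\<^sup>2) * K)) * (2 * q\<^sup>2 - 1) + 2 * hh q * q * (q * (1 - q\<^sup>2))"
      proof -
        have "(a * b + c) * z = (a * z) * b + c * z" for a b c z :: real by (simp add: algebra_simps)
        then show ?thesis using \<open>(2 * E' - K') * (q * (1 - q\<^sup>2)) = _\<close> by simp
      qed
      also have "\<dots> = ff q"
        by (simp add: ff_def hh_def E_def K_def algebra_simps power2_eq_square eval_nat_numeral)
      finally show ?thesis using q q2 by (simp add: field_simps)
    qed
    then have "16 * hh q * ((2 * E' - K') * (2 * q\<^sup>2 - 1) + 2 * hh q * q) = 16 * hh q * (ff q / (q * (1 - q\<^sup>2)))"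
      by simp
    then show ?thesis by (simp add: algebra_simps power2_eq_square)
  qed
  ultimately show ?thesis by simp
qed

text \<open>The derivative has the sign of \<open>hh * ff\<close>, whose factors have the signs
  (+,+), (+,-) and (-,-) on the three intervals. It vanishes at \<open>qhat\<close> and
  \<open>qstar\<close>, hence the monotonicity tests that ask for the sign in the open interval
  only.\<close>

lemma gg_mono:
  shows "1 / sqrt 2 \<le> x \<Longrightarrow> x < y \<Longrightarrow> y \<le> qhat \<Longrightarrow> gg x < gg y"
    "qhat \<le> x \<Longrightarrow> x < y \<Longrightarrow> y \<le> qstar \<Longrightarrow> gg y < gg x"
    "qstar \<le> x \<Longrightarrow> x < y \<Longrightarrow> y < 1 \<Longrightarrow> gg x < gg y"
proof -
  note qs = qstar_props(1-3) and qh = qhat_props(1,2)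
  have cont: "continuous_on {x..y} gg" if "1 / sqrt 2 \<le> x" "y < 1" for x y
    by (intro continuous_at_imp_continuous_on ballI DERIV_isCont[OF gg_has_derivative] ge_sqrt_half_imp_pos)
      (use that in auto)
  have sgn: "0 < z * (1 - z\<^sup>2)" if "0 < z" "z < 1" for z :: real
    using that by (auto intro!: mult_pos_pos simp: power_less_one_iff)
  show "gg x < gg y" if "1 / sqrt 2 \<le> x" "x < y" "y \<le> qhat"
  proof (rule DERIV_pos_imp_increasing_open[OF that(2)])
    fix z assume z: "x < z" "z < y"
    then have z': "0 < z" "z < 1" "z < qhat" "z < qstar" "1 / sqrt 2 \<le> z" using that qs qh ge_sqrt_half_imp_pos[of z] by auto
    have "16 * hh z * ff z / (z * (1 - z\<^sup>2)) > 0"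
      using sgn[OF z'(1,2)] qstar_props(4)[OF z'(1,4)] qhat_props(3)[OF z'(5,3)] by (intro divide_pos_pos) auto
    then show "\<exists>d. (gg has_real_derivative d) (at z) \<and> 0 < d" using gg_has_derivative[OF z'(1,2)] by blast
  qed (use cont[of x y] that qs qh in auto)
  show "gg y < gg x" if "qhat \<le> x" "x < y" "y \<le> qstar"
  proof (rule DERIV_neg_imp_decreasing_open[OF that(2)])
    fix z assume z: "x < z" "z < y"
    then have z': "0 < z" "z < 1" "qhat < z" "z < qstar" using that qs qh ge_sqrt_half_imp_pos[of z] by auto
    have "16 * hh z * ff z / (z * (1 - z\<^sup>2)) < 0"
      using sgn[OF z'(1,2)] qstar_props(4)[OF z'(1,4)] qhat_props(4)[OF z'(3,2)]
      by (intro divide_neg_pos) (auto intro!: mult_neg_pos)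
    then show "\<exists>d. (gg has_real_derivative d) (at z) \<and> d < 0" using gg_has_derivative[OF z'(1,2)] by blast
  qed (use cont[of x y] that qs qh in auto)
  show "gg x < gg y" if "qstar \<le> x" "x < y" "y < 1"
  proof (rule DERIV_pos_imp_increasing_open[OF that(2)])
    fix z assume z: "x < z" "z < y"
    then have z': "0 < z" "z < 1" "qhat < z" "qstar < z" using that qs qh ge_sqrt_half_imp_pos[of z] by auto
    have "16 * hh z * ff z / (z * (1 - z\<^sup>2)) > 0"
      using sgn[OF z'(1,2)] qstar_props(5)[OF z'(4,2)] qhat_props(4)[OF z'(3,2)]
      by (intro divide_pos_pos) (auto intro!: mult_neg_neg)
    then show "\<exists>d. (gg has_real_derivative d) (at z) \<and> 0 < d" using gg_has_derivative[OF z'(1,2)] by blast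
  qed (use cont[of x y] that qs qh in auto)
qed

text \<open>A curve arrives together with its modulus, so the description is resolved by a known
  solution, and injectivity of \<open>gg\<close> on the branch is enough. The same holds for
  \<open>q2_gg\<close> and \<open>q3_gg\<close>.\<close>

lemma q1_gg:
  assumes "1 / sqrt 2 < q" "q \<le> qhat"
  shows "q1 (gg q) = q"
  unfolding q1_def
proof (rule the_equality)
  fix x assume "1 / sqrt 2 < x \<and> x \<le> qhat \<and> gg x = gg q"
  then show "x = q"
    using gg_mono(1)[of x q] gg_mono(1)[of q x] assms by (cases x q rule: linorder_cases) auto
qed (use assms in simp)

lemma q2_gg:
  assumes "qhat \<le> q" "q < qstar"
  shows "q2 (gg q) = q"
  unfolding q2_def
proof (rule the_equality)
  fix x assume "qhat \<le> x \<and> x < qstar \<and> gg x = gg q"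
  then show "x = q"
    using gg_mono(2)[of x q] gg_mono(2)[of q x] assms by (cases x q rule: linorder_cases) auto
qed (use assms in simp)

lemma q3_gg:
  assumes "qstar < q" "q < 1"
  shows "q3 (gg q) = q"
  unfolding q3_def
proof (rule the_equality)
  fix x assume "qstar < x \<and> x < 1 \<and> gg x = gg q"
  then show "x = q"
    using gg_mono(3)[of x q] gg_mono(3)[of q x] assms by (cases x q rule: linorder_cases) auto
qed (use assms in simp)

lemma gg_le_lamhat: "1 / sqrt 2 < q \<Longrightarrow> q < qstar \<Longrightarrow> gg q \<le> lamhat"
  unfolding lamhat_def using gg_mono(1)[of q qhat] gg_mono(2)[of qhat q]
  by (cases q qhat rule: linorder_cases) auto

lemma lamhat_pos: "lamhat > 0"
proof -
  have "gg (1 / sqrt 2) = 0" unfolding gg_def sqrt_half by simp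
  then show ?thesis unfolding lamhat_def using gg_mono(1)[of "1 / sqrt 2" qhat] qhat_props by simp
qed

section \<open>Almost everywhere derivatives and absolutely continuous functions\<close>

text \<open>The last hypothesis replaces absolute continuity: it makes the increments of \<open>F\<close> over intervals tagged in \<open>N\<close>
  negligible, by the Henstock lemma for \<open>p\<close> with its values on \<open>N\<close> set to zero.\<close>
lemma has_integral_of_ae_derivative:
  fixes F f p :: "real \<Rightarrow> real"
  assumes ab: "a \<le> b" and N: "negligible N"
    and der: "\<And>x. x \<in> {a..b} - N \<Longrightarrow> (F has_real_derivative f x) (at x within {a..b})"
    and p: "p integrable_on {a..b}"
    and bnd: "\<And>x y. a \<le> x \<Longrightarrow> x \<le> y \<Longrightarrow> y \<le> b \<Longrightarrow> \<bar>F y - F x\<bar> \<le> integral {x..y} p"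
  shows "(f has_integral (F b - F a)) {a..b}"
proof -
  define f0 where "f0 x = (if x \<in> N then 0 else f x)" for x
  define p0 where "p0 x = (if x \<in> N then 0 else p x)" for x
  have p0i: "p0 integrable_on {u..v}" if "a \<le> u" "v \<le> b" for u v
    using integrable_spike[OF integrable_subinterval_real[OF p, of u v] N, of p0] that
    by (auto simp: p0_def)
  have p0eq: "integral {u..v} p0 = integral {u..v} p" for u v
    by (rule integral_spike[OF N]) (auto simp: p0_def)
  have "(f0 has_integral (F b - F a)) (cbox a b)"
    unfolding has_integral
  proof (intro allI impI)
    fix e :: real assume e: "e > 0"
    \<comment> \<open>The added 2 keeps the denominator positive when a = b.\<close>
    define e' where "e' = e / (2 * (b - a) + 2)"
    have e': "e' > 0" "e' * (b - a) \<le> e / 2"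
      using e ab by (auto simp: e'_def field_simps)
    obtain \<gamma>1 where g1: "gauge \<gamma>1"
      and h1: "\<And>D. \<lbrakk>D tagged_partial_division_of (cbox a b); \<gamma>1 fine D\<rbrakk> \<Longrightarrow>
             sum (\<lambda>(x,k). norm(measure lborel k *\<^sub>R p0 x - integral k p0)) D < e/2"
      using Henstock_lemma[of p0 a b "e/2"] p0i[of a b] e by auto
    have "\<exists>d>0. \<forall>y\<in>{a..b}. \<bar>y - x\<bar> < d \<longrightarrow> \<bar>F y - F x - f x * (y - x)\<bar> \<le> e' * \<bar>y - x\<bar>"
      if "x \<in> {a..b} - N" for x
      using der[OF that] e'(1)
      unfolding has_field_derivative_def has_derivative_within_alt by auto
    then obtain d where d: "\<And>x. x \<in> {a..b} - N \<Longrightarrow> d x > 0"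
      and dd: "\<And>x y. x \<in> {a..b} - N \<Longrightarrow> y \<in> {a..b} \<Longrightarrow> \<bar>y - x\<bar> < d x \<Longrightarrow>
            \<bar>F y - F x - f x * (y - x)\<bar> \<le> e' * \<bar>y - x\<bar>"
      by metis
    define \<gamma> where "\<gamma> x = \<gamma>1 x \<inter> ball x (if x \<in> {a..b} - N then d x else 1)" for x
    have gg: "gauge \<gamma>"
      unfolding \<gamma>_def using d by (intro gauge_Int g1 gauge_ball_dependent) auto
    show "\<exists>\<gamma>. gauge \<gamma> \<and> (\<forall>D. D tagged_division_of cbox a b \<and> \<gamma> fine D \<longrightarrow>
        norm ((\<Sum>(x, k)\<in>D. measure lborel k *\<^sub>R f0 x) - (F b - F a)) < e)"
    proof (intro exI conjI allI impI, rule gg, elim conjE)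
      fix D assume D: "D tagged_division_of cbox a b" and fine: "\<gamma> fine D"
      have fin: "finite D" using D by blast
      have f1: "\<gamma>1 fine D" using fine by (auto simp: fine_def \<gamma>_def)
      have tel: "F b - F a = (\<Sum>(x,k)\<in>D. F (Sup k) - F (Inf k))"
        using additive_tagged_division_1[of a b D F] ab D by simp
      have cont: "(\<Sum>(x,k)\<in>D. measure lborel k) = b - a"
        using additive_content_tagged_division[OF D] ab by simp
      have tm: "\<bar>measure lborel k * f0 x - (F (Sup k) - F (Inf k))\<bar>
          \<le> e' * measure lborel k + \<bar>measure lborel k * p0 x - integral k p0\<bar>" if xk: "(x,k) \<in> D" for x k
      proof -
        obtain u v where k: "k = cbox u v" using D xk by blast
        have xk2: "x \<in> k" using D xk by blast
        have sub: "k \<subseteq> cbox a b" using D xk by blast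
        have uv: "a \<le> u" "u \<le> x" "x \<le> v" "v \<le> b"
          using xk2 sub unfolding k by auto
        have uv': "Sup k = v" "Inf k = u" "measure lborel k = v - u" using uv unfolding k by auto
        show ?thesis
        proof (cases "x \<in> N")
          case True
          have "\<bar>F v - F u\<bar> \<le> integral {u..v} p0"
            using bnd[of u v] uv p0eq by auto
          moreover have "0 \<le> e' * (v - u)" using e'(1) uv by simp
          ultimately show ?thesis
            using True uv unfolding uv' by (simp add: f0_def p0_def k abs_minus_commute)
        next
          case False
          have "k \<subseteq> ball x (d x)"
            using fineD[OF fine xk] False uv by (auto simp: \<gamma>_def)
          moreover have "u \<in> k" "v \<in> k" using uv unfolding k by auto
          ultimately have "u \<in> ball x (d x)" "v \<in> ball x (d x)" by blast+
          then have "\<bar>u - x\<bar> < d x" "\<bar>v - x\<bar> < d x" by (auto simp: dist_real_def)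
          then have "\<bar>F u - F x - f x * (u - x)\<bar> \<le> e' * \<bar>u - x\<bar>"
             "\<bar>F v - F x - f x * (v - x)\<bar> \<le> e' * \<bar>v - x\<bar>"
            using dd[of x u] dd[of x v] uv False by auto
          then have "\<bar>F u - F x - f x * (u - x)\<bar> \<le> e' * (x - u)"
             "\<bar>F v - F x - f x * (v - x)\<bar> \<le> e' * (v - x)"
            using uv by auto
          \<comment> \<open>Straddle argument: both ends are compared with the tag x, which lies
            between them, so the two errors add up to at most e' (v - u).\<close>
          moreover have "(v - u) * f x - (F v - F u) =
            (F u - F x - f x * (u - x)) - (F v - F x - f x * (v - x))" by (simp add: algebra_simps)
          moreover have "e' * (v - u) = e' * (x - u) + e' * (v - x)" by (simp add: algebra_simps)
          ultimately have "\<bar>(v - u) * f x - (F v - F u)\<bar> \<le> e' * (v - u)" by linarith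
          then show ?thesis using False unfolding uv' by (simp add: f0_def)
        qed
      qed
      have "norm ((\<Sum>(x, k)\<in>D. measure lborel k *\<^sub>R f0 x) - (F b - F a))
         = \<bar>\<Sum>(x,k)\<in>D. measure lborel k * f0 x - (F (Sup k) - F (Inf k))\<bar>"
        unfolding tel by (simp add: split_def sum_subtractf)
      also have "\<dots> \<le> (\<Sum>(x,k)\<in>D. \<bar>measure lborel k * f0 x - (F (Sup k) - F (Inf k))\<bar>)"
        by (simp add: split_def sum_abs)
      also have "\<dots> \<le> (\<Sum>(x,k)\<in>D. e' * measure lborel k + \<bar>measure lborel k * p0 x - integral k p0\<bar>)"
        using tm by (intro sum_mono) auto
      also have "\<dots> = e' * (b - a) + (\<Sum>(x,k)\<in>D. \<bar>measure lborel k * p0 x - integral k p0\<bar>)"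
        unfolding cont[symmetric] by (simp add: split_def sum.distrib sum_distrib_left)
      also have "\<dots> < e / 2 + e / 2"
        using h1[OF _ f1] D e'(2)
        by (intro add_le_less_mono) (auto simp: tagged_division_of_def)
      finally show "norm ((\<Sum>(x, k)\<in>D. measure lborel k *\<^sub>R f0 x) - (F b - F a)) < e" by simp
    qed
  qed
  then show ?thesis
    using has_integral_spike[OF N, of "{a..b}" f f0] by (auto simp: f0_def)
qed

text \<open>One-sided, because the differentiation theorem behind it averages over cubes with x as
  lower corner; on the line these are the intervals [x, x + h].\<close>

lemma lebesgue_right_derivative:
  fixes f :: "real \<Rightarrow> real"
  assumes "\<And>a b. f integrable_on {a..b}"
  obtains N where "negligible N"
    "\<And>x e. x \<notin> N \<Longrightarrow> 0 < e \<Longrightarrow> \<exists>d>0. \<forall>h. 0 < h \<and> h < d \<longrightarrow> \<bar>integral {x..x+h} f - h * f x\<bar> \<le> e * h"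
proof -
  obtain N where N: "negligible N"
     and *: "\<And>x e. \<lbrakk>x \<notin> N; 0 < e\<rbrakk> \<Longrightarrow>
               \<exists>d>0. \<forall>h. 0 < h \<and> h < d \<longrightarrow>
                         norm(integral (cbox x (x + h *\<^sub>R One)) f /\<^sub>R h ^ DIM(real) - f x) < e"
    using integrable_ccontinuous_explicit[of f] assms by (metis box_real(2))
  show ?thesis
  proof (rule that[OF N])
    fix x e :: real assume "x \<notin> N" "0 < e"
    from *[OF this] obtain d where d: "d > 0"
      and h: "\<And>h. 0 < h \<Longrightarrow> h < d \<Longrightarrow> \<bar>integral {x..x+h} f / h - f x\<bar> < e"
      by (auto simp: divide_inverse mult.commute)
    have "\<bar>integral {x..x+h} f - h * f x\<bar> \<le> e * h" if hh: "0 < h" "h < d" for h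
    proof -
      have "integral {x..x+h} f - h * f x = (integral {x..x+h} f / h - f x) * h"
        using hh by (simp add: field_simps)
      then have "\<bar>integral {x..x+h} f - h * f x\<bar> = \<bar>integral {x..x+h} f / h - f x\<bar> * h"
        using hh by (simp add: abs_mult)
      then show ?thesis using h[OF hh] hh by (simp add: mult_right_mono)
    qed
    then show "\<exists>d>0. \<forall>h. 0 < h \<and> h < d \<longrightarrow> \<bar>integral {x..x+h} f - h * f x\<bar> \<le> e * h"
      using d by blast
  qed
qed

lemma lebesgue_differentiation:
  fixes f :: "real \<Rightarrow> real"
  assumes f: "f integrable_on {a..b}"
  obtains N where "negligible N"
    "\<And>x. x \<in> {a..b} - N \<Longrightarrow>
      ((\<lambda>x. integral {a..x} f) has_real_derivative f x) (at x within {a..b})"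
proof -
  \<comment> \<open>Extension by zero, since \<open>lebesgue_right_derivative\<close> asks for
    integrability on every interval.\<close>
  define F where "F x = (if x \<in> {a..b} then f x else 0)" for x
  have "F integrable_on UNIV"
    using integrable_restrict_UNIV[of "{a..b}" f] f by (simp add: F_def[abs_def])
  then have Fi: "F integrable_on {u..v}" for u v
    using integrable_on_subinterval by blast
  have Feq: "integral {u..v} F = integral {u..v} f" if "a \<le> u" "v \<le> b" for u v
    by (rule integral_cong) (use that in \<open>auto simp: F_def\<close>)
  \<comment> \<open>Averages of G to the right of -x are averages of F to the left of x.\<close>
  define G where "G x = F (- x)" for x
  have Gi: "G integrable_on {u..v}" for u v
    unfolding G_def using Henstock_Kurzweil_Integration.integrable_reflect_real[where f=F and a="-v" and b="-u"] Fi by simp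
  have Geq: "integral {-v..-u} G = integral {u..v} F" for u v
    unfolding G_def by simp
  obtain N1 where N1: "negligible N1"
    and h1: "\<And>x e. x \<notin> N1 \<Longrightarrow> 0 < e \<Longrightarrow> \<exists>d>0. \<forall>h. 0 < h \<and> h < d \<longrightarrow> \<bar>integral {x..x+h} F - h * F x\<bar> \<le> e * h"
    using lebesgue_right_derivative[OF Fi] by metis
  obtain N2 where N2: "negligible N2"
    and h2: "\<And>x e. x \<notin> N2 \<Longrightarrow> 0 < e \<Longrightarrow> \<exists>d>0. \<forall>h. 0 < h \<and> h < d \<longrightarrow> \<bar>integral {x..x+h} G - h * G x\<bar> \<le> e * h"
    using lebesgue_right_derivative[OF Gi] by metis
  define N where "N = N1 \<union> uminus ` N2"
  have N: "negligible N"
    unfolding N_def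
    by (intro negligible_Un N1 negligible_differentiable_image_negligible N2)
      (auto intro!: derivative_intros)
  show ?thesis
  proof (rule that[OF N])
    fix x assume x: "x \<in> {a..b} - N"
    then have x1: "x \<notin> N1" and x2: "-x \<notin> N2" by (auto simp: N_def image_iff)
    have "\<exists>d>0. \<forall>y\<in>{a..b}. \<bar>y - x\<bar> < d \<longrightarrow>
         \<bar>integral {a..y} f - integral {a..x} f - f x * (y - x)\<bar> \<le> e * \<bar>y - x\<bar>" if e: "e > 0" for e
    proof -
      obtain d1 where d1: "d1 > 0" "\<And>h. 0 < h \<Longrightarrow> h < d1 \<Longrightarrow> \<bar>integral {x..x+h} F - h * F x\<bar> \<le> e * h"
        using h1[OF x1 e] by blast
      obtain d2 where d2: "d2 > 0" "\<And>h. 0 < h \<Longrightarrow> h < d2 \<Longrightarrow> \<bar>integral {-x..-x+h} G - h * G (-x)\<bar> \<le> e * h"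
        using h2[OF x2 e] by blast
      have "\<bar>integral {a..y} f - integral {a..x} f - f x * (y - x)\<bar> \<le> e * \<bar>y - x\<bar>"
        if y: "y \<in> {a..b}" and yd: "\<bar>y - x\<bar> < min d1 d2" for y
      proof -
        consider "y = x" | "y > x" | "y < x" by linarith
        then show ?thesis
        proof cases
          case 1 then show ?thesis by simp
        next
          case 2
          have "integral {a..x} f + integral {x..y} f = integral {a..y} f"
            using 2 x y by (intro Henstock_Kurzweil_Integration.integral_combine integrable_subinterval_real[OF f]) auto
          then show ?thesis using d1(2)[of "y - x"] 2 yd x y Feq[of x y]
            by (auto simp: F_def algebra_simps)
        next
          case 3
          have "integral {a..y} f + integral {y..x} f = integral {a..x} f"
            using 3 x y by (intro Henstock_Kurzweil_Integration.integral_combine integrable_subinterval_real[OF f]) auto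
          then show ?thesis using d2(2)[of "x - y"] 3 yd x y Feq[of y x] Geq[of x y]
            by (auto simp: F_def G_def algebra_simps)
        qed
      qed
      then show ?thesis using d1(1) d2(1) by (intro exI[of _ "min d1 d2"]) auto
    qed
    then show "((\<lambda>x. integral {a..x} f) has_real_derivative f x) (at x within {a..b})"
      unfolding has_field_derivative_def has_derivative_within_alt
      by (auto intro: bounded_linear_mult_right)
  qed
qed

section \<open>Differentiation under the integral sign and the lemma of du Bois-Reymond\<close>

lemma has_derivative_integral_dominated:
  fixes f f' :: "real \<Rightarrow> real \<Rightarrow> real" and S :: "real set"
  assumes \<delta>: "\<delta> > 0"
    and int: "\<And>e. \<bar>e\<bar> < \<delta> \<Longrightarrow> f e integrable_on S"
    and der: "\<And>e x. \<bar>e\<bar> < \<delta> \<Longrightarrow> x \<in> S \<Longrightarrow> ((\<lambda>e. f e x) has_real_derivative f' e x) (at e)"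
    and bnd: "\<And>e x. \<bar>e\<bar> < \<delta> \<Longrightarrow> x \<in> S \<Longrightarrow> \<bar>f' e x\<bar> \<le> h x"
    and h: "h integrable_on S"
  shows "f' 0 integrable_on S"
    "((\<lambda>e. integral S (f e)) has_real_derivative integral S (f' 0)) (at 0)"
proof -
  \<comment> \<open>By the mean value inequality the difference quotients in e are dominated by h,
    so dominated convergence applies along every sequence tending to 0.\<close>
  have lip: "\<bar>f e x - f 0 x\<bar> \<le> h x * \<bar>e\<bar>" if "\<bar>e\<bar> < \<delta>" "x \<in> S" for e x
  proof -
    have "norm (f e x - f 0 x) \<le> h x * norm (e - 0)"
    proof (rule field_differentiable_bound[of "{-\<bar>e\<bar>..\<bar>e\<bar>}" "\<lambda>e. f e x" "\<lambda>e. f' e x"])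
      fix z assume "z \<in> {-\<bar>e\<bar>..\<bar>e\<bar>}"
      then have "\<bar>z\<bar> < \<delta>" using that by auto
      then show "((\<lambda>e. f e x) has_field_derivative f' z x) (at z within {-\<bar>e\<bar>..\<bar>e\<bar>})" "norm (f' z x) \<le> h x"
        using der[of z x] bnd[of z x] that by (auto intro: has_field_derivative_at_within)
    qed auto
    then show ?thesis by simp
  qed
  have conv: "f' 0 integrable_on S \<and>
     (\<lambda>n. (integral S (f (X n)) - integral S (f 0)) / X n) \<longlonglongrightarrow> integral S (f' 0)"
    if X: "\<And>n. X n \<noteq> 0" "\<And>n. \<bar>X n\<bar> < \<delta>" "X \<longlonglongrightarrow> 0" for X :: "nat \<Rightarrow> real"
  proof -
    define q where "q n x = (f (X n) x - f 0 x) / X n" for n x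
    have 1: "q n integrable_on S" for n
      unfolding q_def using int[of "X n"] int[of 0] X \<delta>
      by (intro integrable_on_divide integrable_diff) auto
    have 2: "norm (q n x) \<le> h x" if "x \<in> S" for n x
      using lip[of "X n" x] X that by (simp add: q_def field_simps)
    have 3: "(\<lambda>n. q n x) \<longlonglongrightarrow> f' 0 x" if "x \<in> S" for x
    proof -
      have "((\<lambda>e. (f e x - f 0 x) / (e - 0)) \<longlongrightarrow> f' 0 x) (at 0)"
        using der[of 0 x] \<delta> that by (simp add: has_field_derivative_iff)
      moreover have "filterlim X (at 0) sequentially"
        using X by (simp add: filterlim_at)
      ultimately show ?thesis unfolding q_def
        using filterlim_compose[of "\<lambda>e. (f e x - f 0 x) / (e - 0)"] by fastforce
    qed
    have 4: "integral S (q n) = (integral S (f (X n)) - integral S (f 0)) / X n" for n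
      unfolding q_def using int[of "X n"] int[of 0] X \<delta>
      by (simp add: integral_diff)
    show ?thesis
      using dominated_convergence[of q S h "f' 0"] 1 2 3 h unfolding 4 by auto
  qed
  \<comment> \<open>One explicit sequence, to obtain the integrability of \<open>f' 0\<close> as
    that of a limit. The 2 keeps every term strictly below \<delta>.\<close>
  define X0 where "X0 n = \<delta> / (real n + 2)" for n
  have "(\<lambda>n. \<delta> * inverse (real (Suc (Suc n)))) \<longlonglongrightarrow> \<delta> * 0"
    by (rule tendsto_mult[OF tendsto_const LIMSEQ_Suc[OF LIMSEQ_inverse_real_of_nat]])
  then have "X0 \<longlonglongrightarrow> 0" by (simp add: X0_def[abs_def] divide_inverse add.commute)
  moreover have "X0 n \<noteq> 0" "\<bar>X0 n\<bar> < \<delta>" for n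
  proof -
    have "\<delta> * 1 < \<delta> * (real n + 2)" using \<delta> by (intro mult_strict_left_mono) auto
    then show "\<bar>X0 n\<bar> < \<delta>" using \<delta> by (simp add: X0_def divide_simps)
  qed (use \<delta> in \<open>simp add: X0_def\<close>)
  ultimately show "f' 0 integrable_on S"
    using conv[of X0] by blast
  show "((\<lambda>e. integral S (f e)) has_real_derivative integral S (f' 0)) (at 0)"
    unfolding has_field_derivative_iff tendsto_at_iff_sequentially comp_def
  proof (intro allI impI)
    fix X :: "nat \<Rightarrow> real" assume X: "\<forall>i. X i \<in> UNIV - {0}" and X0: "X \<longlonglongrightarrow> 0"
    then obtain k where k: "\<And>n. n \<ge> k \<Longrightarrow> \<bar>X n\<bar> < \<delta>"
      using \<delta> unfolding LIMSEQ_iff by (metis diff_zero real_norm_def)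
    have "(\<lambda>n. (integral S (f (X (n + k))) - integral S (f 0)) / X (n + k)) \<longlonglongrightarrow> integral S (f' 0)"
      using conv[of "\<lambda>n. X (n + k)"] X k LIMSEQ_ignore_initial_segment[OF X0, of k] by auto
    then show "(\<lambda>n. (integral S (f (X n)) - integral S (f 0)) / (X n - 0)) \<longlonglongrightarrow> integral S (f' 0)"
      using LIMSEQ_offset[of "\<lambda>n. (integral S (f (X n)) - integral S (f 0)) / X n" k] by simp
  qed
qed

lemma abs_integral_le_integral_abs:
  fixes Q :: "real \<Rightarrow> real"
  assumes Q: "Q absolutely_integrable_on {a..b}" and "a \<le> x" "x \<le> y" "y \<le> b"
  shows "\<bar>integral {a..y} Q - integral {a..x} Q\<bar> \<le> integral {x..y} (\<lambda>t. \<bar>Q t\<bar>)"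
proof -
  have "Q integrable_on {a..b}" "(\<lambda>t. \<bar>Q t\<bar>) integrable_on {a..b}"
    using Q by (auto simp: absolutely_integrable_on_def)
  then have i: "Q integrable_on {x..y}" "(\<lambda>t. \<bar>Q t\<bar>) integrable_on {x..y}" "Q integrable_on {a..y}"
    using assms by (auto intro: integrable_subinterval_real)
  have "integral {a..x} Q + integral {x..y} Q = integral {a..y} Q"
    using i assms by (intro Henstock_Kurzweil_Integration.integral_combine) auto
  moreover have "\<bar>integral {x..y} Q\<bar> \<le> integral {x..y} (\<lambda>t. \<bar>Q t\<bar>)"
    using integral_norm_bound_integral[OF i(1,2)] by simp
  ultimately show ?thesis by linarith
qed

lemma has_real_derivative_within_unique:
  fixes F :: "real \<Rightarrow> real"
  assumes "(F has_real_derivative d) (at x within {a..b})" "(F has_real_derivative e) (at x within {a..b})"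
    "a < b" "x \<in> {a..b}"
  shows "d = e"
  using vector_derivative_unique_within_closed_interval[of a b x F d e] assms
  by (simp add: has_real_derivative_iff_has_vector_derivative)

text \<open>Integration by parts where Q is merely integrable. With R the primitive of Q, the
  product x R(x) has derivative R + x Q almost everywhere, and its increments are at most the
  integrals of B + t |Q|, where B bounds |R|.\<close>

lemma integral_by_parts_id:
  fixes Q :: "real \<Rightarrow> real"
  assumes Q: "Q absolutely_integrable_on {0..t}" and t: "0 \<le> t"
  shows "((\<lambda>x. x * Q x) has_integral (t * integral {0..t} Q - integral {0..t} (\<lambda>x. integral {0..x} Q))) {0..t}"
proof -
  define R where "R x = integral {0..x} Q" for x
  have Qi: "Q integrable_on {0..t}" "(\<lambda>t. \<bar>Q t\<bar>) integrable_on {0..t}"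
    using Q by (auto simp: absolutely_integrable_on_def)
  have Rc: "continuous_on {0..t} R"
    unfolding R_def using indefinite_integral_continuous_1[OF Qi(1)] .
  obtain B where "\<forall>y\<in>R ` {0..t}. norm y \<le> B"
    using compact_imp_bounded[OF compact_continuous_image[OF Rc compact_Icc]]
    unfolding bounded_iff by blast
  then have B: "\<bar>R x\<bar> \<le> B" if "x \<in> {0..t}" for x
    using that by auto
  obtain N where N: "negligible N" and dN: "\<And>x. x \<in> {0..t} - N \<Longrightarrow>
      (R has_real_derivative Q x) (at x within {0..t})"
    unfolding R_def[abs_def] using lebesgue_differentiation[OF Qi(1)] by metis
  have "((\<lambda>x. R x + x * Q x) has_integral (t * R t - 0 * R 0)) {0..t}"
  proof (rule has_integral_of_ae_derivative[OF t N, where p="\<lambda>x. B + t * \<bar>Q x\<bar>"])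
    fix x assume "x \<in> {0..t} - N"
    from dN[OF this] show "((\<lambda>x. x * R x) has_real_derivative R x + x * Q x) (at x within {0..t})"
      by (auto intro!: derivative_eq_intros)
  next
    show "(\<lambda>x. B + t * \<bar>Q x\<bar>) integrable_on {0..t}"
      using Qi by (intro integrable_add integrable_on_mult_right) auto
  next
    fix x y assume xy: "0 \<le> x" "x \<le> y" "y \<le> t"
    have "y * R y - x * R x = (y - x) * R x + y * (R y - R x)" by (simp add: algebra_simps)
    moreover have "\<bar>(y - x) * R x\<bar> \<le> B * (y - x)"
      using B[of x] xy by (auto simp: abs_mult mult.commute mult_right_mono)
    moreover have "\<bar>y * (R y - R x)\<bar> \<le> t * integral {x..y} (\<lambda>t. \<bar>Q t\<bar>)"
      using abs_integral_le_integral_abs[OF Q, of x y] xy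
      by (auto simp: abs_mult R_def intro!: mult_mono)
    moreover have "integral {x..y} (\<lambda>x. B + t * \<bar>Q x\<bar>) = B * (y - x) + t * integral {x..y} (\<lambda>t. \<bar>Q t\<bar>)"
      using xy integrable_subinterval_real[OF Qi(2), of x y]
      by (subst integral_add) (auto intro!: integrable_on_mult_right simp: mult.commute)
    ultimately show "\<bar>y * R y - x * R x\<bar> \<le> integral {x..y} (\<lambda>x. B + t * \<bar>Q x\<bar>)" by linarith
  qed
  then have 1: "((\<lambda>x. R x + x * Q x) has_integral (t * R t)) {0..t}" by simp
  have 2: "(R has_integral (integral {0..t} R)) {0..t}"
    using integrable_continuous_real[OF Rc] by (rule integrable_integral)
  show ?thesis
    using has_integral_diff[OF 1 2] by (simp add: R_def[abs_def] R_def)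
qed

text \<open>The test function is the piecewise linear primitive, with mean zero, of the indicator of [0,t].\<close>
lemma du_bois_reymond:
  fixes S Q :: "real \<Rightarrow> real"
  assumes S: "S absolutely_integrable_on {0..1}" and Q: "Q absolutely_integrable_on {0..1}"
    and eq: "\<And>t. t \<in> {0..1} \<Longrightarrow>
      integral {0..1} (\<lambda>x. S x * (if x \<le> t then 1 else 0) + (min x t - (t - t\<^sup>2 / 2)) * Q x) = 0"
  obtains N where "negligible N"
    "\<And>x. x \<in> {0..1} - N \<Longrightarrow> S x = integral {0..x} Q - x * integral {0..1} Q"
proof -
  define R where "R x = integral {0..x} Q" for x
  have Qi: "Q integrable_on {0..1}" and Si: "S integrable_on {0..1}"
    using S Q by (auto simp: absolutely_integrable_on_def)
  have Rc: "continuous_on {0..1} R"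
    unfolding R_def using indefinite_integral_continuous_1[OF Qi] .
  define U where "U x = R x - x * R 1" for x
  have Uc: "continuous_on {0..1} U"
    unfolding U_def by (intro continuous_intros Rc)
  \<comment> \<open>Since t is arbitrary, the hypothesis says that S and U have the same primitive;
    differentiating it gives S = U almost everywhere.\<close>
  have SU: "integral {0..t} S = integral {0..t} U" if t: "t \<in> {0..1}" for t
  proof -
    have Qt: "Q absolutely_integrable_on {0..t}"
      using Q t by (auto intro: absolutely_integrable_on_subinterval)
    have Rt: "R integrable_on {0..t}"
      using t by (intro integrable_continuous_real continuous_on_subset[OF Rc]) auto
    have a: "((\<lambda>x. S x + (min x t - (t - t\<^sup>2 / 2)) * Q x) has_integral
        (integral {0..t} S + (t * R t - integral {0..t} R - (t - t\<^sup>2/2) * R t))) {0..t}"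
    proof (rule has_integral_eq)
      show "((\<lambda>x. S x + (x * Q x - (t - t\<^sup>2/2) * Q x)) has_integral
        (integral {0..t} S + (t * R t - integral {0..t} R - (t - t\<^sup>2/2) * R t))) {0..t}"
        using t integrable_subinterval_real[OF Si, of 0 t] integrable_subinterval_real[OF Qi, of 0 t]
          integral_by_parts_id[OF Qt]
        by (intro has_integral_add has_integral_diff has_integral_mult_right)
          (auto simp: R_def[abs_def] R_def intro: integrable_integral)
    qed (auto simp: algebra_simps)
    have comb: "R t + integral {t..1} Q = R 1"
      unfolding R_def using t by (intro Henstock_Kurzweil_Integration.integral_combine Qi) auto
    \<comment> \<open>To the right of t the slope has the constant value t^2/2 and the indicator is
      0, except at x = t itself.\<close>
    have b: "((\<lambda>x. S x * (if x \<le> t then 1 else 0) + (min x t - (t - t\<^sup>2 / 2)) * Q x) has_integral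
        (t\<^sup>2/2) * (R 1 - R t)) {t..1}"
    proof (rule has_integral_spike)
      show "((\<lambda>x. (t\<^sup>2/2) * Q x) has_integral (t\<^sup>2/2) * (R 1 - R t)) {t..1}"
        using t integrable_subinterval_real[OF Qi, of t 1] comb
        by (intro has_integral_mult_right) (auto intro: integrable_integral simp: has_integral_iff)
      show "negligible {t}" by simp
    qed auto
    have a': "((\<lambda>x. S x * (if x \<le> t then 1 else 0) + (min x t - (t - t\<^sup>2 / 2)) * Q x) has_integral
        (integral {0..t} S + (t * R t - integral {0..t} R - (t - t\<^sup>2/2) * R t))) {0..t}"
      by (rule has_integral_eq[OF _ a]) auto
    have "(integral {0..t} S + (t * R t - integral {0..t} R - (t - t\<^sup>2/2) * R t)) + (t\<^sup>2/2) * (R 1 - R t) = 0"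
      using integral_unique[OF has_integral_combine[OF _ _ a' b]] eq[OF t] t by simp
    \<comment> \<open>Here s stands for t^2/2 and the integrals are treated as atoms: all terms with
      r, the value of R at t, cancel.\<close>
    moreover have "A = I - s * r1" if "(A + (t * r - I - (t - s) * r)) + s * (r1 - r) = 0" for A I s r r1
      using that by (simp add: algebra_simps)
    ultimately have "integral {0..t} S = integral {0..t} R - t\<^sup>2/2 * R 1"
      by blast
    also have "\<dots> = integral {0..t} U"
    proof -
      have "((\<lambda>x. x * R 1) has_integral (t\<^sup>2/2 * R 1)) {0..t}"
        using has_integral_mult_left[OF ident_has_integral, of 0 t "R 1"] t by simp
      from has_integral_diff[OF integrable_integral[OF Rt] this]
      show ?thesis by (simp add: U_def[abs_def] has_integral_iff)
    qed
    finally show ?thesis .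
  qed
  obtain N where N: "negligible N" and dN: "\<And>x. x \<in> {0..1} - N \<Longrightarrow>
      ((\<lambda>x. integral {0..x} S) has_real_derivative S x) (at x within {0..1})"
    using lebesgue_differentiation[OF Si] by metis
  show ?thesis
  proof (rule that[OF N])
    fix x assume x: "x \<in> {0..1} - N"
    have "((\<lambda>x. integral {0..x} U) has_real_derivative U x) (at x within {0..1})"
      using integral_has_real_derivative[OF Uc] x by auto
    then have "((\<lambda>x. integral {0..x} S) has_real_derivative U x) (at x within {0..1})"
      using x SU by (subst has_field_derivative_cong_eventually[where g="\<lambda>x. integral {0..x} U"])
         (auto simp: eventually_at_filter)
    from has_real_derivative_within_unique[OF dN[OF x] this] x
    show "S x = integral {0..x} Q - x * integral {0..1} Q" by (simp add: U_def R_def)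
  qed
qed

section \<open>The first variation of the energy\<close>

text \<open>Energy density of a curve with first derivative \<open>(v1, v2)\<close> and second derivative \<open>(g1, g2)\<close>; \<open>dlagrangian\<close> is its
  derivative in the direction of a variation with first derivative \<open>(w1, w2)\<close> and second derivative \<open>(h1, h2)\<close>.\<close>
definition lagrangian :: "real \<Rightarrow> real \<Rightarrow> real \<Rightarrow> real \<Rightarrow> real \<Rightarrow> real" where
  "lagrangian lam v1 v2 g1 g2 =
     (v1 * g2 - v2 * g1)\<^sup>2 / sqrt (v1\<^sup>2 + v2\<^sup>2) ^ 5 + lam * sqrt (v1\<^sup>2 + v2\<^sup>2)"

definition dlagrangian :: "real \<Rightarrow> real \<Rightarrow> real \<Rightarrow> real \<Rightarrow> real \<Rightarrow> real \<Rightarrow> real \<Rightarrow> real \<Rightarrow> real \<Rightarrow> real" where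
  "dlagrangian lam v1 v2 g1 g2 w1 w2 h1 h2 =
     2 * (v1 * g2 - v2 * g1) * (w1 * g2 - w2 * g1 + v1 * h2 - v2 * h1) / sqrt (v1\<^sup>2 + v2\<^sup>2) ^ 5
     - 5 * (v1 * g2 - v2 * g1)\<^sup>2 * (v1 * w1 + v2 * w2) / sqrt (v1\<^sup>2 + v2\<^sup>2) ^ 7
     + lam * (v1 * w1 + v2 * w2) / sqrt (v1\<^sup>2 + v2\<^sup>2)"

lemma lagrangian_has_derivative:
  assumes "(v1 + e * w1)\<^sup>2 + (v2 + e * w2)\<^sup>2 > 0"
  shows "((\<lambda>e. lagrangian lam (v1 + e * w1) (v2 + e * w2) (g1 + e * h1) (g2 + e * h2)) has_real_derivative
     dlagrangian lam (v1 + e * w1) (v2 + e * w2) (g1 + e * h1) (g2 + e * h2) w1 w2 h1 h2) (at e)"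
proof -
  define V1 V2 G1 G2 where V: "V1 = (\<lambda>e. v1 + e * w1)" "V2 = (\<lambda>e. v2 + e * w2)"
    "G1 = (\<lambda>e. g1 + e * h1)" "G2 = (\<lambda>e. g2 + e * h2)"
  define n where "n = (\<lambda>e. sqrt ((V1 e)\<^sup>2 + (V2 e)\<^sup>2))"
  have d: "(V1 has_real_derivative w1) (at e)" "(V2 has_real_derivative w2) (at e)"
    "(G1 has_real_derivative h1) (at e)" "(G2 has_real_derivative h2) (at e)"
    unfolding V by (auto intro!: derivative_eq_intros)
  have n0: "n e > 0" using assms by (simp add: n_def V)
  have "((\<lambda>e. (V1 e)\<^sup>2 + (V2 e)\<^sup>2) has_real_derivative (2 * V1 e * w1 + 2 * V2 e * w2)) (at e)"
    by (auto intro!: derivative_eq_intros d)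
  from DERIV_chain2[OF DERIV_real_sqrt this]
  have dn: "(n has_real_derivative (V1 e * w1 + V2 e * w2) / n e) (at e)"
    unfolding n_def by (rule DERIV_cong) (use assms in \<open>auto simp: V divide_simps algebra_simps\<close>)
  define P where "P e = V1 e * G2 e - V2 e * G1 e" for e
  define P' where "P' = w1 * G2 e - w2 * G1 e + V1 e * h2 - V2 e * h1"
  define nd where "nd = V1 e * w1 + V2 e * w2"
  have dP: "(P has_real_derivative P') (at e)"
    unfolding P_def[abs_def] P'_def by (auto intro!: derivative_eq_intros d simp: algebra_simps)
  have dP2: "((\<lambda>e. (P e)\<^sup>2) has_real_derivative 2 * P e * P') (at e)"
    by (auto intro!: derivative_eq_intros dP)
  have dn5: "((\<lambda>e. n e ^ 5) has_real_derivative 5 * n e ^ 3 * nd) (at e)"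
    using n0 by (auto intro!: derivative_eq_intros dn[folded nd_def] simp: field_simps eval_nat_numeral)
  have "((\<lambda>e. (P e)\<^sup>2 / n e ^ 5 + lam * n e) has_real_derivative
     2 * P e * P' / n e ^ 5 - 5 * (P e)\<^sup>2 * nd / n e ^ 7 + lam * nd / n e) (at e)"
  proof (rule DERIV_cong[OF DERIV_add[OF DERIV_divide[OF dP2 dn5] DERIV_cmult[OF dn]]])
    have "(a * N ^ 5 - b * (5 * N ^ 3 * c)) / (N ^ 5 * N ^ 5) = a / N ^ 5 - 5 * b * c / N ^ 7"
      if "N \<noteq> 0" for a b c N :: real
    proof -
      have "N ^ 5 * N ^ 5 = N ^ 3 * N ^ 7" by (simp flip: power_add)
      then have "b * (5 * N ^ 3 * c) / (N ^ 5 * N ^ 5) = N ^ 3 * (5 * b * c) / (N ^ 3 * N ^ 7)"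
        by (simp add: ac_simps)
      also have "\<dots> = 5 * b * c / N ^ 7" using that by (intro mult_divide_mult_cancel_left) simp
      finally have 2: "b * (5 * N ^ 3 * c) / (N ^ 5 * N ^ 5) = 5 * b * c / N ^ 7" .
      have 1: "a * N ^ 5 / (N ^ 5 * N ^ 5) = a / N ^ 5"
        using that by (intro nonzero_mult_divide_mult_cancel_right) simp
      show ?thesis unfolding diff_divide_distrib 1 2 ..
    qed
    then show "(2 * P e * P' * n e ^ 5 - (P e)\<^sup>2 * (5 * n e ^ 3 * nd)) / (n e ^ 5 * n e ^ 5)
      + lam * ((V1 e * w1 + V2 e * w2) / n e)
      = 2 * P e * P' / n e ^ 5 - 5 * (P e)\<^sup>2 * nd / n e ^ 7 + lam * nd / n e"
      using n0 by (simp add: nd_def)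
  qed (use n0 in simp)
  then show ?thesis unfolding lagrangian_def dlagrangian_def n_def P_def P'_def nd_def V .
qed

lemma abs_le_sqrt_sum: "\<bar>a\<bar> \<le> sqrt (a\<^sup>2 + b\<^sup>2)" "\<bar>b\<bar> \<le> sqrt (a\<^sup>2 + b\<^sup>2)" for a b :: real
  by (auto intro!: real_le_rsqrt)

lemma abs_det_bound: "\<bar>a * d - b * c\<bar> \<le> M * (\<bar>c\<bar> + \<bar>d\<bar>)" if "\<bar>a\<bar> \<le> M" "\<bar>b\<bar> \<le> M" for a b c d :: real
proof -
  have "\<bar>a * d\<bar> \<le> M * \<bar>d\<bar>" "\<bar>b * c\<bar> \<le> M * \<bar>c\<bar>"
    using that by (auto simp: abs_mult intro!: mult_right_mono)
  then show ?thesis by (simp add: algebra_simps)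
qed

lemma divide_power_bound:
  fixes a b :: real
  assumes "0 < m" "m \<le> n" "\<bar>a\<bar> \<le> b"
  shows "\<bar>a / n ^ k\<bar> \<le> b / m ^ k"
  using assms by (auto simp: abs_divide power_mono intro!: frac_le)

text \<open>This is the domination behind the first variation: \<open>dlagrangian\<close> is at most
  quadratic in the second derivatives, and those of a W22 curve are square integrable. The summand 1
  ensures G >= 1, so that terms of lower degree are absorbed by G^2.\<close>

lemma dlagrangian_bound:
  assumes m: "0 < m" "m \<le> sqrt (v1\<^sup>2 + v2\<^sup>2)" and M: "sqrt (v1\<^sup>2 + v2\<^sup>2) \<le> M"
    and w: "\<bar>w1\<bar> \<le> W" "\<bar>w2\<bar> \<le> W" and h: "\<bar>h1\<bar> \<le> 1" "\<bar>h2\<bar> \<le> 1"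
    and G: "1 + \<bar>g1\<bar> + \<bar>g2\<bar> \<le> G" and lam: "lam \<ge> 0"
  shows "\<bar>dlagrangian lam v1 v2 g1 g2 w1 w2 h1 h2\<bar> \<le>
     (2 * M * (W + 2 * M) / m ^ 5 + 5 * M\<^sup>2 * (2 * M * W) / m ^ 7 + lam * (2 * M * W) / m) * G\<^sup>2"
proof -
  have v: "\<bar>v1\<bar> \<le> M" "\<bar>v2\<bar> \<le> M" using abs_le_sqrt_sum[where a=v1 and b=v2] M by linarith+
  have M0: "M \<ge> 0" and W0: "W \<ge> 0" and G0: "G \<ge> 1" using v w G by linarith+
  have P: "\<bar>v1 * g2 - v2 * g1\<bar> \<le> M * G"
    using abs_det_bound[OF v, of g2 g1] mult_left_mono[OF G M0] M0 by (simp add: algebra_simps)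
  have "\<bar>w1 * g2 - w2 * g1\<bar> \<le> W * G"
    using abs_det_bound[OF w, of g2 g1] mult_left_mono[OF G W0] W0 by (simp add: algebra_simps)
  moreover have "\<bar>v1 * h2 - v2 * h1\<bar> \<le> 2 * M * G"
  proof -
    have "M * (\<bar>h1\<bar> + \<bar>h2\<bar>) \<le> M * (2 * G)" using h G0 M0 by (intro mult_left_mono) auto
    then show ?thesis using abs_det_bound[OF v, of h2 h1] by simp
  qed
  ultimately have P': "\<bar>w1 * g2 - w2 * g1 + v1 * h2 - v2 * h1\<bar> \<le> (W + 2 * M) * G"
    unfolding distrib_right by linarith
  have vw: "\<bar>v1 * w1 + v2 * w2\<bar> \<le> 2 * M * W"
  proof -
    have "\<bar>v1 * w1\<bar> \<le> M * W" "\<bar>v2 * w2\<bar> \<le> M * W"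
      using v w by (auto simp: abs_mult intro!: mult_mono)
    then show ?thesis by linarith
  qed
  have P2: "(v1 * g2 - v2 * g1)\<^sup>2 \<le> M\<^sup>2 * G\<^sup>2"
    using power_mono[OF P, of 2] by (simp add: power_mult_distrib)
  have "\<bar>2 * (v1 * g2 - v2 * g1) * (w1 * g2 - w2 * g1 + v1 * h2 - v2 * h1)\<bar> \<le> 2 * (M * G) * ((W + 2 * M) * G)"
    using P P' M0 G0 unfolding abs_mult by (intro mult_mono) auto
  then have 1: "\<bar>2 * (v1 * g2 - v2 * g1) * (w1 * g2 - w2 * g1 + v1 * h2 - v2 * h1)\<bar> \<le> 2 * M * (W + 2 * M) * G\<^sup>2"
    by (simp add: power2_eq_square algebra_simps)
  have "\<bar>5 * (v1 * g2 - v2 * g1)\<^sup>2 * (v1 * w1 + v2 * w2)\<bar> \<le> 5 * (M\<^sup>2 * G\<^sup>2) * (2 * M * W)"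
    using P2 vw M0 W0 unfolding abs_mult by (intro mult_mono) auto
  then have 2: "\<bar>5 * (v1 * g2 - v2 * g1)\<^sup>2 * (v1 * w1 + v2 * w2)\<bar> \<le> 5 * M\<^sup>2 * (2 * M * W) * G\<^sup>2"
    by (simp add: algebra_simps)
  have "\<bar>lam * (v1 * w1 + v2 * w2)\<bar> \<le> lam * (2 * M * W)"
    using vw lam unfolding abs_mult by (intro mult_mono) auto
  also have "\<dots> \<le> lam * (2 * M * W) * G\<^sup>2"
    using M0 W0 G0 lam mult_left_mono[of 1 "G\<^sup>2" "lam * (2 * M * W)"] by simp
  finally have 3: "\<bar>lam * (v1 * w1 + v2 * w2)\<bar> \<le> lam * (2 * M * W) * G\<^sup>2" .
  have tri: "\<bar>a - b + c\<bar> \<le> A + B + C" if "\<bar>a\<bar> \<le> A" "\<bar>b\<bar> \<le> B" "\<bar>c\<bar> \<le> C" for a b c A B C :: real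
    using that by linarith
  show ?thesis
    unfolding dlagrangian_def distrib_right times_divide_eq_left
    using tri[OF divide_power_bound[OF m 1, of 5] divide_power_bound[OF m 2, of 7]
        divide_power_bound[OF m 3, of 1], unfolded power_one_right] .
qed

lemma integrable_on_of_measurable_bound:
  fixes f :: "real \<Rightarrow> real"
  assumes "f \<in> borel_measurable (lebesgue_on S)" "h integrable_on S" "S \<in> sets lebesgue"
    "\<And>x. x \<in> S \<Longrightarrow> \<bar>f x\<bar> \<le> h x"
  shows "f integrable_on S"
  using measurable_bounded_by_integrable_imp_integrable[OF assms(1,2) _ assms(3)] assms(4) by simp

lemma borel_measurable_continuous_on_Icc:
  fixes f :: "real \<Rightarrow> real"
  assumes "continuous_on {a..b} f"
  shows "f \<in> borel_measurable (lebesgue_on {a..b})"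
  using continuous_imp_measurable_on_sets_lebesgue[OF assms] by simp

text \<open>Cauchy-Schwarz for the three numbers 3, |a| and |b|. The 3 collects the 1 in
  \<open>dlagrangian_bound\<close> and a 1 for each of the perturbations e h1 and e h2 of the second
  derivative.\<close>

lemma square_bound3: "(3 + \<bar>a\<bar> + \<bar>b\<bar>)\<^sup>2 \<le> 27 + 3 * a\<^sup>2 + 3 * b\<^sup>2" for a b :: real
proof -
  have "(3 + \<bar>a\<bar> + \<bar>b\<bar>)\<^sup>2 + ((\<bar>a\<bar> - 3)\<^sup>2 + (\<bar>b\<bar> - 3)\<^sup>2 + (\<bar>a\<bar> - \<bar>b\<bar>)\<^sup>2) = 27 + 3 * a\<^sup>2 + 3 * b\<^sup>2"
    by (simp add: power2_eq_square algebra_simps)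
  moreover have "(\<bar>a\<bar> - 3)\<^sup>2 + (\<bar>b\<bar> - 3)\<^sup>2 + (\<bar>a\<bar> - \<bar>b\<bar>)\<^sup>2 \<ge> 0" by simp
  ultimately show ?thesis by linarith
qed

lemma continuous_pos_bounds:
  fixes n :: "real \<Rightarrow> real"
  assumes c: "continuous_on {0..1} n" and pos: "\<And>x. x \<in> {0..1} \<Longrightarrow> n x > 0"
  obtains m M where "m > 0" "M \<ge> 0" "\<And>x. x \<in> {0..1} \<Longrightarrow> m \<le> n x" "\<And>x. x \<in> {0..1} \<Longrightarrow> n x \<le> M"
proof -
  obtain xm where xm: "xm \<in> {0..1}" "\<And>x. x \<in> {0..1} \<Longrightarrow> n xm \<le> n x"
    using continuous_attains_inf[OF compact_Icc _ c] by auto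
  obtain xM where xM: "xM \<in> {0..1}" "\<And>x. x \<in> {0..1} \<Longrightarrow> n x \<le> n xM"
    using continuous_attains_sup[OF compact_Icc _ c] by auto
  show ?thesis
    using that[of "n xm" "n xM"] pos[OF xm(1)] pos[OF xM(1)] xm(2) xM(2) by simp
qed

lemma lagrangian_integrable:
  fixes v1 v2 g1 g2 :: "real \<Rightarrow> real"
  assumes vc: "continuous_on {0..1} v1" "continuous_on {0..1} v2"
    and pos: "\<And>x. x \<in> {0..1} \<Longrightarrow> (v1 x)\<^sup>2 + (v2 x)\<^sup>2 > 0"
    and gm: "g1 \<in> borel_measurable (lebesgue_on {0..1})" "g2 \<in> borel_measurable (lebesgue_on {0..1})"
    and g2: "(\<lambda>x. (g1 x)\<^sup>2) integrable_on {0..1}" "(\<lambda>x. (g2 x)\<^sup>2) integrable_on {0..1}"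
  shows "(\<lambda>x. (v1 x * g2 x - v2 x * g1 x)\<^sup>2 / sqrt ((v1 x)\<^sup>2 + (v2 x)\<^sup>2) ^ 5) integrable_on {0..1}"
    "(\<lambda>x. sqrt ((v1 x)\<^sup>2 + (v2 x)\<^sup>2)) integrable_on {0..1}"
proof -
  define n where "n x = sqrt ((v1 x)\<^sup>2 + (v2 x)\<^sup>2)" for x
  have nc: "continuous_on {0..1} n" unfolding n_def by (intro continuous_intros vc)
  show "(\<lambda>x. sqrt ((v1 x)\<^sup>2 + (v2 x)\<^sup>2)) integrable_on {0..1}"
    using integrable_continuous_real[OF nc] by (simp add: n_def[abs_def])
  have n0: "n x > 0" if "x \<in> {0..1}" for x using pos[OF that] by (simp add: n_def)
  have ic: "continuous_on {0..1} (\<lambda>x. 1 / n x ^ 3)"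
    using n0 by (intro continuous_intros nc) (auto simp: less_le)
  obtain C where C: "\<forall>y\<in>(\<lambda>x. 1 / n x ^ 3) ` {0..1}. norm y \<le> C"
    using compact_imp_bounded[OF compact_continuous_image[OF ic compact_Icc]]
    unfolding bounded_iff by blast
  have "(\<lambda>x. (v1 x * g2 x - v2 x * g1 x)\<^sup>2 / n x ^ 5) integrable_on {0..1}"
  proof (rule integrable_on_of_measurable_bound)
    show "(\<lambda>x. (v1 x * g2 x - v2 x * g1 x)\<^sup>2 / n x ^ 5) \<in> borel_measurable (lebesgue_on {0..1})"
      by (intro borel_measurable_divide borel_measurable_power borel_measurable_diff
        borel_measurable_times gm borel_measurable_continuous_on_Icc vc nc)
    show "(\<lambda>x. C * (27 + 3 * (g1 x)\<^sup>2 + 3 * (g2 x)\<^sup>2)) integrable_on {0..1}"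
      by (intro integrable_on_mult_right integrable_add g2) auto
    fix x :: real assume x: "x \<in> {0..1}"
    have v: "\<bar>v1 x\<bar> \<le> n x" "\<bar>v2 x\<bar> \<le> n x" using abs_le_sqrt_sum by (auto simp: n_def)
    have "\<bar>v1 x * g2 x - v2 x * g1 x\<bar> \<le> n x * (\<bar>g1 x\<bar> + \<bar>g2 x\<bar>)"
      using abs_det_bound[OF v] .
    also have "\<dots> \<le> n x * (3 + \<bar>g1 x\<bar> + \<bar>g2 x\<bar>)" using n0[OF x] by simp
    finally have "(v1 x * g2 x - v2 x * g1 x)\<^sup>2 \<le> (n x)\<^sup>2 * (3 + \<bar>g1 x\<bar> + \<bar>g2 x\<bar>)\<^sup>2"

      using power_mono[of "\<bar>v1 x * g2 x - v2 x * g1 x\<bar>" "n x * (3 + \<bar>g1 x\<bar> + \<bar>g2 x\<bar>)" 2]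
      by (simp add: power_mult_distrib)
    also have "\<dots> \<le> (n x)\<^sup>2 * (27 + 3 * (g1 x)\<^sup>2 + 3 * (g2 x)\<^sup>2)"
      by (intro mult_left_mono square_bound3) auto
    finally have "(v1 x * g2 x - v2 x * g1 x)\<^sup>2 / n x ^ 5 \<le> (n x)\<^sup>2 * (27 + 3 * (g1 x)\<^sup>2 + 3 * (g2 x)\<^sup>2) / n x ^ 5"
      using n0[OF x] by (intro divide_right_mono) auto
    also have "\<dots> = (1 / n x ^ 3) * (27 + 3 * (g1 x)\<^sup>2 + 3 * (g2 x)\<^sup>2)"
      using n0[OF x] by (simp add: divide_simps eval_nat_numeral)
    also have "\<dots> \<le> C * (27 + 3 * (g1 x)\<^sup>2 + 3 * (g2 x)\<^sup>2)"
    proof (rule mult_right_mono)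
      have "norm (1 / n x ^ 3) \<le> C" using C x by blast
      then show "1 / n x ^ 3 \<le> C" unfolding real_norm_def by linarith
    qed simp
    finally show "\<bar>(v1 x * g2 x - v2 x * g1 x)\<^sup>2 / n x ^ 5\<bar> \<le> C * (27 + 3 * (g1 x)\<^sup>2 + 3 * (g2 x)\<^sup>2)"
      using n0[OF x] by simp
  qed auto
  then show "(\<lambda>x. (v1 x * g2 x - v2 x * g1 x)\<^sup>2 / sqrt ((v1 x)\<^sup>2 + (v2 x)\<^sup>2) ^ 5) integrable_on {0..1}"
    by (simp add: n_def)
qed

lemma square_integrable_add_bounded:
  fixes g h :: "real \<Rightarrow> real"
  assumes gm: "g \<in> borel_measurable (lebesgue_on {0..1})" and g2: "(\<lambda>x. (g x)\<^sup>2) integrable_on {0..1}"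
    and hm: "h \<in> borel_measurable (lebesgue_on {0..1})" and hb: "\<And>x. \<bar>h x\<bar> \<le> 1"
  shows "(\<lambda>x. (g x + e * h x)\<^sup>2) integrable_on {0..1}"
proof (rule integrable_on_of_measurable_bound)
  show "(\<lambda>x. (g x + e * h x)\<^sup>2) \<in> borel_measurable (lebesgue_on {0..1})"
    by (intro borel_measurable_power borel_measurable_add borel_measurable_times gm hm) auto
  show "(\<lambda>x. 2 * (g x)\<^sup>2 + 2 * e\<^sup>2) integrable_on {0..1}"
    by (intro integrable_add integrable_on_mult_right g2) auto
  fix x
  have "e\<^sup>2 * (h x)\<^sup>2 \<le> e\<^sup>2 * 1" using hb[of x] by (intro mult_left_mono) (auto simp: abs_square_le_1)
  then have "(e * h x)\<^sup>2 \<le> e\<^sup>2" by (simp add: power_mult_distrib)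
  moreover have "(g x + e * h x)\<^sup>2 + (g x - e * h x)\<^sup>2 = 2 * (g x)\<^sup>2 + 2 * (e * h x)\<^sup>2"
    by (simp add: power2_eq_square algebra_simps)
  moreover have "(g x - e * h x)\<^sup>2 \<ge> 0" by simp
  ultimately have "(g x + e * h x)\<^sup>2 \<le> 2 * (g x)\<^sup>2 + 2 * e\<^sup>2" by linarith
  then show "\<bar>(g x + e * h x)\<^sup>2\<bar> \<le> 2 * (g x)\<^sup>2 + 2 * e\<^sup>2" by simp
qed auto

lemma first_variation_lagrangian:
  fixes v1 v2 g1 g2 w1 w2 h1 h2 :: "real \<Rightarrow> real"
  assumes vc: "continuous_on {0..1} v1" "continuous_on {0..1} v2"
    and pos: "\<And>x. x \<in> {0..1} \<Longrightarrow> (v1 x)\<^sup>2 + (v2 x)\<^sup>2 > 0"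
    and gm: "g1 \<in> borel_measurable (lebesgue_on {0..1})" "g2 \<in> borel_measurable (lebesgue_on {0..1})"
    and g2: "(\<lambda>x. (g1 x)\<^sup>2) integrable_on {0..1}" "(\<lambda>x. (g2 x)\<^sup>2) integrable_on {0..1}"
    and wc: "continuous_on {0..1} w1" "continuous_on {0..1} w2"
    and hm: "h1 \<in> borel_measurable (lebesgue_on {0..1})" "h2 \<in> borel_measurable (lebesgue_on {0..1})"
    and hb: "\<And>x. \<bar>h1 x\<bar> \<le> 1" "\<And>x. \<bar>h2 x\<bar> \<le> 1"
    and lam: "lam \<ge> 0"
  obtains \<delta> where "\<delta> > 0"
    "\<And>e x. \<bar>e\<bar> < \<delta> \<Longrightarrow> x \<in> {0..1} \<Longrightarrow> (v1 x + e * w1 x)\<^sup>2 + (v2 x + e * w2 x)\<^sup>2 > 0"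
    "((\<lambda>e. integral {0..1} (\<lambda>x. lagrangian lam (v1 x + e * w1 x) (v2 x + e * w2 x) (g1 x + e * h1 x) (g2 x + e * h2 x)))
      has_real_derivative integral {0..1} (\<lambda>x. dlagrangian lam (v1 x) (v2 x) (g1 x) (g2 x) (w1 x) (w2 x) (h1 x) (h2 x))) (at 0)"
proof -
  define n where "n x = sqrt ((v1 x)\<^sup>2 + (v2 x)\<^sup>2)" for x
  have nc: "continuous_on {0..1} n" unfolding n_def by (intro continuous_intros vc)
  have n0: "n x > 0" if "x \<in> {0..1}" for x using pos[OF that] by (simp add: n_def)
  obtain m0 M0 where mM: "m0 > 0" "M0 \<ge> 0" "\<And>x. x \<in> {0..1} \<Longrightarrow> m0 \<le> n x" "\<And>x. x \<in> {0..1} \<Longrightarrow> n x \<le> M0"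
    using continuous_pos_bounds[OF nc n0] by metis
  have wc': "continuous_on {0..1} (\<lambda>x. \<bar>w1 x\<bar> + \<bar>w2 x\<bar>)" by (intro continuous_intros wc)
  obtain xW where xW: "xW \<in> {0..1}" "\<And>x. x \<in> {0..1} \<Longrightarrow> \<bar>w1 x\<bar> + \<bar>w2 x\<bar> \<le> \<bar>w1 xW\<bar> + \<bar>w2 xW\<bar>"
    using continuous_attains_sup[OF compact_Icc _ wc'] by auto
  \<comment> \<open>For |e| < \<delta> the velocity moves by at most m, half of a lower bound for
    the speed, so the perturbed curves stay immersed with speed at least m. The bound \<delta> \<le>
    1 keeps |e h| \<le> 1, and the summand 1 in W permits division by W.\<close>
  define m where "m = m0 / 2"
  define W where "W = \<bar>w1 xW\<bar> + \<bar>w2 xW\<bar> + 1"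
  define \<delta> where "\<delta> = min 1 (m / W)"
  have m0: "m > 0" using mM(1) by (simp add: m_def)
  have W1: "W \<ge> 1" by (simp add: W_def)
  have d0: "\<delta> > 0" using m0 W1 by (simp add: \<delta>_def)
  have wW: "\<bar>w1 x\<bar> \<le> W" "\<bar>w2 x\<bar> \<le> W" "sqrt ((w1 x)\<^sup>2 + (w2 x)\<^sup>2) \<le> W" if "x \<in> {0..1}" for x
    using xW(2)[OF that] sqrt_sum_squares_le_sum_abs[of "w1 x" "w2 x"] by (auto simp: W_def)
  define V where "V e x = sqrt ((v1 x + e * w1 x)\<^sup>2 + (v2 x + e * w2 x)\<^sup>2)" for e x
  have close: "\<bar>V e x - n x\<bar> \<le> m" if e: "\<bar>e\<bar> < \<delta>" and x: "x \<in> {0..1}" for e x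
  proof -
    have "sqrt ((e * w1 x)\<^sup>2 + (e * w2 x)\<^sup>2) = \<bar>e\<bar> * sqrt ((w1 x)\<^sup>2 + (w2 x)\<^sup>2)"
      by (simp add: power_mult_distrib real_sqrt_mult flip: distrib_left)
    also have "\<dots> \<le> (m / W) * W"
      using e wW[OF x] m0 W1 by (intro mult_mono) (auto simp: \<delta>_def)
    also have "\<dots> = m" using W1 by simp
    finally have s: "sqrt ((e * w1 x)\<^sup>2 + (e * w2 x)\<^sup>2) \<le> m" .
    have "V e x \<le> n x + sqrt ((e * w1 x)\<^sup>2 + (e * w2 x)\<^sup>2)"
      unfolding V_def n_def by (rule real_sqrt_sum_squares_triangle_ineq)
    moreover have "n x \<le> V e x + sqrt ((- e * w1 x)\<^sup>2 + (- e * w2 x)\<^sup>2)"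
      using real_sqrt_sum_squares_triangle_ineq[of "v1 x + e * w1 x" "- e * w1 x" "v2 x + e * w2 x" "- e * w2 x"]
      by (simp add: V_def n_def)
    ultimately show ?thesis using s by simp
  qed
  have Vm: "m \<le> V e x" and VM: "V e x \<le> M0 + m" if "\<bar>e\<bar> < \<delta>" "x \<in> {0..1}" for e x
    using close[OF that] mM(3,4)[OF that(2)] unfolding m_def abs_le_iff by linarith+
  have Vpos: "(v1 x + e * w1 x)\<^sup>2 + (v2 x + e * w2 x)\<^sup>2 > 0" if "\<bar>e\<bar> < \<delta>" "x \<in> {0..1}" for e x
    using Vm[OF that] m0 unfolding V_def by (metis less_le_trans real_sqrt_gt_0_iff)
  define M where "M = M0 + m"
  define C where "C = 2 * M * (W + 2 * M) / m ^ 5 + 5 * M\<^sup>2 * (2 * M * W) / m ^ 7 + lam * (2 * M * W) / m"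
  have M0: "M \<ge> 0" using m0 mM(2) by (simp add: M_def)
  have C0: "C \<ge> 0" unfolding C_def using M0 m0 W1 lam by (intro add_nonneg_nonneg divide_nonneg_nonneg mult_nonneg_nonneg) auto
  have "((\<lambda>e. integral {0..1} (\<lambda>x. lagrangian lam (v1 x + e * w1 x) (v2 x + e * w2 x) (g1 x + e * h1 x) (g2 x + e * h2 x)))
      has_real_derivative integral {0..1} (\<lambda>x. dlagrangian lam (v1 x + 0 * w1 x) (v2 x + 0 * w2 x) (g1 x + 0 * h1 x) (g2 x + 0 * h2 x) (w1 x) (w2 x) (h1 x) (h2 x))) (at 0)"
  proof (rule has_derivative_integral_dominated(2)[OF d0, where h = "\<lambda>x. C * (27 + 3 * (g1 x)\<^sup>2 + 3 * (g2 x)\<^sup>2)"])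
    show "(\<lambda>x. C * (27 + 3 * (g1 x)\<^sup>2 + 3 * (g2 x)\<^sup>2)) integrable_on {0..1}"
      by (intro integrable_on_mult_right integrable_add g2) auto
  next
    fix e x :: real assume "\<bar>e\<bar> < \<delta>" "x \<in> {0..1}"
    then show "((\<lambda>e. lagrangian lam (v1 x + e * w1 x) (v2 x + e * w2 x) (g1 x + e * h1 x) (g2 x + e * h2 x))
       has_real_derivative dlagrangian lam (v1 x + e * w1 x) (v2 x + e * w2 x) (g1 x + e * h1 x) (g2 x + e * h2 x)
         (w1 x) (w2 x) (h1 x) (h2 x)) (at e)"
      by (intro lagrangian_has_derivative Vpos)
  next
    fix e x :: real assume e: "\<bar>e\<bar> < \<delta>" and x: "x \<in> {0..1}"
    have eh: "\<bar>e * h1 x\<bar> \<le> 1" "\<bar>e * h2 x\<bar> \<le> 1"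
      using e hb[of x] unfolding abs_mult \<delta>_def by (auto intro!: mult_le_one)
    have "\<bar>dlagrangian lam (v1 x + e * w1 x) (v2 x + e * w2 x) (g1 x + e * h1 x) (g2 x + e * h2 x)
         (w1 x) (w2 x) (h1 x) (h2 x)\<bar> \<le> C * (3 + \<bar>g1 x\<bar> + \<bar>g2 x\<bar>)\<^sup>2"
      unfolding C_def using Vm[OF e x] VM[OF e x] m0 wW[OF x] hb lam eh
      by (intro dlagrangian_bound) (auto simp: V_def M_def)
    also have "\<dots> \<le> C * (27 + 3 * (g1 x)\<^sup>2 + 3 * (g2 x)\<^sup>2)"
      by (intro mult_left_mono square_bound3 C0)
    finally show "\<bar>dlagrangian lam (v1 x + e * w1 x) (v2 x + e * w2 x) (g1 x + e * h1 x) (g2 x + e * h2 x)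
         (w1 x) (w2 x) (h1 x) (h2 x)\<bar> \<le> C * (27 + 3 * (g1 x)\<^sup>2 + 3 * (g2 x)\<^sup>2)" .
  next
    fix e :: real assume e: "\<bar>e\<bar> < \<delta>"
    note sq = square_integrable_add_bounded
    note li = lagrangian_integrable[of "\<lambda>x. v1 x + e * w1 x" "\<lambda>x. v2 x + e * w2 x"
        "\<lambda>x. g1 x + e * h1 x" "\<lambda>x. g2 x + e * h2 x"]
    have "(\<lambda>x. ((v1 x + e * w1 x) * (g2 x + e * h2 x) - (v2 x + e * w2 x) * (g1 x + e * h1 x))\<^sup>2 /
           sqrt ((v1 x + e * w1 x)\<^sup>2 + (v2 x + e * w2 x)\<^sup>2) ^ 5) integrable_on {0..1}"
      by (intro li(1) Vpos e continuous_intros vc wc sq gm hm g2 hb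
        borel_measurable_add borel_measurable_times borel_measurable_const; simp)
    moreover have "(\<lambda>x. sqrt ((v1 x + e * w1 x)\<^sup>2 + (v2 x + e * w2 x)\<^sup>2)) integrable_on {0..1}"
      by (intro li(2) Vpos e continuous_intros vc wc sq gm hm g2 hb
        borel_measurable_add borel_measurable_times borel_measurable_const; simp)
    ultimately show "(\<lambda>x. lagrangian lam (v1 x + e * w1 x) (v2 x + e * w2 x) (g1 x + e * h1 x) (g2 x + e * h2 x)) integrable_on {0..1}"
      unfolding lagrangian_def by (intro integrable_add integrable_on_mult_right)
  qed
  then show ?thesis using that[OF d0 Vpos] by simp
qed

text \<open>The coordinate form of \<open>W22\<close>: (v1, v2) is the velocity and (g1, g2) the
  weak second derivative. It uses the integral for which the almost everywhere theorems above are
  stated. Square integrability is carried separately, by the lemmas about the energy.\<close>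

definition W22_data :: "(real \<Rightarrow> real \<times> real) \<Rightarrow> (real \<Rightarrow> real) \<Rightarrow> (real \<Rightarrow> real) \<Rightarrow> (real \<Rightarrow> real) \<Rightarrow> (real \<Rightarrow> real) \<Rightarrow> bool" where
  "W22_data \<gamma> v1 v2 g1 g2 \<longleftrightarrow>
    (\<forall>x\<in>{0..1}. (\<gamma> has_vector_derivative (v1 x, v2 x)) (at x within {0..1}))
    \<and> g1 absolutely_integrable_on {0..1} \<and> g2 absolutely_integrable_on {0..1}
    \<and> (\<forall>x\<in>{0..1}. v1 x = v1 0 + integral {0..x} g1) \<and> (\<forall>x\<in>{0..1}. v2 x = v2 0 + integral {0..x} g2)"

lemma W22_dataD:
  assumes "W22_data \<gamma> v1 v2 g1 g2"
  shows "x \<in> {0..1} \<Longrightarrow> (\<gamma> has_vector_derivative (v1 x, v2 x)) (at x within {0..1})"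
    "g1 absolutely_integrable_on {0..1}" "g2 absolutely_integrable_on {0..1}"
    "x \<in> {0..1} \<Longrightarrow> v1 x = v1 0 + integral {0..x} g1" "x \<in> {0..1} \<Longrightarrow> v2 x = v2 0 + integral {0..x} g2"
    "g1 integrable_on {0..1}" "g2 integrable_on {0..1}"
  using assms unfolding W22_data_def absolutely_integrable_on_def by blast+

lemma W22_dataI:
  assumes "\<And>x. x \<in> {0..1} \<Longrightarrow> (\<gamma> has_vector_derivative (v1 x, v2 x)) (at x within {0..1})"
    "g1 absolutely_integrable_on {0..1}" "g2 absolutely_integrable_on {0..1}"
    "\<And>x. x \<in> {0..1} \<Longrightarrow> v1 x = v1 0 + integral {0..x} g1" "\<And>x. x \<in> {0..1} \<Longrightarrow> v2 x = v2 0 + integral {0..x} g2"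
  shows "W22_data \<gamma> v1 v2 g1 g2"
  using assms unfolding W22_data_def by blast

lemma W22_imp_data:
  assumes "W22 \<gamma>"
  obtains v1 v2 g1 g2 where "W22_data \<gamma> v1 v2 g1 g2"
    "(\<lambda>x. (g1 x)\<^sup>2) integrable_on {0..1}" "(\<lambda>x. (g2 x)\<^sup>2) integrable_on {0..1}"
proof -
  from assms obtain v g where v: "\<And>x. x\<in>{0..1} \<Longrightarrow> (\<gamma> has_vector_derivative v x) (at x within {0..1})"
    and g: "set_integrable lborel {0..1} g" and gg: "set_integrable lborel {0..1} (\<lambda>x. (norm (g x))\<^sup>2)"
    and vg: "\<And>x. x\<in>{0..1} \<Longrightarrow> v x = v 0 + (LINT t:{0..x}|lborel. g t)"
    unfolding W22_def by blast
  have ga: "g absolutely_integrable_on {0..1}"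
    using g unfolding set_integrable_def by (rule integrable_completion[THEN iffD2, rotated])
      (use g in \<open>auto simp: set_integrable_def\<close>)
  have ggi: "(\<lambda>x. (norm (g x))\<^sup>2) integrable_on {0..1}"
    using set_borel_integral_eq_integral(1)[OF gg] .
  have comp: "(\<lambda>x. p (g x)) absolutely_integrable_on {0..1} \<and> (\<lambda>x. (p (g x))\<^sup>2) integrable_on {0..1} \<and>
     (\<forall>x\<in>{0..1}. p (v x) = p (v 0) + integral {0..x} (\<lambda>t. p (g t)))"
    if p: "bounded_linear p" and pn: "\<And>y. \<bar>p y\<bar> \<le> norm y" for p :: "real \<times> real \<Rightarrow> real"
  proof (intro conjI ballI)
    show a: "(\<lambda>x. p (g x)) absolutely_integrable_on {0..1}"
      using absolutely_integrable_linear[OF ga p] by (simp add: o_def)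
    show "(\<lambda>x. (p (g x))\<^sup>2) integrable_on {0..1}"
    proof (rule integrable_on_of_measurable_bound[OF _ ggi])
      show "(\<lambda>x. (p (g x))\<^sup>2) \<in> borel_measurable (lebesgue_on {0..1})"
        using absolutely_integrable_measurable[of "{0..1}" "\<lambda>x. p (g x)"] a by (auto intro: borel_measurable_power)
      show "\<bar>(p (g x))\<^sup>2\<bar> \<le> (norm (g x))\<^sup>2" for x
        using power_mono[OF pn[of "g x"], of 2] by simp
    qed simp
    fix x :: real assume x: "x \<in> {0..1}"
    have gx: "set_integrable lborel {0..x} g"
      using g by (rule set_integrable_subset) (use x in auto)
    have "p (v x) = p (v 0) + p (integral {0..x} g)"
      using vg[OF x] set_borel_integral_eq_integral(2)[OF gx] linear_add[OF bounded_linear.linear[OF p]] by simp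
    also have "p (integral {0..x} g) = integral {0..x} (\<lambda>t. p (g t))"
      using integral_linear[OF set_borel_integral_eq_integral(1)[OF gx] p] by (simp add: o_def)
    finally show "p (v x) = p (v 0) + integral {0..x} (\<lambda>t. p (g t))" .
  qed
  have 1: "\<bar>fst y\<bar> \<le> norm y" "\<bar>snd y\<bar> \<le> norm y" for y :: "real \<times> real"
    by (cases y; simp add: norm_Pair abs_le_sqrt_sum)+
  note c = comp[of fst, OF bounded_linear_fst 1(1)] comp[of snd, OF bounded_linear_snd 1(2)]
  show ?thesis
  proof (rule that)
    show "W22_data \<gamma> (\<lambda>x. fst (v x)) (\<lambda>x. snd (v x)) (\<lambda>x. fst (g x)) (\<lambda>x. snd (g x))"
    proof (rule W22_dataI)
      show "(\<gamma> has_vector_derivative (fst (v x), snd (v x))) (at x within {0..1})" if "x \<in> {0..1}" for x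
        using v[OF that] by simp
    qed (use c in blast)+
  qed (use c in blast)+
qed

lemma W22_data_continuous:
  assumes "W22_data \<gamma> v1 v2 g1 g2"
  shows "continuous_on {0..1} v1" "continuous_on {0..1} v2"
proof -
  note 1 = W22_dataD(6,7)[OF assms]
  have "continuous_on {0..1} (\<lambda>x. v1 0 + integral {0..x} g1)" "continuous_on {0..1} (\<lambda>x. v2 0 + integral {0..x} g2)"
    by (intro continuous_intros indefinite_integral_continuous_1 1)+
  then show "continuous_on {0..1} v1" "continuous_on {0..1} v2"
    using assms unfolding W22_data_def by (metis (no_types, lifting) continuous_on_cong)+
qed

lemma indefinite_integral_ae_derivative:
  fixes v g :: "real \<Rightarrow> real"
  assumes g: "g integrable_on {0..1}" and v: "\<And>x. x \<in> {0..1} \<Longrightarrow> v x = v 0 + integral {0..x} g"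
  obtains N where "negligible N"
    "\<And>x. x \<in> {0..1} - N \<Longrightarrow> (v has_real_derivative g x) (at x within {0..1})"
proof -
  obtain N where N: "negligible N" "\<And>x. x \<in> {0..1} - N \<Longrightarrow>
      ((\<lambda>x. integral {0..x} g) has_real_derivative g x) (at x within {0..1})"
    using lebesgue_differentiation[OF g] by metis
  show ?thesis
  proof (rule that[OF N(1)])
    fix x assume x: "x \<in> {0..1} - N"
    have "((\<lambda>x. v 0 + integral {0..x} g) has_real_derivative g x) (at x within {0..1})"
      using N(2)[OF x] by (auto intro!: derivative_eq_intros)
    then show "(v has_real_derivative g x) (at x within {0..1})"
      by (rule has_field_derivative_transform_within[where d=1]) (use x in \<open>auto simp: v[symmetric]\<close>)
  qed
qed

lemma W22_data_d1:
  assumes "W22_data \<gamma> v1 v2 g1 g2" "x \<in> {0..1}"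
  shows "d1 \<gamma> x = (v1 x, v2 x)"
  unfolding d1_def using assms(2) W22_dataD(1)[OF assms]
  by (intro vector_derivative_within_closed_interval) auto

lemma W22_data_d2:
  assumes D: "W22_data \<gamma> v1 v2 g1 g2"
  obtains N where "negligible N"
    "\<And>x. x \<in> {0..1} - N \<Longrightarrow> (v1 has_real_derivative g1 x) (at x within {0..1})"
    "\<And>x. x \<in> {0..1} - N \<Longrightarrow> (v2 has_real_derivative g2 x) (at x within {0..1})"
    "\<And>x. x \<in> {0..1} - N \<Longrightarrow> d2 \<gamma> x = (g1 x, g2 x)"
proof -
  note 1 = W22_dataD(6,7)[OF D]
  obtain N1 where N1: "negligible N1"
    "\<And>x. x \<in> {0..1} - N1 \<Longrightarrow> (v1 has_real_derivative g1 x) (at x within {0..1})"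
    using indefinite_integral_ae_derivative[OF 1(1) W22_dataD(4)[OF D]] by metis
  obtain N2 where N2: "negligible N2"
    "\<And>x. x \<in> {0..1} - N2 \<Longrightarrow> (v2 has_real_derivative g2 x) (at x within {0..1})"
    using indefinite_integral_ae_derivative[OF 1(2) W22_dataD(5)[OF D]] by metis
  show ?thesis
  proof (rule that[of "N1 \<union> N2"])
    show "negligible (N1 \<union> N2)" using N1 N2 by simp
    fix x assume x: "x \<in> {0..1} - (N1 \<union> N2)"
    show d: "(v1 has_real_derivative g1 x) (at x within {0..1})" "(v2 has_real_derivative g2 x) (at x within {0..1})"
      using N1(2)[of x] N2(2)[of x] x by auto
    have "((\<lambda>x. (v1 x, v2 x)) has_vector_derivative (g1 x, g2 x)) (at x within {0..1})"
      using d by (intro has_vector_derivative_Pair) (auto simp: has_real_derivative_iff_has_vector_derivative)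
    then have "(d1 \<gamma> has_vector_derivative (g1 x, g2 x)) (at x within {0..1})"
      by (rule has_vector_derivative_transform_within[where d=1]) (use x W22_data_d1[OF D] in auto)
    then show "d2 \<gamma> x = (g1 x, g2 x)"
      unfolding d2_def using x by (intro vector_derivative_within_closed_interval) auto
  qed
qed

text \<open>The pointwise derivative \<open>d2\<close> agrees with (g1, g2) off a negligible set,
  which the integral ignores. The fifth power is what remains of k^2 |v|, since k is a determinant
  divided by |v|^3.\<close>

lemma energy_eq_integral_lagrangian:
  assumes D: "W22_data \<gamma> v1 v2 g1 g2"
    and pos: "\<And>x. x \<in> {0..1} \<Longrightarrow> (v1 x)\<^sup>2 + (v2 x)\<^sup>2 > 0"
    and sq: "(\<lambda>x. (g1 x)\<^sup>2) integrable_on {0..1}" "(\<lambda>x. (g2 x)\<^sup>2) integrable_on {0..1}"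
  shows "energy lam \<gamma> = integral {0..1} (\<lambda>x. lagrangian lam (v1 x) (v2 x) (g1 x) (g2 x))"
proof -
  have gm: "g1 \<in> borel_measurable (lebesgue_on {0..1})" "g2 \<in> borel_measurable (lebesgue_on {0..1})"
    using W22_dataD(2,3)[OF D] absolutely_integrable_measurable[of "{0..1}" g1]
      absolutely_integrable_measurable[of "{0..1}" g2] by simp_all
  note li = lagrangian_integrable[OF W22_data_continuous[OF D] pos gm sq]
  obtain N where N: "negligible N" "\<And>x. x \<in> {0..1} - N \<Longrightarrow> d2 \<gamma> x = (g1 x, g2 x)"
    using W22_data_d2[OF D] by metis
  have "bend \<gamma> = integral {0..1} (\<lambda>x. (v1 x * g2 x - v2 x * g1 x)\<^sup>2 / sqrt ((v1 x)\<^sup>2 + (v2 x)\<^sup>2) ^ 5)"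
    unfolding bend_def
  proof (rule integral_spike[OF N(1)])
    fix x :: real assume x: "x \<in> {0..1} - N"
    define n where "n = sqrt ((v1 x)\<^sup>2 + (v2 x)\<^sup>2)"
    have n: "n > 0" using pos x by (simp add: n_def)
    show "(v1 x * g2 x - v2 x * g1 x)\<^sup>2 / sqrt ((v1 x)\<^sup>2 + (v2 x)\<^sup>2) ^ 5 = (curv \<gamma> x)\<^sup>2 * norm (d1 \<gamma> x)"
      using N(2)[OF x] W22_data_d1[OF D, of x] x n
      by (simp add: curv_def norm_Pair flip: n_def) (simp add: field_simps eval_nat_numeral)
  qed
  moreover have "len \<gamma> = integral {0..1} (\<lambda>x. sqrt ((v1 x)\<^sup>2 + (v2 x)\<^sup>2))"
    unfolding len_def by (rule integral_cong) (simp add: W22_data_d1[OF D] norm_Pair)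
  ultimately show ?thesis
    unfolding energy_def lagrangian_def using li
    by (subst integral_add) (auto intro: integrable_on_mult_right)
qed

lemma W22_data_perturb:
  assumes D: "W22_data \<gamma> v1 v2 g1 g2" and E: "W22_data \<eta> w1 w2 h1 h2"
  shows "W22_data (\<lambda>x. \<gamma> x + e *\<^sub>R \<eta> x) (\<lambda>x. v1 x + e * w1 x) (\<lambda>x. v2 x + e * w2 x)
     (\<lambda>x. g1 x + e * h1 x) (\<lambda>x. g2 x + e * h2 x)"
proof -
  have lin: "(\<lambda>x. g x + e * h x) absolutely_integrable_on {0..1} \<and>
       (\<forall>x\<in>{0..1}. v x + e * w x = v 0 + e * w 0 + integral {0..x} (\<lambda>x. g x + e * h x))"
    if g: "g absolutely_integrable_on {0..1}" and h: "h absolutely_integrable_on {0..1}"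
     and v: "\<And>x. x\<in>{0..1} \<Longrightarrow> v x = v 0 + integral {0..x} g"
     and w: "\<And>x. x\<in>{0..1} \<Longrightarrow> w x = w 0 + integral {0..x} h" for g h v w :: "real \<Rightarrow> real"
  proof (intro conjI ballI)
    show "(\<lambda>x. g x + e * h x) absolutely_integrable_on {0..1}"
      using g h by (intro set_integral_add(1) set_integrable_mult_right)
    fix x :: real assume x: "x \<in> {0..1}"
    have "g integrable_on {0..1}" "h integrable_on {0..1}"
      using g h by (auto simp: absolutely_integrable_on_def)
    then have "g integrable_on {0..x}" "h integrable_on {0..x}"
      using x by (auto intro: integrable_subinterval_real)
    then have "integral {0..x} (\<lambda>x. g x + e * h x) = integral {0..x} g + e * integral {0..x} h"
      by (subst integral_add) (auto intro: integrable_on_mult_right)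
    then show "v x + e * w x = v 0 + e * w 0 + integral {0..x} (\<lambda>x. g x + e * h x)"
      unfolding v[OF x] w[OF x] by (simp add: algebra_simps)
  qed
  have "((\<lambda>x. \<gamma> x + e *\<^sub>R \<eta> x) has_vector_derivative (v1 x + e * w1 x, v2 x + e * w2 x)) (at x within {0..1})"
    if "x \<in> {0..1}" for x
  proof -
    have 1: "(\<gamma> has_vector_derivative (v1 x, v2 x)) (at x within {0..1})"
      "(\<eta> has_vector_derivative (w1 x, w2 x)) (at x within {0..1})"
      using W22_dataD(1)[OF D that] W22_dataD(1)[OF E that] .
    have "((\<lambda>x. \<gamma> x + e *\<^sub>R \<eta> x) has_vector_derivative (v1 x, v2 x) + e *\<^sub>R (w1 x, w2 x)) (at x within {0..1})"
      by (intro has_vector_derivative_add 1 bounded_linear.has_vector_derivative[OF bounded_linear_scaleR_right 1(2)])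
    then show ?thesis by simp
  qed
  moreover note lin[OF W22_dataD(2)[OF D] W22_dataD(2)[OF E] W22_dataD(4)[OF D] W22_dataD(4)[OF E]]
    lin[OF W22_dataD(3)[OF D] W22_dataD(3)[OF E] W22_dataD(5)[OF D] W22_dataD(5)[OF E]]
  ultimately show ?thesis
    by (intro W22_dataI) (assumption | blast)+
qed

section \<open>Piecewise quadratic test fields and the integrated Euler-Lagrange equation\<close>

definition test_slope :: "real \<Rightarrow> real \<Rightarrow> real" where
  "test_slope t x = min x t - (t - t\<^sup>2 / 2)"

text \<open>A field of fixed direction (a, b). The constant t - t^2/2 in \<open>test_slope\<close>
  is the mean of \<open>min x t\<close> over [0, 1], so the field returns to 0 at x = 1, while its
  slopes at the two ends are in general not 0.\<close>

definition test_fun :: "real \<Rightarrow> real \<Rightarrow> real \<Rightarrow> real \<Rightarrow> real \<times> real" where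
  "test_fun t a b x = (a * integral {0..x} (test_slope t), b * integral {0..x} (test_slope t))"

lemma continuous_test_slope: "continuous_on S (test_slope t)"
  unfolding test_slope_def by (intro continuous_intros)

lemma test_slope_eq:
  assumes "t \<in> {0..1}" "x \<in> {0..1}"
  shows "((\<lambda>s. if s \<le> t then 1 else 0) has_integral (test_slope t x - test_slope t 0)) {0..x}"
proof -
  have "((\<lambda>s. 1::real) has_integral (min x t - 0)) {0..min x t}"
    using has_integral_const_real[of "1::real" 0 "min x t"] assms by auto
  then have a: "((\<lambda>s. if s \<le> t then 1 else (0::real)) has_integral (min x t - 0)) {0..min x t}"
    by (rule has_integral_eq[rotated]) auto
  have b: "((\<lambda>s. if s \<le> t then 1 else (0::real)) has_integral 0) {min x t..x}"
    by (rule has_integral_spike[of "{min x t}" _ _ "\<lambda>_. 0"]) (auto simp: min_def split: if_splits)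
  show ?thesis
    using has_integral_combine[OF _ _ a b] assms by (simp add: test_slope_def)
qed

lemma test_fun_data:
  assumes t: "t \<in> {0..1}"
  shows "W22_data (test_fun t a b) (\<lambda>x. a * test_slope t x) (\<lambda>x. b * test_slope t x)
      (\<lambda>x. a * (if x \<le> t then 1 else 0)) (\<lambda>x. b * (if x \<le> t then 1 else 0))"
    and "W22 (test_fun t a b)" "test_fun t a b 0 = 0" "test_fun t a b 1 = 0"
proof -
  define ch where "ch s = (if s \<le> t then 1 else (0::real))" for s
  have chi: "ch s = indicator {..t} s" for s by (simp add: ch_def)
  \<comment> \<open>General in the type of c: it is applied to real constants and to the planar
    vector (a, b).\<close>
  have sl: "set_integrable lborel {0..1} (\<lambda>x. ch x *\<^sub>R c)" for c :: "'z::euclidean_space"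
  proof -
    have "set_integrable lborel ({0..1} \<inter> {..t}) (\<lambda>x. c)"
      by (rule set_integrable_subset[of _ "{0..1}", OF borel_integrable_atLeastAtMost']) auto
    moreover have "indicat_real ({0..1} \<inter> {..t}) x *\<^sub>R c = indicator {0..1} x *\<^sub>R (ch x *\<^sub>R c)" for x
      by (auto simp: chi indicator_def)
    ultimately show ?thesis unfolding set_integrable_def by (simp only:)
  qed
  have slopei: "(ch has_integral (test_slope t x - test_slope t 0)) {0..x}" if "x \<in> {0..1}" for x
    unfolding ch_def[abs_def] by (rule test_slope_eq[OF t that])
  have der: "((\<lambda>x. integral {0..x} (test_slope t)) has_real_derivative test_slope t x) (at x within {0..1})"
    if "x \<in> {0..1}" for x
    using integral_has_real_derivative[OF continuous_test_slope that] .
  have derv: "(test_fun t a b has_vector_derivative (a * test_slope t x, b * test_slope t x)) (at x within {0..1})"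
    if "x \<in> {0..1}" for x
    unfolding test_fun_def[abs_def]
    by (intro has_vector_derivative_Pair; unfold has_real_derivative_iff_has_vector_derivative[symmetric])
       (auto intro!: derivative_eq_intros der that)
  have ai: "(\<lambda>x. c * ch x) absolutely_integrable_on {0..1}" for c :: real
    using integrable_completion[of "\<lambda>x. indicator {0..1} x *\<^sub>R (ch x *\<^sub>R c)" lborel] sl[of c]
    by (auto simp: set_integrable_def mult.commute)
  have lin: "c * test_slope t x = c * test_slope t 0 + integral {0..x} (\<lambda>x. c * ch x)" if "x \<in> {0..1}" for c x
    using integral_unique[OF has_integral_mult_right[OF slopei[OF that], of c]] by (simp add: algebra_simps)
  show "W22_data (test_fun t a b) (\<lambda>x. a * test_slope t x) (\<lambda>x. b * test_slope t x)
      (\<lambda>x. a * (if x \<le> t then 1 else 0)) (\<lambda>x. b * (if x \<le> t then 1 else 0))"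
    unfolding ch_def[symmetric] by (intro W22_dataI derv ai lin)
  show "W22 (test_fun t a b)"
    unfolding W22_def
  proof (intro exI conjI ballI)
    show "(test_fun t a b has_vector_derivative (test_slope t x *\<^sub>R (a, b))) (at x within {0..1})" if "x \<in> {0..1}" for x
      using derv[OF that] by (simp add: mult.commute)
    show "set_integrable lborel {0..1} (\<lambda>x. ch x *\<^sub>R (a, b))" by (rule sl)
    have "(norm (ch x *\<^sub>R (a, b)))\<^sup>2 = ch x *\<^sub>R (norm (a, b))\<^sup>2" for x
      by (simp add: ch_def)
    then show "set_integrable lborel {0..1} (\<lambda>x. (norm (ch x *\<^sub>R (a, b)))\<^sup>2)"
      using sl[of "(norm (a, b))\<^sup>2"] by simp
    fix x :: real assume x: "x \<in> {0..1}"
    have "set_integrable lborel {0..x} (\<lambda>x. ch x *\<^sub>R (a, b))"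
      by (rule set_integrable_subset[OF sl]) (use x in auto)
    then have "(LINT s:{0..x}|lborel. ch s *\<^sub>R (a, b)) = integral {0..x} (\<lambda>s. ch s *\<^sub>R (a, b))"
      by (rule set_borel_integral_eq_integral)
    also have "\<dots> = (test_slope t x - test_slope t 0) *\<^sub>R (a, b)"
      using has_integral_scaleR_left[OF slopei[OF x]] by (rule integral_unique)
    finally show "test_slope t x *\<^sub>R (a, b) = test_slope t 0 *\<^sub>R (a, b) + (LINT s:{0..x}|lborel. ch s *\<^sub>R (a, b))"
      by (simp add: algebra_simps)
  qed
  show "test_fun t a b 0 = 0" by (simp add: test_fun_def zero_prod_def)
  have "((\<lambda>x. x - (t - t\<^sup>2/2)) has_integral (t\<^sup>2/2 - (t - t\<^sup>2/2) * t)) {0..t}"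
    using has_integral_diff[OF ident_has_integral[of 0 t] has_integral_const_real[of "t - t\<^sup>2/2" 0 t]] t
    by (simp add: mult.commute)
  then have A: "(test_slope t has_integral (t\<^sup>2/2 - (t - t\<^sup>2/2) * t)) {0..t}"
    by (rule has_integral_eq[rotated]) (auto simp: test_slope_def)
  have "((\<lambda>x. t - (t - t\<^sup>2/2)) has_integral ((t\<^sup>2/2) * (1 - t))) {t..1}"
    using has_integral_const_real[of "t\<^sup>2/2" t 1] t by (simp add: mult.commute)
  then have B: "(test_slope t has_integral ((t\<^sup>2/2) * (1 - t))) {t..1}"
    by (rule has_integral_eq[rotated]) (auto simp: test_slope_def)
  have "integral {0..1} (test_slope t) = 0"
  proof -
    have "(t\<^sup>2/2 - (t - t\<^sup>2/2) * t) + (t\<^sup>2/2) * (1 - t) = 0"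
      by (simp add: field_simps power2_eq_square)
    then show ?thesis using integral_unique[OF has_integral_combine[OF _ _ A B]] t by simp
  qed
  then show "test_fun t a b 1 = 0" by (simp add: test_fun_def zero_prod_def)
qed

lemma measurable_dlagrangian:
  assumes "v1 \<in> borel_measurable M" "v2 \<in> borel_measurable M" "g1 \<in> borel_measurable M" "g2 \<in> borel_measurable M"
  shows "(\<lambda>x. dlagrangian lam (v1 x) (v2 x) (g1 x) (g2 x) w1 w2 h1 h2) \<in> borel_measurable M"
  unfolding dlagrangian_def using assms by measurable

text \<open>Linearity in the variation. For a field of fixed direction the first variation thus
  involves two coefficient functions that do not depend on the slope w and its derivative h.\<close>

lemma dlagrangian_split:
  "dlagrangian lam v1 v2 g1 g2 (w * a) (w * b) (h * a) (h * b) =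
    dlagrangian lam v1 v2 g1 g2 0 0 a b * h + w * dlagrangian lam v1 v2 g1 g2 a b 0 0"
  unfolding dlagrangian_def by (simp add: algebra_simps add_divide_distrib diff_divide_distrib)

text \<open>\<open>S\<close> and \<open>Q\<close> are the coefficients of the second and of the first derivative of a variation in the direction \<open>(a, b)\<close>.\<close>
lemma euler_lagrange_integrated:
  assumes D: "W22_data \<gamma> v1 v2 g1 g2"
    and pos: "\<And>x. x \<in> {0..1} \<Longrightarrow> (v1 x)\<^sup>2 + (v2 x)\<^sup>2 > 0"
    and sq: "(\<lambda>x. (g1 x)\<^sup>2) integrable_on {0..1}" "(\<lambda>x. (g2 x)\<^sup>2) integrable_on {0..1}"
    and pen: "pen_pinned_elastica lam l \<gamma>" and lam: "lam \<ge> 0"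
    and ab: "\<bar>a\<bar> \<le> 1" "\<bar>b\<bar> \<le> 1"
    and S_def: "S = (\<lambda>x. dlagrangian lam (v1 x) (v2 x) (g1 x) (g2 x) 0 0 a b)"
    and Q_def: "Q = (\<lambda>x. dlagrangian lam (v1 x) (v2 x) (g1 x) (g2 x) a b 0 0)"
  obtains N where "negligible N" "Q absolutely_integrable_on {0..1}"
    "\<And>x. x \<in> {0..1} - N \<Longrightarrow> S x = integral {0..x} Q - x * integral {0..1} Q"
proof -
  note vc = W22_data_continuous[OF D]
  have gm: "g1 \<in> borel_measurable (lebesgue_on {0..1})" "g2 \<in> borel_measurable (lebesgue_on {0..1})"
    using W22_dataD(2,3)[OF D] absolutely_integrable_measurable[of "{0..1}" g1]
      absolutely_integrable_measurable[of "{0..1}" g2] by simp_all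
  define n where "n x = sqrt ((v1 x)\<^sup>2 + (v2 x)\<^sup>2)" for x
  have nc: "continuous_on {0..1} n" unfolding n_def by (intro continuous_intros vc)
  have n0: "n x > 0" if "x \<in> {0..1}" for x using pos[OF that] by (simp add: n_def)
  obtain m M where mM: "m > 0" "M \<ge> 0" "\<And>x. x \<in> {0..1} \<Longrightarrow> m \<le> n x" "\<And>x. x \<in> {0..1} \<Longrightarrow> n x \<le> M"
    using continuous_pos_bounds[OF nc n0] by metis
  have ai: "(\<lambda>x. dlagrangian lam (v1 x) (v2 x) (g1 x) (g2 x) w1 w2 h1 h2) absolutely_integrable_on {0..1}"
    if w: "\<bar>w1\<bar> \<le> 1" "\<bar>w2\<bar> \<le> 1" "\<bar>h1\<bar> \<le> 1" "\<bar>h2\<bar> \<le> 1" for w1 w2 h1 h2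
  proof -
    define C where "C = 2 * M * (1 + 2 * M) / m ^ 5 + 5 * (M)\<^sup>2 * (2 * M * 1) / m ^ 7
       + lam * (2 * M * 1) / m"
    have C0: "C \<ge> 0"
      unfolding C_def using mM(1,2) lam
      by (intro add_nonneg_nonneg divide_nonneg_nonneg mult_nonneg_nonneg) auto
    show ?thesis
    proof (rule measurable_bounded_by_integrable_imp_absolutely_integrable)
      show "(\<lambda>x. dlagrangian lam (v1 x) (v2 x) (g1 x) (g2 x) w1 w2 h1 h2) \<in> borel_measurable (lebesgue_on {0..1})"
        by (intro measurable_dlagrangian borel_measurable_continuous_on_Icc vc gm)
      show "(\<lambda>x. C * (27 + 3 * (g1 x)\<^sup>2 + 3 * (g2 x)\<^sup>2)) integrable_on {0..1}"
        by (intro integrable_on_mult_right integrable_add sq) auto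
      fix x :: real assume x: "x \<in> {0..1}"
      have "\<bar>dlagrangian lam (v1 x) (v2 x) (g1 x) (g2 x) w1 w2 h1 h2\<bar> \<le> C * (3 + \<bar>g1 x\<bar> + \<bar>g2 x\<bar>)\<^sup>2"
        unfolding C_def using mM(1) mM(3,4)[OF x] w lam
        by (intro dlagrangian_bound) (auto simp: n_def)
      also have "\<dots> \<le> C * (27 + 3 * (g1 x)\<^sup>2 + 3 * (g2 x)\<^sup>2)"
        by (intro mult_left_mono square_bound3 C0)
      finally show "norm (dlagrangian lam (v1 x) (v2 x) (g1 x) (g2 x) w1 w2 h1 h2) \<le> C * (27 + 3 * (g1 x)\<^sup>2 + 3 * (g2 x)\<^sup>2)"
        by simp
    qed simp
  qed
  have Sai: "S absolutely_integrable_on {0..1}" and Qai: "Q absolutely_integrable_on {0..1}"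
    unfolding S_def Q_def using ab by (auto intro!: ai)
  have "integral {0..1} (\<lambda>x. S x * (if x \<le> t then 1 else 0) + (min x t - (t - t\<^sup>2 / 2)) * Q x) = 0"
    if t: "t \<in> {0..1}" for t
  proof -
    define ch where "ch x = (if x \<le> t then 1 else (0::real))" for x
    note tf = test_fun_data[OF t, of a b, folded ch_def]
    have chm: "ch \<in> borel_measurable (lebesgue_on {0..1})"
    proof -
      have "ch \<in> borel_measurable lborel" unfolding ch_def[abs_def] by measurable
      then show ?thesis by (intro measurable_restrict_space1 measurable_completion)
    qed
    have hm: "(\<lambda>x. c * ch x) \<in> borel_measurable (lebesgue_on {0..1})" for c
      using chm by (intro borel_measurable_times) auto
    have hb: "\<bar>a * ch x\<bar> \<le> 1" "\<bar>b * ch x\<bar> \<le> 1" for x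
      using ab by (auto simp: ch_def)
    have wc: "continuous_on {0..1} (\<lambda>x. c * test_slope t x)" for c
      by (intro continuous_intros continuous_test_slope)
    obtain \<delta> where \<delta>: "\<delta> > 0"
      and pos': "\<And>e x. \<bar>e\<bar> < \<delta> \<Longrightarrow> x \<in> {0..1} \<Longrightarrow>
        (v1 x + e * (a * test_slope t x))\<^sup>2 + (v2 x + e * (b * test_slope t x))\<^sup>2 > 0"
      and der: "((\<lambda>e. integral {0..1} (\<lambda>x. lagrangian lam (v1 x + e * (a * test_slope t x)) (v2 x + e * (b * test_slope t x))
           (g1 x + e * (a * ch x)) (g2 x + e * (b * ch x))))
      has_real_derivative integral {0..1} (\<lambda>x. dlagrangian lam (v1 x) (v2 x) (g1 x) (g2 x) (a * test_slope t x) (b * test_slope t x)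
          (a * ch x) (b * ch x))) (at 0)"
      using first_variation_lagrangian[OF vc pos gm sq wc wc hm hm hb lam] by metis
    \<comment> \<open>Asserted only while the perturbed curve is known to be immersed, which
      suffices for a derivative at 0.\<close>
    have en: "energy lam (\<lambda>x. \<gamma> x + e *\<^sub>R test_fun t a b x) = integral {0..1} (\<lambda>x. lagrangian lam (v1 x + e * (a * test_slope t x))
         (v2 x + e * (b * test_slope t x)) (g1 x + e * (a * ch x)) (g2 x + e * (b * ch x)))"
      if e: "\<bar>e\<bar> < \<delta>" for e
      by (rule energy_eq_integral_lagrangian[OF W22_data_perturb[OF D tf(1)] pos'[OF e]])
        (assumption, (intro square_integrable_add_bounded gm sq hm hb)+)
    have "((\<lambda>e. energy lam (\<lambda>x. \<gamma> x + e *\<^sub>R test_fun t a b x)) has_real_derivative 0) (at 0)"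
      using pen tf(2-4) unfolding pen_pinned_elastica_def by blast
    moreover have "((\<lambda>e. energy lam (\<lambda>x. \<gamma> x + e *\<^sub>R test_fun t a b x)) has_real_derivative
       integral {0..1} (\<lambda>x. dlagrangian lam (v1 x) (v2 x) (g1 x) (g2 x) (a * test_slope t x) (b * test_slope t x)
          (a * ch x) (b * ch x))) (at 0)"
      using der \<delta> by (rule has_field_derivative_transform_within[where d=\<delta>]) (auto simp: en)
    ultimately have "integral {0..1} (\<lambda>x. dlagrangian lam (v1 x) (v2 x) (g1 x) (g2 x) (a * test_slope t x) (b * test_slope t x)
          (a * ch x) (b * ch x)) = 0"
      using DERIV_unique by blast
    moreover have "dlagrangian lam (v1 x) (v2 x) (g1 x) (g2 x) (a * test_slope t x) (b * test_slope t x)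
          (a * ch x) (b * ch x) = S x * ch x + test_slope t x * Q x" for x
      using dlagrangian_split[of lam "v1 x" "v2 x" "g1 x" "g2 x" "test_slope t x" a b "ch x"]
      by (simp add: S_def Q_def mult.commute)
    ultimately show ?thesis by (simp add: ch_def test_slope_def)
  qed
  from du_bois_reymond[OF Sai Qai this] Qai show ?thesis using that by metis
qed

text \<open>The bootstrap from almost everywhere to everywhere. By
  \<open>has_integral_of_ae_derivative\<close> F is F(0) plus the primitive of k, and a primitive of
  a continuous function is differentiable at every point. The increment bound excludes singular
  functions such as Cantor's.\<close>

lemma C1_of_ae_derivative:
  fixes F k p :: "real \<Rightarrow> real"
  assumes N: "negligible N"
    and der: "\<And>x. x \<in> {0..1} - N \<Longrightarrow> (F has_real_derivative k x) (at x within {0..1})"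
    and p: "p integrable_on {0..1}"
    and bnd: "\<And>x y. 0 \<le> x \<Longrightarrow> x \<le> y \<Longrightarrow> y \<le> 1 \<Longrightarrow> \<bar>F y - F x\<bar> \<le> integral {x..y} p"
    and k: "continuous_on {0..1} k" and x: "x \<in> {0..1}"
  shows "(F has_real_derivative k x) (at x within {0..1})"
proof -
  have eq: "F 0 + integral {0..y} k = F y" if y: "y \<in> {0..1}" for y
  proof -
    have "(k has_integral (F y - F 0)) {0..y}"
    proof (rule has_integral_of_ae_derivative[OF _ N])
      show "(F has_real_derivative k x) (at x within {0..y})" if "x \<in> {0..y} - N" for x
        by (rule has_field_derivative_subset[OF der]) (use that y in auto)
      show "p integrable_on {0..y}" using integrable_subinterval_real[OF p] y by auto
    qed (use y bnd in auto)
    then show ?thesis by (simp add: has_integral_iff)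
  qed
  have "((\<lambda>y. F 0 + integral {0..y} k) has_real_derivative k x) (at x within {0..1})"
    using integral_has_real_derivative[OF k x] by (auto intro!: derivative_eq_intros)
  then show ?thesis
    by (rule has_field_derivative_transform_within[where d=1]) (use x eq in auto)
qed

text \<open>Off N the zero function has derivative k x. By \<open>C1_of_ae_derivative\<close> it
  then has this derivative everywhere, and derivatives are unique.\<close>

lemma continuous_ae_zero:
  fixes k :: "real \<Rightarrow> real"
  assumes "negligible N" "\<And>x. x \<in> {0..1} - N \<Longrightarrow> k x = 0" "continuous_on {0..1} k" "x \<in> {0..1}"
  shows "k x = 0"
proof -
  have "((\<lambda>x. 0) has_real_derivative k x) (at x within {0..1})"
    by (rule C1_of_ae_derivative[OF assms(1), where p="\<lambda>_. 0"]) (use assms in auto)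
  moreover have "((\<lambda>x. 0) has_real_derivative (0::real)) (at x within {0..1})" by simp
  ultimately show ?thesis
    using has_real_derivative_within_unique[of "\<lambda>_. 0" "k x" x 0 1 0] assms(4) by simp
qed

section \<open>The elastica equation\<close>

text \<open>Provides the increment bounds for T = v / |v| and for the speed in terms of those of v.
  The speed is Lipschitz in the velocity, and c / q - a / p = ((c - a) + (a / p) (p - q)) / q with
  |a / p| \<le> 1, where p and q are the two speeds.\<close>

lemma unit_quotient_diff:
  fixes a b c d m :: real
  assumes "0 < m" "m \<le> sqrt (a\<^sup>2 + b\<^sup>2)" "m \<le> sqrt (c\<^sup>2 + d\<^sup>2)"
  shows "\<bar>c / sqrt (c\<^sup>2 + d\<^sup>2) - a / sqrt (a\<^sup>2 + b\<^sup>2)\<bar> \<le> 2 / m * (\<bar>c - a\<bar> + \<bar>d - b\<bar>)"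
    "\<bar>sqrt (c\<^sup>2 + d\<^sup>2) - sqrt (a\<^sup>2 + b\<^sup>2)\<bar> \<le> \<bar>c - a\<bar> + \<bar>d - b\<bar>"
proof -
  define p q where "p = sqrt (a\<^sup>2 + b\<^sup>2)" and "q = sqrt (c\<^sup>2 + d\<^sup>2)"
  have pq: "p > 0" "q > 0" "m \<le> q" "m \<le> p" using assms unfolding p_def q_def by linarith+
  have "q \<le> p + sqrt ((c - a)\<^sup>2 + (d - b)\<^sup>2)"
    using real_sqrt_sum_squares_triangle_ineq[of a "c - a" b "d - b"] by (simp add: p_def q_def)
  moreover have "p \<le> q + sqrt ((a - c)\<^sup>2 + (b - d)\<^sup>2)"
    using real_sqrt_sum_squares_triangle_ineq[of c "a - c" d "b - d"] by (simp add: p_def q_def)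
  moreover have "sqrt ((c - a)\<^sup>2 + (d - b)\<^sup>2) \<le> \<bar>c - a\<bar> + \<bar>d - b\<bar>"
    "sqrt ((a - c)\<^sup>2 + (b - d)\<^sup>2) \<le> \<bar>a - c\<bar> + \<bar>b - d\<bar>"
    by (rule sqrt_sum_squares_le_sum_abs)+
  ultimately have d: "\<bar>q - p\<bar> \<le> \<bar>c - a\<bar> + \<bar>d - b\<bar>" by linarith
  then show "\<bar>sqrt (c\<^sup>2 + d\<^sup>2) - sqrt (a\<^sup>2 + b\<^sup>2)\<bar> \<le> \<bar>c - a\<bar> + \<bar>d - b\<bar>"
    by (simp add: p_def q_def)
  define D where "D = \<bar>c - a\<bar> + \<bar>d - b\<bar>"
  have "c / q - a / p = ((c - a) + (a / p) * (p - q)) / q"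
    using pq by (simp add: field_simps)
  moreover have "\<bar>(c - a) + (a / p) * (p - q)\<bar> \<le> 2 * D"
  proof -
    define t where "t = (a / p) * (p - q)"
    have "\<bar>a / p\<bar> \<le> 1" using pq abs_le_sqrt_sum(1)[of a b] by (simp add: p_def)
    then have "\<bar>t\<bar> \<le> 1 * D"
      unfolding abs_mult t_def using d by (intro mult_mono) (auto simp: D_def)
    moreover have "\<bar>c - a\<bar> \<le> D" by (simp add: D_def)
    ultimately show ?thesis unfolding t_def[symmetric] using abs_triangle_ineq[of "c - a" t] by linarith
  qed
  moreover have "2 * D / q \<le> 2 * D / m" using pq assms by (intro divide_left_mono) (auto simp: D_def)
  ultimately have "\<bar>c / q - a / p\<bar> \<le> 2 * D / m"
    using pq by (simp add: abs_divide) (meson divide_right_mono less_imp_le order_trans)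
  then show "\<bar>c / sqrt (c\<^sup>2 + d\<^sup>2) - a / sqrt (a\<^sup>2 + b\<^sup>2)\<bar> \<le> 2 / m * (\<bar>c - a\<bar> + \<bar>d - b\<bar>)"
    by (simp add: p_def q_def D_def)
qed

text \<open>The pointwise algebra off the exceptional set, with u the velocity and n its length. The
  curvature is read off from S, not from the second derivative, because S has a continuous
  representative; the first claim shows that this gives the curvature. The last two claims compute
  the derivative of n U where U = S and U' = Q - c.\<close>

lemma frenet_algebra:
  fixes n u1 u2 g1 g2 lam P k c1 c2 :: real
  assumes n: "n > 0" and nn: "n\<^sup>2 = u1\<^sup>2 + u2\<^sup>2" and P: "P = u1 * g2 - u2 * g1"
    and S1: "S1 = dlagrangian lam u1 u2 g1 g2 0 0 1 0" and S2: "S2 = dlagrangian lam u1 u2 g1 g2 0 0 0 1"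
    and Q1: "Q1 = dlagrangian lam u1 u2 g1 g2 1 0 0 0" and Q2: "Q2 = dlagrangian lam u1 u2 g1 g2 0 1 0 0"
    and k: "k = (- (n * S1) * (u2 / n) + (n * S2) * (u1 / n)) / 2"
  shows "k = P / n ^ 3" "n * S1 = - 2 * k * (u2 / n)" "n * S2 = 2 * k * (u1 / n)"
    "(g1 * n - u1 * ((u1 * g1 + u2 * g2) / n)) / (n * n) = - k * n * (u2 / n)"
    "(g2 * n - u2 * ((u1 * g1 + u2 * g2) / n)) / (n * n) = k * n * (u1 / n)"
    "((u1 * g1 + u2 * g2) / n) * S1 + (Q1 - c1) * n = n * ((lam - 3 * k\<^sup>2) * (u1 / n) - c1)"
    "((u1 * g1 + u2 * g2) / n) * S2 + (Q2 - c2) * n = n * ((lam - 3 * k\<^sup>2) * (u2 / n) - c2)"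
proof -
  have sn: "sqrt (u1\<^sup>2 + u2\<^sup>2) = n" using n nn by (metis less_imp_le real_sqrt_unique)
  have S1': "S1 = - 2 * P * u2 / n ^ 5" and S2': "S2 = 2 * P * u1 / n ^ 5"
    and Q1': "Q1 = 2 * P * g2 / n ^ 5 - 5 * P\<^sup>2 * u1 / n ^ 7 + lam * u1 / n"
    and Q2': "Q2 = - 2 * P * g1 / n ^ 5 - 5 * P\<^sup>2 * u2 / n ^ 7 + lam * u2 / n"
    unfolding S1 S2 Q1 Q2 dlagrangian_def sn P[symmetric] by simp_all
  have "k = P * n\<^sup>2 / n ^ 5"
    unfolding k S1' S2' nn using n by (simp add: field_simps power2_eq_square)
  also have "\<dots> = P / n ^ 3" using n by (simp add: field_simps eval_nat_numeral)
  finally show k': "k = P / n ^ 3" .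
  have Pk: "P = k * n ^ 3" using k' n by simp
  show "n * S1 = - 2 * k * (u2 / n)" "n * S2 = 2 * k * (u1 / n)"
    unfolding S1' S2' Pk using n by (simp_all add: field_simps eval_nat_numeral)
  have 1: "g1 * n\<^sup>2 - u1 * (u1 * g1 + u2 * g2) = - u2 * P" "g2 * n\<^sup>2 - u2 * (u1 * g1 + u2 * g2) = u1 * P"
    unfolding nn P by (simp_all add: power2_eq_square algebra_simps)
  have "(g1 * n - u1 * ((u1 * g1 + u2 * g2) / n)) / (n * n) = (g1 * n\<^sup>2 - u1 * (u1 * g1 + u2 * g2)) / n ^ 3"
    "(g2 * n - u2 * ((u1 * g1 + u2 * g2) / n)) / (n * n) = (g2 * n\<^sup>2 - u2 * (u1 * g1 + u2 * g2)) / n ^ 3"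
    using n by (simp_all add: field_simps eval_nat_numeral)
  then show "(g1 * n - u1 * ((u1 * g1 + u2 * g2) / n)) / (n * n) = - k * n * (u2 / n)"
    "(g2 * n - u2 * ((u1 * g1 + u2 * g2) / n)) / (n * n) = k * n * (u1 / n)"
    unfolding 1 k' using n by simp_all
  have 2: "- u2 * (u1 * g1 + u2 * g2) + g2 * n\<^sup>2 = u1 * P" "u1 * (u1 * g1 + u2 * g2) - g1 * n\<^sup>2 = u2 * P"
    unfolding nn P by (simp_all add: power2_eq_square algebra_simps)
  have n0: "n \<noteq> 0" using n by simp
  have "((u1 * g1 + u2 * g2) / n) * S1 + (Q1 - c1) * n =
     2 * P * (- u2 * (u1 * g1 + u2 * g2) + g2 * n\<^sup>2) / n ^ 6 - 5 * P\<^sup>2 * u1 / n ^ 6 + lam * u1 - c1 * n"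
    unfolding S1' Q1' using n0 by (simp add: field_simps eval_nat_numeral)
  also have "\<dots> = - 3 * (P / n ^ 3)\<^sup>2 * u1 + lam * u1 - c1 * n"
    unfolding 2 using n0 by (simp add: field_simps eval_nat_numeral)
  also have "\<dots> = n * ((lam - 3 * k\<^sup>2) * (u1 / n) - c1)"
    unfolding k' using n0 by (simp add: algebra_simps)
  finally show "((u1 * g1 + u2 * g2) / n) * S1 + (Q1 - c1) * n = n * ((lam - 3 * k\<^sup>2) * (u1 / n) - c1)" .
  have "((u1 * g1 + u2 * g2) / n) * S2 + (Q2 - c2) * n =
     2 * P * (u1 * (u1 * g1 + u2 * g2) - g1 * n\<^sup>2) / n ^ 6 - 5 * P\<^sup>2 * u2 / n ^ 6 + lam * u2 - c2 * n"
    unfolding S2' Q2' using n0 by (simp add: field_simps eval_nat_numeral)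
  also have "\<dots> = - 3 * (P / n ^ 3)\<^sup>2 * u2 + lam * u2 - c2 * n"
    unfolding 2 using n0 by (simp add: field_simps eval_nat_numeral)
  also have "\<dots> = n * ((lam - 3 * k\<^sup>2) * (u2 / n) - c2)"
    unfolding k' using n0 by (simp add: algebra_simps)
  finally show "((u1 * g1 + u2 * g2) / n) * S2 + (Q2 - c2) * n = n * ((lam - 3 * k\<^sup>2) * (u2 / n) - c2)" .
qed

lemma elastica_ode:
  assumes pen: "pen_pinned_elastica lam l \<gamma>" and lam: "lam > 0" and l: "l > 0"
  obtains r T1 T2 k c where "continuous_on {0..1} r"
    "\<And>x. x \<in> {0..1} \<Longrightarrow> r x > 0"
    "\<And>x. x \<in> {0..1} \<Longrightarrow> (T1 x)\<^sup>2 + (T2 x)\<^sup>2 = 1"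
    "\<And>x. x \<in> {0..1} \<Longrightarrow> ((\<lambda>x. fst (\<gamma> x)) has_real_derivative r x * T1 x) (at x within {0..1})"
    "\<And>x. x \<in> {0..1} \<Longrightarrow> ((\<lambda>x. snd (\<gamma> x)) has_real_derivative r x * T2 x) (at x within {0..1})"
    "\<And>x. x \<in> {0..1} \<Longrightarrow> (T1 has_real_derivative - r x * k x * T2 x) (at x within {0..1})"
    "\<And>x. x \<in> {0..1} \<Longrightarrow> (T2 has_real_derivative r x * k x * T1 x) (at x within {0..1})"
    "\<And>x. x \<in> {0..1} \<Longrightarrow> (k has_real_derivative r x * (c / 2) * T2 x) (at x within {0..1})"
    "\<And>x. x \<in> {0..1} \<Longrightarrow> c * T1 x = lam - (k x)\<^sup>2"
    "k 0 = 0" "k 1 = 0"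
proof -
  have W: "W22 \<gamma>" and imm: "\<And>x. x \<in> {0..1} \<Longrightarrow> d1 \<gamma> x \<noteq> 0" and bc: "\<gamma> 0 = (0, 0)" "\<gamma> 1 = (l, 0)"
    using pen by (auto simp: pen_pinned_elastica_def A_adm_def W22_imm_def)
  obtain v1 v2 g1 g2 where D: "W22_data \<gamma> v1 v2 g1 g2" and
    sq: "(\<lambda>x. (g1 x)\<^sup>2) integrable_on {0..1}" "(\<lambda>x. (g2 x)\<^sup>2) integrable_on {0..1}"
    using W22_imp_data[OF W] by metis
  note vc = W22_data_continuous[OF D]
  have pos: "(v1 x)\<^sup>2 + (v2 x)\<^sup>2 > 0" if "x \<in> {0..1}" for x
    using imm[OF that] W22_data_d1[OF D that] by (auto simp: sum_power2_gt_zero_iff zero_prod_def)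
  define n where "n x = sqrt ((v1 x)\<^sup>2 + (v2 x)\<^sup>2)" for x
  have nc: "continuous_on {0..1} n" unfolding n_def by (intro continuous_intros vc)
  have n0: "n x > 0" if "x \<in> {0..1}" for x using pos[OF that] by (simp add: n_def)
  have nn: "(n x)\<^sup>2 = (v1 x)\<^sup>2 + (v2 x)\<^sup>2" for x by (simp add: n_def)
  define T1 T2 where "T1 x = v1 x / n x" and "T2 x = v2 x / n x" for x
  have T12: "(T1 x)\<^sup>2 + (T2 x)\<^sup>2 = 1" if "x \<in> {0..1}" for x
    unfolding T1_def T2_def power_divide add_divide_distrib[symmetric] nn[symmetric] using n0[OF that] by simp
  have Tc: "continuous_on {0..1} T1" "continuous_on {0..1} T2"
    unfolding T1_def T2_def using n0 by (auto intro!: continuous_intros vc nc simp: less_le)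
  define S1 where "S1 = (\<lambda>x. dlagrangian lam (v1 x) (v2 x) (g1 x) (g2 x) 0 0 1 0)"
  define S2 where "S2 = (\<lambda>x. dlagrangian lam (v1 x) (v2 x) (g1 x) (g2 x) 0 0 0 1)"
  define Q1 where "Q1 = (\<lambda>x. dlagrangian lam (v1 x) (v2 x) (g1 x) (g2 x) 1 0 0 0)"
  define Q2 where "Q2 = (\<lambda>x. dlagrangian lam (v1 x) (v2 x) (g1 x) (g2 x) 0 1 0 0)"
  define c1 where "c1 = integral {0..1} Q1"
  define c2 where "c2 = integral {0..1} Q2"
  define U1 where "U1 x = integral {0..x} Q1 - x * c1" for x
  define U2 where "U2 x = integral {0..x} Q2 - x * c2" for x
  have one: "\<bar>1::real\<bar> \<le> 1" "\<bar>0::real\<bar> \<le> 1" by simp_all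
  obtain N1 where N1: "negligible N1" "Q1 absolutely_integrable_on {0..1}"
    "\<And>x. x \<in> {0..1} - N1 \<Longrightarrow> S1 x = integral {0..x} Q1 - x * c1"
    unfolding c1_def
    using euler_lagrange_integrated[OF D pos sq pen less_imp_le[OF lam] one(1) one(2) S1_def Q1_def] by blast
  obtain N2 where N2: "negligible N2" "Q2 absolutely_integrable_on {0..1}"
    "\<And>x. x \<in> {0..1} - N2 \<Longrightarrow> S2 x = integral {0..x} Q2 - x * c2"
    unfolding c2_def
    using euler_lagrange_integrated[OF D pos sq pen less_imp_le[OF lam] one(2) one(1) S2_def Q2_def] by blast
  obtain N3 where N3: "negligible N3"
    "\<And>x. x \<in> {0..1} - N3 \<Longrightarrow> (v1 has_real_derivative g1 x) (at x within {0..1})"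
    "\<And>x. x \<in> {0..1} - N3 \<Longrightarrow> (v2 has_real_derivative g2 x) (at x within {0..1})"
    using W22_data_d2[OF D] by metis
  have Qi: "Q1 integrable_on {0..1}" "Q2 integrable_on {0..1}"
    using N1(2) N2(2) by (auto simp: absolutely_integrable_on_def)
  obtain N4 where N4: "negligible N4" "\<And>x. x \<in> {0..1} - N4 \<Longrightarrow>
      ((\<lambda>x. integral {0..x} Q1) has_real_derivative Q1 x) (at x within {0..1})"
    using lebesgue_differentiation[OF Qi(1)] by metis
  obtain N5 where N5: "negligible N5" "\<And>x. x \<in> {0..1} - N5 \<Longrightarrow>
      ((\<lambda>x. integral {0..x} Q2) has_real_derivative Q2 x) (at x within {0..1})"
    using lebesgue_differentiation[OF Qi(2)] by metis
  define N where "N = N1 \<union> N2 \<union> N3 \<union> N4 \<union> N5"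
  have N: "negligible N" using N1(1) N2(1) N3(1) N4(1) N5(1) by (simp add: N_def)
  have off: "U1 x = S1 x" "U2 x = S2 x"
    "(v1 has_real_derivative g1 x) (at x within {0..1})" "(v2 has_real_derivative g2 x) (at x within {0..1})"
    "(U1 has_real_derivative Q1 x - c1) (at x within {0..1})" "(U2 has_real_derivative Q2 x - c2) (at x within {0..1})"
    if "x \<in> {0..1} - N" for x
    using N1(3)[of x] N2(3)[of x] N3(2,3)[of x] N4(2)[of x] N5(2)[of x] that
    unfolding U1_def[abs_def] U2_def[abs_def] by (auto simp: N_def intro!: derivative_eq_intros)
  have Uc: "continuous_on {0..1} U1" "continuous_on {0..1} U2"
    unfolding U1_def U2_def by (intro continuous_intros indefinite_integral_continuous_1 Qi)+
  \<comment> \<open>(Z1, Z2) will be 2 k N: the functions U1 and U2 are continuous and equal S1 and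
    S2 off N. Taking k to be half of the normal component makes it continuous from the
    outset.\<close>
  define Z1 where "Z1 x = n x * U1 x" for x
  define Z2 where "Z2 x = n x * U2 x" for x
  define k where "k x = (- Z1 x * T2 x + Z2 x * T1 x) / 2" for x
  have Zc: "continuous_on {0..1} Z1" "continuous_on {0..1} Z2" "continuous_on {0..1} k"
    unfolding Z1_def Z2_def k_def by (intro continuous_intros Uc nc Tc; simp)+
  have dn: "(n has_real_derivative (v1 x * g1 x + v2 x * g2 x) / n x) (at x within {0..1})"
    if "x \<in> {0..1} - N" for x
  proof -
    have "((\<lambda>x. (v1 x)\<^sup>2 + (v2 x)\<^sup>2) has_real_derivative (2 * v1 x * g1 x + 2 * v2 x * g2 x)) (at x within {0..1})"
      using off(3,4)[OF that] by (auto intro!: derivative_eq_intros)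
    moreover have "(sqrt has_real_derivative inverse (n x) / 2) (at ((v1 x)\<^sup>2 + (v2 x)\<^sup>2))"
      using DERIV_real_sqrt[of "(v1 x)\<^sup>2 + (v2 x)\<^sup>2"] pos that by (auto simp: n_def)
    ultimately have "(n has_real_derivative inverse (n x) / 2 * (2 * v1 x * g1 x + 2 * v2 x * g2 x)) (at x within {0..1})"
      unfolding n_def[abs_def] by (intro DERIV_chain2[where f=sqrt])
    then show ?thesis by (rule DERIV_cong) (use n0[of x] that in \<open>auto simp: field_simps\<close>)
  qed
  have k_eq: "k x = (- (n x * S1 x) * (v2 x / n x) + (n x * S2 x) * (v1 x / n x)) / 2" if x: "x \<in> {0..1} - N" for x
    by (simp add: k_def Z1_def Z2_def off(1,2)[OF x] T1_def T2_def)
  have alg: "Z1 x = - 2 * k x * T2 x" "Z2 x = 2 * k x * T1 x"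
    "(g1 x * n x - v1 x * ((v1 x * g1 x + v2 x * g2 x) / n x)) / (n x * n x) = - k x * n x * T2 x"
    "(g2 x * n x - v2 x * ((v1 x * g1 x + v2 x * g2 x) / n x)) / (n x * n x) = k x * n x * T1 x"
    "((v1 x * g1 x + v2 x * g2 x) / n x) * U1 x + (Q1 x - c1) * n x = n x * ((lam - 3 * (k x)\<^sup>2) * T1 x - c1)"
    "((v1 x * g1 x + v2 x * g2 x) / n x) * U2 x + (Q2 x - c2) * n x = n x * ((lam - 3 * (k x)\<^sup>2) * T2 x - c2)"
    if x: "x \<in> {0..1} - N" for x
    unfolding Z1_def Z2_def off(1,2)[OF x] T1_def T2_def
    by (rule frenet_algebra[OF n0[OF DiffD1[OF x]] nn refl fun_cong[OF S1_def] fun_cong[OF S2_def]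
       fun_cong[OF Q1_def] fun_cong[OF Q2_def] k_eq[OF x]])+
  obtain m M where m0: "m > 0" "M \<ge> 0" and mM: "\<And>x. x \<in> {0..1} \<Longrightarrow> m \<le> n x" "\<And>x. x \<in> {0..1} \<Longrightarrow> n x \<le> M"
    using continuous_pos_bounds[OF nc n0] by metis
  have gai: "(\<lambda>x. \<bar>g1 x\<bar>) integrable_on {0..1}" "(\<lambda>x. \<bar>g2 x\<bar>) integrable_on {0..1}"
    "(\<lambda>x. \<bar>Q1 x\<bar>) integrable_on {0..1}" "(\<lambda>x. \<bar>Q2 x\<bar>) integrable_on {0..1}"
    using W22_dataD(2,3)[OF D] N1(2) N2(2) by (auto simp: absolutely_integrable_on_def)
  define G where "G x = \<bar>g1 x\<bar> + \<bar>g2 x\<bar>" for x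
  have Gi: "G integrable_on {0..1}" unfolding G_def by (intro integrable_add gai)
  have vG: "\<bar>v1 y - v1 x\<bar> + \<bar>v2 y - v2 x\<bar> \<le> integral {x..y} G" if xy: "0 \<le> x" "x \<le> y" "y \<le> 1" for x y
  proof -
    have "\<bar>v1 y - v1 x\<bar> \<le> integral {x..y} (\<lambda>x. \<bar>g1 x\<bar>)" "\<bar>v2 y - v2 x\<bar> \<le> integral {x..y} (\<lambda>x. \<bar>g2 x\<bar>)"
      using abs_integral_le_integral_abs[OF W22_dataD(2)[OF D] xy] abs_integral_le_integral_abs[OF W22_dataD(3)[OF D] xy]
        W22_dataD(4,5)[OF D, of x] W22_dataD(4,5)[OF D, of y] xy by auto
    moreover have "integral {x..y} G = integral {x..y} (\<lambda>x. \<bar>g1 x\<bar>) + integral {x..y} (\<lambda>x. \<bar>g2 x\<bar>)"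
      unfolding G_def using xy by (intro integral_add integrable_subinterval_real[OF gai(1)] integrable_subinterval_real[OF gai(2)]) auto
    ultimately show ?thesis by linarith
  qed
  have dT: "(T1 has_real_derivative - k x * n x * T2 x) (at x within {0..1})"
      "(T2 has_real_derivative k x * n x * T1 x) (at x within {0..1})" if x: "x \<in> {0..1}" for x
  proof -
    have pm: "(\<lambda>x. 2 / m * G x) integrable_on {0..1}" using Gi by (intro integrable_on_mult_right)
    show "(T1 has_real_derivative - k x * n x * T2 x) (at x within {0..1})"
    proof (rule C1_of_ae_derivative[OF N _ pm _ _ x])
      show "continuous_on {0..1} (\<lambda>x. - k x * n x * T2 x)" by (intro continuous_intros Zc nc Tc)
      show "(T1 has_real_derivative - k x * n x * T2 x) (at x within {0..1})" if x: "x \<in> {0..1} - N" for x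
        unfolding T1_def[abs_def]
        by (rule DERIV_cong[OF DERIV_divide[OF off(3)[OF x] dn[OF x]]]) (use n0[of x] x alg(3)[OF x] in auto)
      show "\<bar>T1 y - T1 x\<bar> \<le> integral {x..y} (\<lambda>x. 2 / m * G x)" if xy: "0 \<le> x" "x \<le> y" "y \<le> 1" for x y
        using unit_quotient_diff(1)[of m "v1 x" "v2 x" "v1 y" "v2 y"] m0 mM[of x] mM[of y] xy
          mult_left_mono[OF vG[OF xy], of "2/m"] by (simp add: T1_def n_def)
    qed
    show "(T2 has_real_derivative k x * n x * T1 x) (at x within {0..1})"
    proof (rule C1_of_ae_derivative[OF N _ pm _ _ x])
      show "continuous_on {0..1} (\<lambda>x. k x * n x * T1 x)" by (intro continuous_intros Zc nc Tc)
      show "(T2 has_real_derivative k x * n x * T1 x) (at x within {0..1})" if x: "x \<in> {0..1} - N" for x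
        unfolding T2_def[abs_def]
        by (rule DERIV_cong[OF DERIV_divide[OF off(4)[OF x] dn[OF x]]]) (use n0[of x] x alg(4)[OF x] in auto)
      show "\<bar>T2 y - T2 x\<bar> \<le> integral {x..y} (\<lambda>x. 2 / m * G x)" if xy: "0 \<le> x" "x \<le> y" "y \<le> 1" for x y
        using unit_quotient_diff(1)[of m "v2 x" "v1 x" "v2 y" "v1 y"] m0 mM[of x] mM[of y] xy
          mult_left_mono[OF vG[OF xy], of "2/m"] by (simp add: T2_def n_def add.commute)
    qed
  qed
  \<comment> \<open>Common to both components. An increment of n U splits into n times one of U,
    controlled by |Q| + |c|, and U times one of n, controlled by G.\<close>
  have dZ: "((\<lambda>x. n x * (integral {0..x} Q - x * c)) has_real_derivative z x) (at x within {0..1})"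
    if Q: "Q absolutely_integrable_on {0..1}" and x: "x \<in> {0..1}" and zc: "continuous_on {0..1} z"
      and zd: "\<And>x. x \<in> {0..1} - N \<Longrightarrow> ((\<lambda>x. n x * (integral {0..x} Q - x * c)) has_real_derivative z x) (at x within {0..1})"
    for Q z c x
  proof -
    have Qi: "Q integrable_on {0..1}" "(\<lambda>x. \<bar>Q x\<bar>) integrable_on {0..1}"
      using Q by (auto simp: absolutely_integrable_on_def)
    define U where "U x = integral {0..x} Q - x * c" for x
    have Uc: "continuous_on {0..1} U"
      unfolding U_def by (intro continuous_intros indefinite_integral_continuous_1 Qi)
    obtain B where "\<forall>y\<in>U ` {0..1}. norm y \<le> B"
      using compact_imp_bounded[OF compact_continuous_image[OF Uc compact_Icc]]
      unfolding bounded_iff by blast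
    then have B: "\<bar>U x\<bar> \<le> B" if "x \<in> {0..1}" for x
      using that by auto
    show ?thesis
    proof (rule C1_of_ae_derivative[OF N zd _ _ zc x])
      show pi: "(\<lambda>x. M * (\<bar>Q x\<bar> + \<bar>c\<bar>) + B * G x) integrable_on {0..1}"
        by (intro integrable_add integrable_on_mult_right Qi Gi) auto
      fix x y :: real assume xy: "0 \<le> x" "x \<le> y" "y \<le> 1"
      have i: "(\<lambda>x. \<bar>Q x\<bar>) integrable_on {x..y}" "G integrable_on {x..y}"
        using xy by (auto intro: integrable_subinterval_real[OF Qi(2)] integrable_subinterval_real[OF Gi])
      have "integral {x..y} (\<lambda>x. M * (\<bar>Q x\<bar> + \<bar>c\<bar>) + B * G x) =
          M * (integral {x..y} (\<lambda>x. \<bar>Q x\<bar>) + (y - x) * \<bar>c\<bar>) + B * integral {x..y} G"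
      proof -
        have j: "(\<lambda>x. \<bar>Q x\<bar> + \<bar>c\<bar>) integrable_on {x..y}" using i by (intro integrable_add) auto
        have "integral {x..y} (\<lambda>x. \<bar>Q x\<bar> + \<bar>c\<bar>) = integral {x..y} (\<lambda>x. \<bar>Q x\<bar>) + (y - x) * \<bar>c\<bar>"
          using xy by (subst integral_add[OF i(1)]) auto
        moreover have "integral {x..y} (\<lambda>x. M * (\<bar>Q x\<bar> + \<bar>c\<bar>) + B * G x) =
          M * integral {x..y} (\<lambda>x. \<bar>Q x\<bar> + \<bar>c\<bar>) + B * integral {x..y} G"
          using integral_add[OF integrable_on_mult_right[OF j, of M] integrable_on_mult_right[OF i(2), of B]] by simp
        ultimately show ?thesis by simp
      qed
      moreover have "\<bar>n y * (U y - U x)\<bar> \<le> M * (integral {x..y} (\<lambda>x. \<bar>Q x\<bar>) + (y - x) * \<bar>c\<bar>)"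
      proof -
        have "U y - U x = (integral {0..y} Q - integral {0..x} Q) - (y - x) * c"
          by (simp add: U_def algebra_simps)
        moreover have "\<bar>(y - x) * c\<bar> = (y - x) * \<bar>c\<bar>" using xy by (simp add: abs_mult)
        ultimately have "\<bar>U y - U x\<bar> \<le> integral {x..y} (\<lambda>x. \<bar>Q x\<bar>) + (y - x) * \<bar>c\<bar>"
          using abs_integral_le_integral_abs[OF Q xy] by linarith
        then show ?thesis
          unfolding abs_mult using mM[of y] n0[of y] xy m0 by (intro mult_mono) auto
      qed
      moreover have "\<bar>U x * (n y - n x)\<bar> \<le> B * integral {x..y} G"
      proof -
        have "\<bar>n y - n x\<bar> \<le> integral {x..y} G"
          using unit_quotient_diff(2)[of m "v1 x" "v2 x" "v1 y" "v2 y"] m0 mM[of x] mM[of y] xy vG[OF xy]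
          by (simp add: n_def)
        then show ?thesis unfolding abs_mult using B[of x] xy by (intro mult_mono) auto
      qed
      moreover have "n y * U y - n x * U x = n y * (U y - U x) + U x * (n y - n x)" by (simp add: algebra_simps)
      ultimately show "\<bar>n y * (integral {0..y} Q - y * c) - n x * (integral {0..x} Q - x * c)\<bar>
          \<le> integral {x..y} (\<lambda>x. M * (\<bar>Q x\<bar> + \<bar>c\<bar>) + B * G x)"
        unfolding U_def[symmetric] by linarith
    qed
  qed
  have dZ1: "(Z1 has_real_derivative n x * ((lam - 3 * (k x)\<^sup>2) * T1 x - c1)) (at x within {0..1})"
    if x: "x \<in> {0..1}" for x
    unfolding Z1_def[abs_def] U1_def[abs_def]
  proof (rule dZ[OF N1(2) x])
    show "continuous_on {0..1} (\<lambda>x. n x * ((lam - 3 * (k x)\<^sup>2) * T1 x - c1))"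
      by (intro continuous_intros Zc nc Tc)
    fix x assume x: "x \<in> {0..1} - N"
    show "((\<lambda>x. n x * (integral {0..x} Q1 - x * c1)) has_real_derivative n x * ((lam - 3 * (k x)\<^sup>2) * T1 x - c1)) (at x within {0..1})"
      using DERIV_mult[OF dn[OF x] off(5)[OF x]] unfolding alg(5)[OF x] by (simp add: U1_def[abs_def])
  qed
  have dZ2: "(Z2 has_real_derivative n x * ((lam - 3 * (k x)\<^sup>2) * T2 x - c2)) (at x within {0..1})"
    if x: "x \<in> {0..1}" for x
    unfolding Z2_def[abs_def] U2_def[abs_def]
  proof (rule dZ[OF N2(2) x])
    show "continuous_on {0..1} (\<lambda>x. n x * ((lam - 3 * (k x)\<^sup>2) * T2 x - c2))"
      by (intro continuous_intros Zc nc Tc)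
    fix x assume x: "x \<in> {0..1} - N"
    show "((\<lambda>x. n x * (integral {0..x} Q2 - x * c2)) has_real_derivative n x * ((lam - 3 * (k x)\<^sup>2) * T2 x - c2)) (at x within {0..1})"
      using DERIV_mult[OF dn[OF x] off(6)[OF x]] unfolding alg(6)[OF x] by (simp add: U2_def[abs_def])
  qed
  have Z1k: "Z1 x = - 2 * k x * T2 x" and Z2k: "Z2 x = 2 * k x * T1 x" if x: "x \<in> {0..1}" for x
  proof -
    have "Z1 x + 2 * k x * T2 x = 0"
      by (rule continuous_ae_zero[OF N _ _ x]) (auto intro!: continuous_intros Zc Tc simp: alg(1))
    then show "Z1 x = - 2 * k x * T2 x" by simp
    have "Z2 x - 2 * k x * T1 x = 0"
      by (rule continuous_ae_zero[OF N _ _ x]) (auto intro!: continuous_intros Zc Tc simp: alg(2))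
    then show "Z2 x = 2 * k x * T1 x" by simp
  qed
  have dk: "(k has_real_derivative n x * ((c1 * T2 x - c2 * T1 x) / 2)) (at x within {0..1})" if x: "x \<in> {0..1}" for x
  proof -
    have gen: "((\<lambda>x. (- Z1 x * T2 x + Z2 x * T1 x) / 2) has_real_derivative
        (- z1 * T2 x - Z1 x * t2 + z2 * T1 x + Z2 x * t1) / 2) (at x within {0..1})"
      if "(Z1 has_real_derivative z1) (at x within {0..1})" "(Z2 has_real_derivative z2) (at x within {0..1})"
        "(T1 has_real_derivative t1) (at x within {0..1})" "(T2 has_real_derivative t2) (at x within {0..1})"
      for z1 z2 t1 t2
      by (auto intro!: derivative_eq_intros that simp: field_simps)
    have kk: "(\<lambda>x. (- Z1 x * T2 x + Z2 x * T1 x) / 2) = k" by (simp add: k_def fun_eq_iff)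
    note gen[OF dZ1[OF x] dZ2[OF x] dT[OF x], unfolded kk]
    then show ?thesis
      by (rule DERIV_cong) (simp add: Z1k[OF x] Z2k[OF x] field_simps)
  qed
  \<comment> \<open>Z is normal to T everywhere, so Z . T has derivative 0; expanding this
    derivative yields the tangential component of the vector equation.\<close>
  have cons: "c1 * T1 x + c2 * T2 x = lam - (k x)\<^sup>2" if x: "x \<in> {0..1}" for x
  proof -
    define t where "t = (\<lambda>x. Z1 x * T1 x + Z2 x * T2 x)"
    have "(t has_real_derivative (n x * ((lam - 3 * (k x)\<^sup>2) * T1 x - c1)) * T1 x + Z1 x * (- k x * n x * T2 x)
       + (n x * ((lam - 3 * (k x)\<^sup>2) * T2 x - c2)) * T2 x + Z2 x * (k x * n x * T1 x)) (at x within {0..1})"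
      unfolding t_def by (auto intro!: derivative_eq_intros dZ1[OF x] dZ2[OF x] dT[OF x])
    moreover have "(t has_real_derivative 0) (at x within {0..1})"
    proof (rule has_field_derivative_transform_within[where d=1])
      show "((\<lambda>_. 0) has_real_derivative 0) (at x within {0..1})" by simp
      show "0 = t y" if "y \<in> {0..1}" for y using Z1k[OF that] Z2k[OF that] by (simp add: t_def)
    qed (use x in auto)
    ultimately have "(n x * ((lam - 3 * (k x)\<^sup>2) * T1 x - c1)) * T1 x + Z1 x * (- k x * n x * T2 x)
       + (n x * ((lam - 3 * (k x)\<^sup>2) * T2 x - c2)) * T2 x + Z2 x * (k x * n x * T1 x) = 0"
      using has_real_derivative_within_unique[of t _ x 0 1 0] x by auto
    then have "n x * ((lam - 3 * (k x)\<^sup>2) * ((T1 x)\<^sup>2 + (T2 x)\<^sup>2) - c1 * T1 x - c2 * T2 x + 2 * (k x)\<^sup>2 * ((T1 x)\<^sup>2 + (T2 x)\<^sup>2)) = 0"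
      unfolding Z1k[OF x] Z2k[OF x] by (simp add: algebra_simps power2_eq_square)
    then show ?thesis using n0[OF x] unfolding T12[OF x] by simp
  qed
  \<comment> \<open>U1 and U2 vanish at 0 and at 1 by construction: the natural boundary
    conditions.\<close>
  have k01: "k 0 = 0" "k 1 = 0"
    by (simp_all add: k_def Z1_def Z2_def U1_def U2_def c1_def c2_def)
  have d\<gamma>: "((\<lambda>x. fst (\<gamma> x)) has_real_derivative n x * T1 x) (at x within {0..1})"
    "((\<lambda>x. snd (\<gamma> x)) has_real_derivative n x * T2 x) (at x within {0..1})" if x: "x \<in> {0..1}" for x
    using bounded_linear.has_vector_derivative[OF bounded_linear_fst W22_dataD(1)[OF D x]]
      bounded_linear.has_vector_derivative[OF bounded_linear_snd W22_dataD(1)[OF D x]] n0[OF x]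
    by (simp_all add: T1_def T2_def has_real_derivative_iff_has_vector_derivative)
  have c2: "c2 = 0"
  proof -
    \<comment> \<open>By the conditions at the ends this expression is 0 at x = 0 and c2 l / 2 at x
      = 1.\<close>
    have "\<exists>C. \<forall>x\<in>{0..1}. k x - (c1 * snd (\<gamma> x) - c2 * fst (\<gamma> x)) / 2 = C"
    proof (rule has_field_derivative_zero_constant)
      fix x :: real assume x: "x \<in> {0..1}"
      show "((\<lambda>x. k x - (c1 * snd (\<gamma> x) - c2 * fst (\<gamma> x)) / 2) has_field_derivative 0) (at x within {0..1})"
        by (auto intro!: derivative_eq_intros dk[OF x] d\<gamma>[OF x] simp: field_simps)
    qed simp
    then obtain C where "\<And>x. x\<in>{0..1} \<Longrightarrow> k x - (c1 * snd (\<gamma> x) - c2 * fst (\<gamma> x)) / 2 = C" by blast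
    from this[of 0] this[of 1] show ?thesis using k01 bc l by simp
  qed
  show ?thesis
  proof (rule that[of n T1 T2 k c1])
    show "(T1 has_real_derivative - n x * k x * T2 x) (at x within {0..1})"
      "(T2 has_real_derivative n x * k x * T1 x) (at x within {0..1})"
      "(k has_real_derivative n x * (c1 / 2) * T2 x) (at x within {0..1})"
      "c1 * T1 x = lam - (k x)\<^sup>2" if x: "x \<in> {0..1}" for x
      using dT[OF x] dk[OF x] cons[OF x] c2 by (simp_all add: mult.commute mult.left_commute)
  qed (use nc n0 T12 d\<gamma> k01 in auto)
qed

section \<open>Classification\<close>

lemma gronwall_zero:
  fixes D D' :: "real \<Rightarrow> real"
  assumes d: "\<And>x. x \<in> {0..1} \<Longrightarrow> (D has_real_derivative D' x) (at x within {0..1})"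
    and b: "\<And>x. x \<in> {0..1} \<Longrightarrow> D' x \<le> C * D x"
    and nonneg: "\<And>x. x \<in> {0..1} \<Longrightarrow> 0 \<le> D x" and D0: "D 0 = 0" and x: "x \<in> {0..1}"
  shows "D x = 0"
proof -
  define F where "F x = D x * exp (- C * x)" for x
  have dF: "(F has_real_derivative (D' x - C * D x) * exp (- C * x)) (at x within {0..1})" if "x \<in> {0..1}" for x
    unfolding F_def[abs_def] by (auto intro!: derivative_eq_intros d[OF that] simp: algebra_simps)
  have "F x \<le> F 0"
  proof (rule DERIV_nonpos_imp_decreasing_open[of 0 x F])
    show "0 \<le> x" using x by simp
    show "continuous_on {0..x} F"
      by (rule continuous_on_subset[OF DERIV_continuous_on[OF dF]]) (use x in auto)
    fix z assume z: "0 < z" "z < x"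
    then have "(F has_real_derivative (D' z - C * D z) * exp (- C * z)) (at z)"
      using dF[of z] x at_within_Icc_at[of 0 z 1] by simp
    moreover have "(D' z - C * D z) * exp (- C * z) \<le> 0"
      using b[of z] z x by (intro mult_nonpos_nonneg) auto
    ultimately show "\<exists>y. (F has_real_derivative y) (at z) \<and> y \<le> 0" by blast
  qed
  then have "F x \<le> 0" using D0 by (simp add: F_def)
  then have "D x \<le> 0" by (simp add: F_def mult_le_0_iff)
  then show ?thesis using nonneg[OF x] by simp
qed

text \<open>D is the squared distance of the two solutions. Because k only rotates the tangent, its
  own contribution to the derivative of D cancels; what remains carries the factor k - k', with
  coefficients from the unit vector (A', B') and from m. This gives the linear bound that
  \<open>gronwall_zero\<close> asks for.\<close>

lemma elastica_ode_unique:
  fixes r A B k A' B' k' :: "real \<Rightarrow> real"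
  assumes r: "continuous_on {0..1} r" "\<And>x. x \<in> {0..1} \<Longrightarrow> r x > 0"
    and u: "\<And>x. x \<in> {0..1} \<Longrightarrow> (A' x)\<^sup>2 + (B' x)\<^sup>2 = 1"
    and dA: "\<And>x. x \<in> {0..1} \<Longrightarrow> (A has_real_derivative - r x * k x * B x) (at x within {0..1})"
    and dB: "\<And>x. x \<in> {0..1} \<Longrightarrow> (B has_real_derivative r x * k x * A x) (at x within {0..1})"
    and dk: "\<And>x. x \<in> {0..1} \<Longrightarrow> (k has_real_derivative r x * m * B x) (at x within {0..1})"
    and dA': "\<And>x. x \<in> {0..1} \<Longrightarrow> (A' has_real_derivative - r x * k' x * B' x) (at x within {0..1})"
    and dB': "\<And>x. x \<in> {0..1} \<Longrightarrow> (B' has_real_derivative r x * k' x * A' x) (at x within {0..1})"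
    and dk': "\<And>x. x \<in> {0..1} \<Longrightarrow> (k' has_real_derivative r x * m * B' x) (at x within {0..1})"
    and init: "A 0 = A' 0" "B 0 = B' 0" "k 0 = k' 0"
    and x: "x \<in> {0..1}"
  shows "A x = A' x" "B x = B' x" "k x = k' x"
proof -
  define D where "D x = (A x - A' x)\<^sup>2 + (B x - B' x)\<^sup>2 + (k x - k' x)\<^sup>2" for x
  define E where "E x = 2 * r x * ((k x - k' x) * (- (A x - A' x) * B' x + (B x - B' x) * A' x + m * (B x - B' x)))" for x
  obtain M where M: "\<And>x. x \<in> {0..1} \<Longrightarrow> r x \<le> M" using continuous_pos_bounds[OF r] by metis
  define C where "C = 2 * M * (2 + \<bar>m\<bar>)"
  have "D x = 0"
  proof (rule gronwall_zero[where D'=E and C=C, OF _ _ _ _ x])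
    fix x :: real assume x: "x \<in> {0..1}"
    show "(D has_real_derivative E x) (at x within {0..1})"
      unfolding D_def[abs_def]
      by (rule derivative_eq_intros dA[OF x] dB[OF x] dk[OF x] dA'[OF x] dB'[OF x] dk'[OF x] refl)+
        (simp add: E_def algebra_simps)
    show "0 \<le> D x" by (simp add: D_def)
    define a b c where "a = A x - A' x" and "b = B x - B' x" and "c = k x - k' x"
    have D: "D x = a\<^sup>2 + b\<^sup>2 + c\<^sup>2" by (simp add: D_def a_def b_def c_def)
    have am: "\<bar>c\<bar> * \<bar>y\<bar> \<le> D x" if "y\<^sup>2 + c\<^sup>2 \<le> D x" for y
    proof -
      have "0 \<le> (\<bar>c\<bar> - \<bar>y\<bar>)\<^sup>2 + \<bar>c\<bar>\<^sup>2 + \<bar>y\<bar>\<^sup>2" by simp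
      then have "2 * (\<bar>c\<bar> * \<bar>y\<bar>) \<le> 2 * (y\<^sup>2 + c\<^sup>2)" unfolding power2_diff by simp
      then have "\<bar>c\<bar> * \<bar>y\<bar> \<le> y\<^sup>2 + c\<^sup>2" by (simp only: mult_le_cancel_left_pos zero_less_numeral)
      then show ?thesis using that by (rule order_trans)
    qed
    have ca: "\<bar>c\<bar> * \<bar>a\<bar> \<le> D x" "\<bar>c\<bar> * \<bar>b\<bar> \<le> D x" by (rule am; simp add: D)+
    have AB: "\<bar>A' x\<bar> \<le> 1" "\<bar>B' x\<bar> \<le> 1"
      using abs_le_sqrt_sum[where a="A' x" and b="B' x"] u[OF x] by auto
    have "\<bar>c * (- a * B' x + b * A' x + m * b)\<bar> \<le> (2 + \<bar>m\<bar>) * D x"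
    proof -
      have "\<bar>c * (- a * B' x)\<bar> \<le> D x * 1" "\<bar>c * (b * A' x)\<bar> \<le> D x * 1"
        using mult_mono[OF ca(1) AB(2)] mult_mono[OF ca(2) AB(1)] by (auto simp: abs_mult mult.assoc D)
      moreover have "\<bar>c * (m * b)\<bar> \<le> \<bar>m\<bar> * D x"
        using mult_left_mono[OF ca(2), of "\<bar>m\<bar>"] by (simp add: abs_mult mult.left_commute)
      moreover have "c * (- a * B' x + b * A' x + m * b) = c * (- a * B' x) + c * (b * A' x) + c * (m * b)"
        by (simp add: algebra_simps)
      ultimately show ?thesis unfolding distrib_right by linarith
    qed
    then have "c * (- a * B' x + b * A' x + m * b) \<le> (2 + \<bar>m\<bar>) * D x" by linarith
    then have "2 * r x * (c * (- a * B' x + b * A' x + m * b)) \<le> 2 * r x * ((2 + \<bar>m\<bar>) * D x)"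
      using r(2)[OF x] by (intro mult_left_mono) auto
    also have "\<dots> \<le> 2 * M * ((2 + \<bar>m\<bar>) * D x)"
      using M[OF x] by (intro mult_right_mono) (auto simp: D)
    finally show "E x \<le> C * D x" by (simp add: E_def C_def a_def b_def c_def mult.assoc)
  qed (simp add: D_def init)
  moreover have "(A x - A' x)\<^sup>2 \<ge> 0" "(B x - B' x)\<^sup>2 \<ge> 0" "(k x - k' x)\<^sup>2 \<ge> 0" by simp_all
  ultimately have "(A x - A' x)\<^sup>2 = 0" "(B x - B' x)\<^sup>2 = 0" "(k x - k' x)\<^sup>2 = 0"
    unfolding D_def by linarith+
  then show "A x = A' x" "B x = B' x" "k x = k' x" by simp_all
qed

lemma eq_of_equal_derivatives:
  fixes F G :: "real \<Rightarrow> real"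
  assumes "\<And>x. x \<in> {0..1} \<Longrightarrow> (F has_real_derivative d x) (at x within {0..1})"
    "\<And>x. x \<in> {0..1} \<Longrightarrow> (G has_real_derivative d x) (at x within {0..1})" "F 0 = G 0" "x \<in> {0..1}"
  shows "F x = G x"
proof -
  have "\<exists>c. \<forall>x\<in>{0..1}. F x - G x = c"
  proof (rule has_field_derivative_zero_constant)
    fix x :: real assume "x \<in> {0..1}"
    then show "((\<lambda>x. F x - G x) has_real_derivative 0) (at x within {0..1})"
      using DERIV_diff[OF assms(1,2)] by fastforce
  qed simp
  then obtain c where "\<And>x. x\<in>{0..1} \<Longrightarrow> F x - G x = c" by blast
  from this[of x] this[of 0] assms show ?thesis by simp
qed

text \<open>\<open>\<delta> = 1\<close> gives the arcs and \<open>\<delta> = - 1\<close> the loops.\<close>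
definition elastica_x :: "real \<Rightarrow> real \<Rightarrow> real \<Rightarrow> real \<Rightarrow> real" where
  "elastica_x \<delta> q \<alpha> s = \<delta> * (2 * ellE (jam (\<alpha> * s - ellK q) q) q + 2 * ellEc q - \<alpha> * s) / \<alpha>"

definition elastica_y :: "real \<Rightarrow> real \<Rightarrow> real \<Rightarrow> real" where
  "elastica_y q \<alpha> s = 2 * q * jcn (\<alpha> * s - ellK q) q / \<alpha>"

lemma special_curves_eq:
  "arc_curve q \<alpha> s = (elastica_x 1 q \<alpha> s, elastica_y q \<alpha> s)"
  "loop_curve q \<alpha> s = (elastica_x (- 1) q \<alpha> s, elastica_y q \<alpha> s)"
  by (simp_all add: arc_curve_def loop_curve_def elastica_x_def elastica_y_def)

text \<open>(A, B) is the unit tangent and k the curvature in terms of the amplitude \<phi>; they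
  solve the system of \<open>elastica_ode_unique\<close> with m = - \<delta> \<alpha>^2. With X =
  q^2 sin^2, unit length is (1 - 2 X)^2 + 4 X (1 - X) = 1. The shift by K starts the amplitude at
  -pi/2, where the curvature vanishes.\<close>

lemma elastica_derivatives:
  fixes \<delta> q \<alpha> :: real
  assumes q: "\<bar>q\<bar> < 1" and \<alpha>: "\<alpha> \<noteq> 0" and \<delta>: "\<delta>\<^sup>2 = 1"
  defines "\<phi> \<equiv> \<lambda>s. jam (\<alpha> * s - ellK q) q"
  defines "A \<equiv> \<lambda>s. \<delta> * (1 - 2 * q\<^sup>2 * (sin (\<phi> s))\<^sup>2)"
    and "B \<equiv> \<lambda>s. - 2 * q * sin (\<phi> s) * ellD q (\<phi> s)"
    and "k \<equiv> \<lambda>s. - 2 * \<delta> * \<alpha> * q * cos (\<phi> s)"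
  shows "(elastica_x \<delta> q \<alpha> has_real_derivative A s) (at s)"
    "(elastica_y q \<alpha> has_real_derivative B s) (at s)"
    "(A has_real_derivative - k s * B s) (at s)"
    "(B has_real_derivative k s * A s) (at s)"
    "(k has_real_derivative - \<delta> * \<alpha>\<^sup>2 * B s) (at s)"
    "(A s)\<^sup>2 + (B s)\<^sup>2 = 1"
    "elastica_x \<delta> q \<alpha> 0 = 0" "elastica_y q \<alpha> 0 = 0"
    "A 0 = \<delta> * (1 - 2 * q\<^sup>2)" "B 0 = 2 * q * sqrt (1 - q\<^sup>2)" "k 0 = 0"
proof -
  define D where "D = ellD q (\<phi> s)"
  have D2: "D\<^sup>2 = 1 - q\<^sup>2 * (sin (\<phi> s))\<^sup>2" unfolding D_def by (rule ellD_square[OF q])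
  have D0: "D > 0" unfolding D_def by (rule ellD_pos[OF q])
  have dl: "((\<lambda>s. \<alpha> * s - ellK q) has_real_derivative \<alpha>) (at s)" by (auto intro!: derivative_eq_intros)
  have d\<phi>: "(\<phi> has_real_derivative D * \<alpha>) (at s)"
    unfolding \<phi>_def D_def
    using DERIV_chain2[where f="\<lambda>u. jam u q" and g="\<lambda>s. \<alpha> * s - ellK q" and x=s and s=UNIV, OF jam_has_derivative[OF q] dl] .
  have dE: "((\<lambda>s. ellE (\<phi> s) q) has_real_derivative D * (D * \<alpha>)) (at s)"
    unfolding D_def
    using DERIV_chain2[where f="\<lambda>u. ellE u q" and g=\<phi> and x=s and s=UNIV, OF ellE_has_derivative d\<phi>] by (simp add: D_def)
  have dsin: "((\<lambda>s. sin (\<phi> s)) has_real_derivative cos (\<phi> s) * (D * \<alpha>)) (at s)"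
    using DERIV_chain2[where f=sin and g=\<phi> and x=s and s=UNIV, OF DERIV_sin d\<phi>] .
  have dcos: "((\<lambda>s. cos (\<phi> s)) has_real_derivative - sin (\<phi> s) * (D * \<alpha>)) (at s)"
    using DERIV_chain2[where f=cos and g=\<phi> and x=s and s=UNIV, OF DERIV_cos d\<phi>] .
  have dDl: "(ellD q has_real_derivative - q\<^sup>2 * sin t * cos t / ellD q t) (at t)" for t
    by (rule ellD_has_derivative[OF q])
  have dD: "((\<lambda>s. ellD q (\<phi> s)) has_real_derivative - q\<^sup>2 * sin (\<phi> s) * cos (\<phi> s) * \<alpha>) (at s)"
    by (rule DERIV_cong[OF DERIV_chain2[where f="ellD q" and g=\<phi> and x=s and s=UNIV, OF dDl d\<phi>]])
      (use D0 in \<open>simp add: D_def[symmetric]\<close>)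
  show "(elastica_x \<delta> q \<alpha> has_real_derivative A s) (at s)"
  proof -
    have "((\<lambda>s. \<delta> * (2 * ellE (\<phi> s) q + 2 * ellEc q - \<alpha> * s) / \<alpha>) has_real_derivative \<delta> * (2 * (D * (D * \<alpha>)) - \<alpha>) / \<alpha>) (at s)"
      using \<alpha> by (auto intro!: derivative_eq_intros dE)
    moreover have "\<delta> * (2 * (D * (D * \<alpha>)) - \<alpha>) / \<alpha> = \<delta> * (2 * D\<^sup>2 - 1)"
      using \<alpha> by (simp add: field_simps power2_eq_square)
    moreover have "\<delta> * (2 * D\<^sup>2 - 1) = A s" unfolding A_def D2 by (simp add: algebra_simps)
    moreover have "elastica_x \<delta> q \<alpha> = (\<lambda>s. \<delta> * (2 * ellE (\<phi> s) q + 2 * ellEc q - \<alpha> * s) / \<alpha>)"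
      by (simp add: fun_eq_iff elastica_x_def \<phi>_def)
    ultimately show ?thesis by (simp only:)
  qed
  show "(elastica_y q \<alpha> has_real_derivative B s) (at s)"
  proof -
    have "((\<lambda>s. 2 * q * cos (\<phi> s) / \<alpha>) has_real_derivative 2 * q * (- sin (\<phi> s) * (D * \<alpha>)) / \<alpha>) (at s)"
      by (intro DERIV_cdivide DERIV_cmult dcos)
    moreover have "2 * q * (- sin (\<phi> s) * (D * \<alpha>)) / \<alpha> = B s"
      using \<alpha> by (simp add: B_def D_def)
    moreover have "elastica_y q \<alpha> = (\<lambda>s. 2 * q * cos (\<phi> s) / \<alpha>)"
      by (simp add: fun_eq_iff elastica_y_def jcn_def \<phi>_def)
    ultimately show ?thesis by (simp only:)
  qed
  show "(A has_real_derivative - k s * B s) (at s)"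
    unfolding A_def
    by (rule derivative_eq_intros dsin refl)+ (simp add: k_def B_def D_def \<delta> algebra_simps power2_eq_square)
  show "(B has_real_derivative k s * A s) (at s)"
  proof -
    have "(B has_real_derivative (- 2 * q * (cos (\<phi> s) * (D * \<alpha>))) * D + (- 2 * q * sin (\<phi> s)) * (- q\<^sup>2 * sin (\<phi> s) * cos (\<phi> s) * \<alpha>)) (at s)"
      unfolding B_def using DERIV_mult[OF DERIV_cmult[OF dsin, of "- 2 * q"] dD] by (simp add: D_def ac_simps)
    moreover have "(- 2 * q * (cos (\<phi> s) * (D * \<alpha>))) * D + (- 2 * q * sin (\<phi> s)) * (- q\<^sup>2 * sin (\<phi> s) * cos (\<phi> s) * \<alpha>)
       = - 2 * \<alpha> * q * cos (\<phi> s) * (D\<^sup>2 - q\<^sup>2 * (sin (\<phi> s))\<^sup>2)"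
      by (simp add: algebra_simps power2_eq_square)
    moreover have "\<dots> = k s * A s"
    proof -
      have "k s * A s = \<delta>\<^sup>2 * (- 2 * \<alpha> * q * cos (\<phi> s) * (1 - 2 * q\<^sup>2 * (sin (\<phi> s))\<^sup>2))"
        by (simp add: k_def A_def power2_eq_square algebra_simps)
      then show ?thesis unfolding \<delta> D2 by simp
    qed
    ultimately show ?thesis by simp
  qed
  show "(k has_real_derivative - \<delta> * \<alpha>\<^sup>2 * B s) (at s)"
    unfolding k_def
    by (rule DERIV_cong[OF DERIV_cmult[OF dcos]]) (simp add: B_def D_def power2_eq_square)
  show "(A s)\<^sup>2 + (B s)\<^sup>2 = 1"
  proof -
    have "(A s)\<^sup>2 + (B s)\<^sup>2 = \<delta>\<^sup>2 * (1 - 2 * q\<^sup>2 * (sin (\<phi> s))\<^sup>2)\<^sup>2 + 4 * (q\<^sup>2 * (sin (\<phi> s))\<^sup>2) * D\<^sup>2"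
      by (simp add: A_def B_def D_def power_mult_distrib)
    also have "\<dots> = 1" unfolding \<delta> D2 by (simp add: power2_eq_square algebra_simps)
    finally show ?thesis .
  qed
  have \<phi>0: "\<phi> 0 = - pi/2"
    using jam_odd_multiple[OF q, of "-1"] by (simp add: \<phi>_def)
  have "ellE (- pi/2) q = - ellEc q"
    using ellE_odd_multiple[of "-1" q] by simp
  then show "elastica_x \<delta> q \<alpha> 0 = 0"
    using \<phi>0 by (simp add: elastica_x_def \<phi>_def)
  show "elastica_y q \<alpha> 0 = 0" using \<phi>0 by (simp add: elastica_y_def jcn_def \<phi>_def)
  show "A 0 = \<delta> * (1 - 2 * q\<^sup>2)" "B 0 = 2 * q * sqrt (1 - q\<^sup>2)" "k 0 = 0"
    by (simp_all add: A_def B_def k_def \<phi>0 ellD_def)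
qed

text \<open>The parameters are fitted to the initial data and uniqueness does the rest. The
  assumption on T2(0) selects one of two mirror images: the special curves start with B(0) >
  0.\<close>

lemma elastica_classification:
  fixes X Y r T1 T2 k :: "real \<Rightarrow> real"
  assumes r: "continuous_on {0..1} r" "\<And>x. x \<in> {0..1} \<Longrightarrow> r x > 0"
    and unit: "\<And>x. x \<in> {0..1} \<Longrightarrow> (T1 x)\<^sup>2 + (T2 x)\<^sup>2 = 1"
    and dX: "\<And>x. x \<in> {0..1} \<Longrightarrow> (X has_real_derivative r x * T1 x) (at x within {0..1})"
    and dY: "\<And>x. x \<in> {0..1} \<Longrightarrow> (Y has_real_derivative r x * T2 x) (at x within {0..1})"
    and dT1: "\<And>x. x \<in> {0..1} \<Longrightarrow> (T1 has_real_derivative - r x * k x * T2 x) (at x within {0..1})"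
    and dT2: "\<And>x. x \<in> {0..1} \<Longrightarrow> (T2 has_real_derivative r x * k x * T1 x) (at x within {0..1})"
    and dk: "\<And>x. x \<in> {0..1} \<Longrightarrow> (k has_real_derivative r x * (c / 2) * T2 x) (at x within {0..1})"
    and c: "c * T1 0 = lam" and k01: "k 0 = 0" "k 1 = 0"
    and lam: "lam > 0" and bc: "X 0 = 0" "Y 0 = 0" "X 1 = l" and T20: "T2 0 > 0"
    and \<Phi>: "\<And>x. x \<in> {0..1} \<Longrightarrow> (\<Phi> has_real_derivative r x) (at x within {0..1})" "\<Phi> 0 = 0" "\<Phi> 1 > 0"
  obtains \<delta> q \<alpha> n where "\<delta> = 1 \<or> \<delta> = - 1" "1 / sqrt 2 < q" "q < 1" "\<alpha> > 0" "n \<ge> (1::nat)"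
    "\<alpha> * \<Phi> 1 = 2 * real n * ellK q" "lam = 2 * \<alpha>\<^sup>2 * (2 * q\<^sup>2 - 1)"
    "l * \<alpha> = \<delta> * 2 * real n * hh q"
    "\<And>x. x \<in> {0..1} \<Longrightarrow> X x = elastica_x \<delta> q \<alpha> (\<Phi> x)" "\<And>x. x \<in> {0..1} \<Longrightarrow> Y x = elastica_y q \<alpha> (\<Phi> x)"
proof -
  have u0: "(T1 0)\<^sup>2 + (T2 0)\<^sup>2 = 1" using unit[of 0] by simp
  have c0: "c \<noteq> 0" using c lam by auto
  define \<mu> where "\<mu> = lam / \<bar>c\<bar>"
  have T1\<mu>: "\<bar>T1 0\<bar> = \<mu>"
  proof -
    have "\<bar>c\<bar> * \<bar>T1 0\<bar> = lam" using c lam by (metis abs_mult abs_of_pos)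
    then show ?thesis using c0 by (simp add: \<mu>_def field_simps)
  qed
  have \<mu>: "0 < \<mu>" "\<mu> < 1"
  proof -
    show "0 < \<mu>" using lam c0 by (simp add: \<mu>_def)
    have "(T1 0)\<^sup>2 < 1" using u0 T20 by (smt (verit) zero_less_power2)
    then show "\<mu> < 1" unfolding T1\<mu>[symmetric] by (simp add: abs_square_less_1)
  qed
  \<comment> \<open>Arcs start with T1(0) = 1 - 2 q^2 < 0, and T1(0) has the sign of c because lam >
    0.\<close>
  define \<delta> where "\<delta> = (if c < 0 then 1 else - 1 :: real)"
  have \<delta>: "\<delta> = 1 \<or> \<delta> = - 1" "\<delta>\<^sup>2 = 1" and c\<delta>: "c = - \<delta> * \<bar>c\<bar>" by (auto simp: \<delta>_def)
  have T10: "T1 0 = - \<delta> * \<mu>"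
    using T1\<mu> c lam c0 by (auto simp: \<delta>_def \<mu>_def field_simps)
  \<comment> \<open>Forced by - \<delta> \<alpha>^2 = c / 2, the coefficient in the equation for
    k.\<close>
  define \<alpha> where "\<alpha> = sqrt (\<bar>c\<bar> / 2)"
  have \<alpha>: "\<alpha> > 0" "\<alpha>\<^sup>2 = \<bar>c\<bar> / 2" using c0 by (simp_all add: \<alpha>_def)
  \<comment> \<open>Forced by 2 q^2 - 1 = \<mu>, which matches the initial tangent.\<close>
  define q where "q = sqrt ((1 + \<mu>) / 2)"
  have q2: "q\<^sup>2 = (1 + \<mu>) / 2" using \<mu> by (simp add: q_def)
  have q: "1 / sqrt 2 < q" "q < 1"
  proof -
    show "q < 1" using \<mu> by (simp add: q_def)
    have "(1 / sqrt 2)\<^sup>2 < q\<^sup>2" unfolding q2 sqrt_half using \<mu> by simp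
    moreover have "0 \<le> q" unfolding q_def using \<mu> by simp
    ultimately show "1 / sqrt 2 < q" by (rule power_less_imp_less_base)
  qed
  have q0: "0 < q" using ge_sqrt_half_imp_pos[of q] q by simp
  have q1: "\<bar>q\<bar> < 1" using q q0 by simp
  define \<phi> where "\<phi> s = jam (\<alpha> * s - ellK q) q" for s
  define A where "A s = \<delta> * (1 - 2 * q\<^sup>2 * (sin (\<phi> s))\<^sup>2)" for s
  define B where "B s = - 2 * q * sin (\<phi> s) * ellD q (\<phi> s)" for s
  define \<kappa> where "\<kappa> s = - 2 * \<delta> * \<alpha> * q * cos (\<phi> s)" for s
  have \<alpha>': "\<alpha> \<noteq> 0" using \<alpha> by simp
  note ed = elastica_derivatives[OF q1 \<alpha>' \<delta>(2), folded \<phi>_def, folded A_def B_def \<kappa>_def]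
  have ch: "((\<lambda>x. f (\<Phi> x)) has_real_derivative d (\<Phi> x) * r x) (at x within {0..1})"
    if "\<And>s. (f has_real_derivative d s) (at s)" "x \<in> {0..1}" for f d x
    using DERIV_chain2[where f=f and g=\<Phi> and x=x and s="{0..1}", OF that(1) \<Phi>(1)[OF that(2)]] .
  have init: "T1 0 = A (\<Phi> 0)" "T2 0 = B (\<Phi> 0)" "k 0 = \<kappa> (\<Phi> 0)"
  proof -
    show "T1 0 = A (\<Phi> 0)" unfolding \<Phi>(2) ed(9) T10 q2 by (simp add: field_simps)
    show "k 0 = \<kappa> (\<Phi> 0)" unfolding \<Phi>(2) ed(11) k01 ..
    have "(T2 0)\<^sup>2 = (B 0)\<^sup>2"
    proof -
      have "(T2 0)\<^sup>2 = 1 - \<mu>\<^sup>2" using u0 \<delta>(2) by (simp add: T10 power_mult_distrib)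
      moreover have "(B 0)\<^sup>2 = 4 * q\<^sup>2 * (1 - q\<^sup>2)"
        unfolding ed(10) using \<mu> q2 by (simp add: power_mult_distrib)
      ultimately show ?thesis unfolding q2 by (simp add: field_simps power2_eq_square)
    qed
    moreover have "B 0 \<ge> 0" unfolding ed(10) using q0 \<mu> q2 by simp
    ultimately show "T2 0 = B (\<Phi> 0)" unfolding \<Phi>(2) using T20 by (simp add: power2_eq_iff_nonneg)
  qed
  have m: "- \<delta> * \<alpha>\<^sup>2 = c / 2" unfolding \<alpha>(2) by (simp only: times_divide_eq_right c\<delta>[symmetric])
  have same: "T1 x = A (\<Phi> x)" "T2 x = B (\<Phi> x)" "k x = \<kappa> (\<Phi> x)" if x: "x \<in> {0..1}" for x
  proof -
    have d1: "((\<lambda>x. A (\<Phi> x)) has_real_derivative - r x * \<kappa> (\<Phi> x) * B (\<Phi> x)) (at x within {0..1})" if "x \<in> {0..1}" for x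
      using ch[of A "\<lambda>s. - \<kappa> s * B s", OF ed(3) that] by (simp add: ac_simps)
    have d2: "((\<lambda>x. B (\<Phi> x)) has_real_derivative r x * \<kappa> (\<Phi> x) * A (\<Phi> x)) (at x within {0..1})" if "x \<in> {0..1}" for x
      using ch[of B "\<lambda>s. \<kappa> s * A s", OF ed(4) that] by (simp add: ac_simps)
    have d3: "((\<lambda>x. \<kappa> (\<Phi> x)) has_real_derivative r x * (c / 2) * B (\<Phi> x)) (at x within {0..1})" if "x \<in> {0..1}" for x
      using ch[of \<kappa> "\<lambda>s. (c / 2) * B s", OF ed(5)[unfolded m] that] by (simp add: ac_simps)
    show "T1 x = A (\<Phi> x)" "T2 x = B (\<Phi> x)" "k x = \<kappa> (\<Phi> x)"
      using elastica_ode_unique[OF r ed(6) dT1 dT2 dk d1 d2 d3 init x] by blast+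
  qed
  have Xe: "X x = elastica_x \<delta> q \<alpha> (\<Phi> x)" if "x \<in> {0..1}" for x
  proof (rule eq_of_equal_derivatives[OF dX _ _ that])
    show "((\<lambda>x. elastica_x \<delta> q \<alpha> (\<Phi> x)) has_real_derivative r x * T1 x) (at x within {0..1})" if x: "x \<in> {0..1}" for x
      using ch[OF ed(1) x] same(1)[OF x] by (simp add: mult.commute)
  qed (simp_all add: \<Phi>(2) ed(7) bc)
  have Ye: "Y x = elastica_y q \<alpha> (\<Phi> x)" if "x \<in> {0..1}" for x
  proof (rule eq_of_equal_derivatives[OF dY _ _ that])
    show "((\<lambda>x. elastica_y q \<alpha> (\<Phi> x)) has_real_derivative r x * T2 x) (at x within {0..1})" if x: "x \<in> {0..1}" for x
      using ch[OF ed(2) x] same(2)[OF x] by (simp add: mult.commute)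
  qed (simp_all add: \<Phi>(2) ed(8) bc)
  have "cos (\<phi> (\<Phi> 1)) = 0"
    using same(3)[of 1] k01 \<alpha> q0 \<delta> by (auto simp: \<kappa>_def)
  then obtain i :: int where i: "\<phi> (\<Phi> 1) = of_int i * pi + pi/2"
    using cos_zero_iff_int2 by blast
  have "\<alpha> * \<Phi> 1 - ellK q = (2 * of_int i + 1) * ellK q"
    using jam_unique(1)[OF q1, of "\<alpha> * \<Phi> 1 - ellK q"] ellF_odd_multiple[OF q1, of i] i by (simp add: \<phi>_def)
  then have len: "\<alpha> * \<Phi> 1 = 2 * of_int (i + 1) * ellK q" by (simp add: algebra_simps)
  have "0 < 2 * of_int (i + 1) * ellK q" unfolding len[symmetric] using \<alpha> \<Phi>(3) by simp
  then have i0: "i + 1 > 0" using ellK_pos[OF q1] by (simp add: zero_less_mult_iff)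
  \<comment> \<open>The amplitude starts at -pi/2, which has index -1, so i + 1 half periods of cn
    are traversed.\<close>
  define n where "n = nat (i + 1)"
  have n: "real n = of_int (i + 1)" "n \<ge> 1" using i0 by (simp_all add: n_def)
  have "l = \<delta> * (2 * ((2 * of_int i + 1) * ellEc q) + 2 * ellEc q - \<alpha> * \<Phi> 1) / \<alpha>"
    using Xe[of 1] bc ellE_odd_multiple[of i q] i by (simp add: elastica_x_def \<phi>_def)
  then have "l * \<alpha> = \<delta> * (2 * ((2 * of_int i + 1) * ellEc q) + 2 * ellEc q - \<alpha> * \<Phi> 1)"
    using \<alpha> by simp
  then have "l * \<alpha> = \<delta> * 2 * real n * hh q"
    unfolding len n(1) hh_def by (simp add: algebra_simps)
  moreover have "lam = 2 * \<alpha>\<^sup>2 * (2 * q\<^sup>2 - 1)"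
    unfolding \<alpha>(2) q2 using c0 by (simp add: \<mu>_def field_simps)
  ultimately show ?thesis
    using that[of \<delta> q \<alpha> n] \<delta>(1) q \<alpha>(1) n len Xe Ye by simp
qed

section \<open>Matching with shorter arcs, longer arcs and loops\<close>

lemma int_ge_n_lam:
  assumes lam: "lam > 0" "l > 0" and n: "n \<ge> 1" and le: "lam * l\<^sup>2 / (real n)\<^sup>2 \<le> lamhat"
  shows "int n \<ge> n_lam lam l"
proof -
  have "lam * l\<^sup>2 \<le> lamhat * (real n)\<^sup>2" using le n by (simp add: field_simps)
  then have "lam * l\<^sup>2 / lamhat \<le> (real n)\<^sup>2" using lamhat_pos by (simp add: field_simps)
  then have "sqrt (lam * l\<^sup>2 / lamhat) \<le> real n" by (intro real_le_lsqrt) auto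
  then show ?thesis unfolding n_lam_def by (simp add: ceiling_le_iff)
qed

text \<open>Since l, \<alpha> and n are positive, \<open>hh q\<close> has the sign of \<delta>,
  which puts q on one side of \<open>qstar\<close>; among the arcs \<open>qhat\<close> then decides.
  Eliminating \<alpha> from the equations for lam and l gives lam l^2 / n^2 = 8 (hh q)^2 (2 q^2 -
  1), which is \<open>gg q\<close>.\<close>

lemma special_curve_of_classification:
  assumes lam: "lam > 0" and l: "l > 0" and \<delta>: "\<delta> = 1 \<or> \<delta> = - 1" and q: "1 / sqrt 2 < q" "q < 1"
    and \<alpha>: "\<alpha> > 0" and n: "n \<ge> (1::nat)"
    and len: "\<alpha> * \<Phi> 1 = 2 * real n * ellK q" and lam_eq: "lam = 2 * \<alpha>\<^sup>2 * (2 * q\<^sup>2 - 1)"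
    and l_eq: "l * \<alpha> = \<delta> * 2 * real n * hh q"
    and rep: "reparam \<Phi> (\<Phi> 1)"
    and \<gamma>: "(\<forall>x\<in>{0..1}. \<gamma> x = (elastica_x \<delta> q \<alpha> (\<Phi> x), elastica_y q \<alpha> (\<Phi> x))) \<or>
      (\<forall>x\<in>{0..1}. \<gamma> x = reflx (elastica_x \<delta> q \<alpha> (\<Phi> x), elastica_y q \<alpha> (\<Phi> x)))"
  shows "(\<exists>n::nat. int n \<ge> n_lam lam l \<and> same_curve_upto \<gamma> (gamma_sarc lam l n) (sarc_len lam l n))
    \<or> (\<exists>n::nat. int n \<ge> n_lam lam l \<and> same_curve_upto \<gamma> (gamma_larc lam l n) (larc_len lam l n))
    \<or> (\<exists>n::nat. n \<ge> 1 \<and> same_curve_upto \<gamma> (gamma_loop lam l n) (loop_len lam l n))"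
proof -
  have q0: "0 < q" using ge_sqrt_half_imp_pos[of q] q by simp
  have n0: "real n > 0" using n by simp
  have h: "hh q = \<delta> * (l * \<alpha> / (2 * real n))"
    using l_eq n0 \<delta> by (auto simp: field_simps)
  have hpos: "l * \<alpha> / (2 * real n) > 0" using l \<alpha> n0 by simp
  have g: "lam * l\<^sup>2 / (real n)\<^sup>2 = gg q"
  proof -
    have "(hh q)\<^sup>2 = l\<^sup>2 * \<alpha>\<^sup>2 / (4 * (real n)\<^sup>2)"
      unfolding h using \<delta> by (auto simp: power_mult_distrib power_divide)
    then have a: "\<alpha>\<^sup>2 * l\<^sup>2 / (real n)\<^sup>2 = 4 * (hh q)\<^sup>2" using n0 by (simp add: field_simps)
    have "lam * l\<^sup>2 / (real n)\<^sup>2 = 2 * (2 * q\<^sup>2 - 1) * (\<alpha>\<^sup>2 * l\<^sup>2 / (real n)\<^sup>2)"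
      unfolding lam_eq by (simp add: ac_simps)
    then show ?thesis unfolding a gg_def hh_def[symmetric] by simp
  qed
  have L: "\<Phi> 1 = 2 * real n * ellK q / \<alpha>" using len \<alpha> by (simp add: field_simps)
  have same: "same_curve_upto \<gamma> (\<lambda>s. (elastica_x \<delta> q \<alpha> s, elastica_y q \<alpha> s)) (\<Phi> 1)"
    unfolding same_curve_upto_def using rep \<gamma> by blast
  show ?thesis
  proof (cases "\<delta> = 1")
    case True
    then have "hh q > 0" using h hpos by simp
    then have qs: "q < qstar" using qstar_props(3) qstar_props(5)[of q] q by (cases q qstar rule: linorder_cases) auto
    have al: "arc_alpha l n q = \<alpha>"
      using h True l n0 by (simp add: arc_alpha_def hh_def[symmetric])
    have nl: "int n \<ge> n_lam lam l"
      using int_ge_n_lam[OF lam l n] gg_le_lamhat[OF q(1) qs] g by simp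
    have curve: "arc_curve q \<alpha> = (\<lambda>s. (elastica_x \<delta> q \<alpha> s, elastica_y q \<alpha> s))"
      by (simp add: fun_eq_iff special_curves_eq True)
    show ?thesis
    proof (cases "q \<le> qhat")
      case True
      then have "sarc_q lam l n = q" unfolding sarc_q_def g using q1_gg q by blast
      then have "same_curve_upto \<gamma> (gamma_sarc lam l n) (sarc_len lam l n)"
        using same by (simp add: gamma_sarc_def sarc_len_def al curve L)
      then show ?thesis using nl by blast
    next
      case False
      then have "larc_q lam l n = q" unfolding larc_q_def g using q2_gg[of q] qs by simp
      then have "same_curve_upto \<gamma> (gamma_larc lam l n) (larc_len lam l n)"
        using same by (simp add: gamma_larc_def larc_len_def al curve L)
      then show ?thesis using nl by blast
    qed
  next
    case False
    then have \<delta>1: "\<delta> = - 1" using \<delta> by simp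
    then have hn: "hh q < 0" using h hpos by simp
    then have qs: "qstar < q" using qstar_props(3) qstar_props(4)[of q] q0 by (cases q qstar rule: linorder_cases) auto
    have "loop_alpha l n q = - (2 * real n / l * hh q)"
      by (simp add: loop_alpha_def hh_def algebra_simps)
    then have al: "loop_alpha l n q = \<alpha>" using h \<delta>1 l n0 by simp
    have curve: "loop_curve q \<alpha> = (\<lambda>s. (elastica_x \<delta> q \<alpha> s, elastica_y q \<alpha> s))"
      by (simp add: fun_eq_iff special_curves_eq \<delta>1)
    have "loop_q lam l n = q" unfolding loop_q_def g using q3_gg[OF qs q(2)] .
    then have "same_curve_upto \<gamma> (gamma_loop lam l n) (loop_len lam l n)"
      using same by (simp add: gamma_loop_def loop_len_def al curve L)
    then show ?thesis using n by blast
  qed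
qed

theorem theorem1p1:
  fixes lam l :: real and \<gamma> :: "real \<Rightarrow> real \<times> real"
  assumes "lam > 0" and "l > 0"
    and "\<gamma> \<in> A_adm l" and "pen_pinned_elastica lam l \<gamma>"
  shows "is_segment l \<gamma>
    \<or> (\<exists>n::nat. int n \<ge> n_lam lam l \<and> same_curve_upto \<gamma> (gamma_sarc lam l n) (sarc_len lam l n))
    \<or> (\<exists>n::nat. int n \<ge> n_lam lam l \<and> same_curve_upto \<gamma> (gamma_larc lam l n) (larc_len lam l n))
    \<or> (\<exists>n::nat. n \<ge> 1 \<and> same_curve_upto \<gamma> (gamma_loop lam l n) (loop_len lam l n))"
proof -
  note lam = assms(1) and l = assms(2)
  obtain r T1 T2 k c where r: "continuous_on {0..1} r" "\<And>x. x \<in> {0..1} \<Longrightarrow> r x > 0"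
    and unit: "\<And>x. x \<in> {0..1} \<Longrightarrow> (T1 x)\<^sup>2 + (T2 x)\<^sup>2 = 1"
    and dX: "\<And>x. x \<in> {0..1} \<Longrightarrow> ((\<lambda>x. fst (\<gamma> x)) has_real_derivative r x * T1 x) (at x within {0..1})"
    and dY: "\<And>x. x \<in> {0..1} \<Longrightarrow> ((\<lambda>x. snd (\<gamma> x)) has_real_derivative r x * T2 x) (at x within {0..1})"
    and dT1: "\<And>x. x \<in> {0..1} \<Longrightarrow> (T1 has_real_derivative - r x * k x * T2 x) (at x within {0..1})"
    and dT2: "\<And>x. x \<in> {0..1} \<Longrightarrow> (T2 has_real_derivative r x * k x * T1 x) (at x within {0..1})"
    and dk: "\<And>x. x \<in> {0..1} \<Longrightarrow> (k has_real_derivative r x * (c / 2) * T2 x) (at x within {0..1})"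
    and cT: "\<And>x. x \<in> {0..1} \<Longrightarrow> c * T1 x = lam - (k x)\<^sup>2" and k01: "k 0 = 0" "k 1 = 0"
    by (rule elastica_ode[OF assms(4) lam l]) (rule that; assumption)
  have bc: "\<gamma> 0 = (0, 0)" "\<gamma> 1 = (l, 0)" using assms(3) by (auto simp: A_adm_def)
  have c: "c * T1 0 = lam" using cT[of 0] k01 by simp
  \<comment> \<open>Arclength; it serves as the reparametrization in all cases.\<close>
  define \<Phi> where "\<Phi> x = integral {0..x} r" for x
  have d\<Phi>: "(\<Phi> has_real_derivative r x) (at x within {0..1})" if "x \<in> {0..1}" for x
    unfolding \<Phi>_def[abs_def] by (rule integral_has_real_derivative[OF r(1) that])
  have \<Phi>0: "\<Phi> 0 = 0" by (simp add: \<Phi>_def)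
  have \<Phi>1: "\<Phi> 1 > 0"
    unfolding \<Phi>_def by (rule integral_pos_of_continuous[where x=0]) (use r in \<open>auto simp: less_imp_le\<close>)
  have rep: "reparam \<Phi> (\<Phi> 1)"
    unfolding reparam_def using \<Phi>0 d\<Phi> r(2) by blast
  consider "T2 0 = 0" | "T2 0 > 0" | "T2 0 < 0" by linarith
  then show ?thesis
  proof cases
    case 1
    have T1sq: "(T1 0)\<^sup>2 = 1" using unit[of 0] 1 by simp
    \<comment> \<open>A horizontal tangent with zero curvature is an equilibrium of the system, so
      uniqueness applies with this constant solution. Below, l > 0 excludes the direction T1 =
      -1.\<close>
    have const: "T1 x = T1 0" "T2 x = 0" if "x \<in> {0..1}" for x
      using elastica_ode_unique[OF r _ dT1 dT2 dk, of "\<lambda>_. T1 0" "\<lambda>_. 0" "\<lambda>_. 0" x] T1sq 1 k01 that by auto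
    have X: "fst (\<gamma> x) = T1 0 * \<Phi> x" if "x \<in> {0..1}" for x
    proof (rule eq_of_equal_derivatives[OF dX _ _ that])
      show "((\<lambda>x. T1 0 * \<Phi> x) has_real_derivative r x * T1 x) (at x within {0..1})" if x: "x \<in> {0..1}" for x
        using DERIV_cmult[OF d\<Phi>[OF x], of "T1 0"] const[OF x] by (simp add: mult.commute)
    qed (simp_all add: bc \<Phi>0)
    have Y: "snd (\<gamma> x) = 0" if "x \<in> {0..1}" for x
    proof (rule eq_of_equal_derivatives[OF dY _ _ that])
      show "((\<lambda>x. 0) has_real_derivative r x * T2 x) (at x within {0..1})" if x: "x \<in> {0..1}" for x
        using const[OF x] by simp
    qed (simp_all add: bc)
    have "l = T1 0 * \<Phi> 1" using X[of 1] bc by simp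
    then have "T1 0 > 0" using l \<Phi>1 by (simp add: zero_less_mult_iff)
    then have "T1 0 = 1" using T1sq by (auto simp: power2_eq_1_iff)
    then have "\<Phi> 1 = l" "\<forall>x\<in>{0..1}. \<gamma> x = (\<Phi> x, 0)"
      using X Y \<open>l = T1 0 * \<Phi> 1\<close> by (auto simp: prod_eq_iff)
    then have "is_segment l \<gamma>" unfolding is_segment_def using rep by blast
    then show ?thesis by blast
  next
    case 2
    obtain \<delta> q \<alpha> n where *: "\<delta> = 1 \<or> \<delta> = - 1" "1 / sqrt 2 < q" "q < 1" "\<alpha> > 0" "n \<ge> (1::nat)"
      "\<alpha> * \<Phi> 1 = 2 * real n * ellK q" "lam = 2 * \<alpha>\<^sup>2 * (2 * q\<^sup>2 - 1)" "l * \<alpha> = \<delta> * 2 * real n * hh q"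
      and XY: "\<And>x. x \<in> {0..1} \<Longrightarrow> fst (\<gamma> x) = elastica_x \<delta> q \<alpha> (\<Phi> x)"
        "\<And>x. x \<in> {0..1} \<Longrightarrow> snd (\<gamma> x) = elastica_y q \<alpha> (\<Phi> x)"
      by (rule elastica_classification[OF r unit dX dY dT1 dT2 dk c k01 lam _ _ _ 2 d\<Phi> \<Phi>0 \<Phi>1, of l])
        (simp_all add: bc)
    have "\<forall>x\<in>{0..1}. \<gamma> x = (elastica_x \<delta> q \<alpha> (\<Phi> x), elastica_y q \<alpha> (\<Phi> x))"
      using XY by (simp add: prod_eq_iff)
    from special_curve_of_classification[OF lam l * rep disjI1[OF this]] show ?thesis by (rule disjI2)
  next
    case 3
    \<comment> \<open>The system is invariant under a change of sign of Y, T2 and k together, the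
      reflection across the x-axis; this reduces the case to the preceding one.\<close>
    have dY': "((\<lambda>x. - snd (\<gamma> x)) has_real_derivative r x * (- T2 x)) (at x within {0..1})" if "x \<in> {0..1}" for x
      using DERIV_minus[OF dY[OF that]] by simp
    have dT1': "(T1 has_real_derivative - r x * (- k x) * (- T2 x)) (at x within {0..1})" if "x \<in> {0..1}" for x
      using dT1[OF that] by simp
    have dT2': "((\<lambda>x. - T2 x) has_real_derivative r x * (- k x) * T1 x) (at x within {0..1})" if "x \<in> {0..1}" for x
      using DERIV_minus[OF dT2[OF that]] by simp
    have dk': "((\<lambda>x. - k x) has_real_derivative r x * (c / 2) * (- T2 x)) (at x within {0..1})" if "x \<in> {0..1}" for x
      using DERIV_minus[OF dk[OF that]] by simp
    have unit': "(T1 x)\<^sup>2 + (- T2 x)\<^sup>2 = 1" if "x \<in> {0..1}" for x using unit[OF that] by simp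
    have k01': "- k 0 = 0" "- k 1 = 0" using k01 by simp_all
    have T20: "- T2 0 > 0" using 3 by simp
    obtain \<delta> q \<alpha> n where *: "\<delta> = 1 \<or> \<delta> = - 1" "1 / sqrt 2 < q" "q < 1" "\<alpha> > 0" "n \<ge> (1::nat)"
      "\<alpha> * \<Phi> 1 = 2 * real n * ellK q" "lam = 2 * \<alpha>\<^sup>2 * (2 * q\<^sup>2 - 1)" "l * \<alpha> = \<delta> * 2 * real n * hh q"
      and XY: "\<And>x. x \<in> {0..1} \<Longrightarrow> fst (\<gamma> x) = elastica_x \<delta> q \<alpha> (\<Phi> x)"
        "\<And>x. x \<in> {0..1} \<Longrightarrow> - snd (\<gamma> x) = elastica_y q \<alpha> (\<Phi> x)"
      by (rule elastica_classification[OF r unit' dX dY' dT1' dT2' dk' c k01' lam _ _ _ T20 d\<Phi> \<Phi>0 \<Phi>1, of l])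
        (simp_all add: bc)
    have "\<forall>x\<in>{0..1}. \<gamma> x = reflx (elastica_x \<delta> q \<alpha> (\<Phi> x), elastica_y q \<alpha> (\<Phi> x))"
      using XY by (auto simp: prod_eq_iff reflx_def simp flip: XY(2))
    from special_curve_of_classification[OF lam l * rep disjI2[OF this]] show ?thesis by (rule disjI2)
  qed
qed

end
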